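(* Let $q$ be a prime power. (i) For each integer $n \geq 1$, there is a sequence $(q_1, q_2, \dots, q_n)$ of powers of $q$ with $q_1 = q$ such that $\mathrm{Aut}(T_{2q_1}) \times \dots \times \mathrm{Aut}(T_{2q_n})$ contains an infinite strictly ascending chain of cocompact vertex-transitive lattices, each of which has non-discrete projection to $\prod_{i\in I}\mathrm{Aut}(T_{2q_i})$ for every non-empty proper subset $I \subsetneq \{1,\dots,n\}$. (ii) If $q \geq 3$, then $\mathrm{Aut}(T_{2q}) \times \mathrm{Aut}(T_{2q})$ contains an infinite strictly ascending chain of cocompact vertex-transitive lattices, each of which has non-discrete projections on both factors.
   Context: $T_k$ denotes the $k$-regular tree (every vertex has degree $k$). The automorphism group of a locally finite connected graph carries the topology of pointwise convergence on vertices, and products carry the product topology. A lattice in a locally compact group $G$ is a discrete subgroup $\Gamma$ such that $G/\Gamma$ carries a finite $G$-invariant measure; it is cocompact if $G/\Gamma$ is compact. "Power of $q$" means $q^e$ with $e \geq 1$ an integer. A subgroup of a product of tree automorphism groups is vertex-transitive if it acts transitively on the product of the vertex sets of the trees. *)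

theory Defs
  imports
    "HOL-Analysis.Analysis"
    "HOL-Algebra.Bij"
    "HOL-Algebra.Left_Coset"
    "HOL-Algebra.Product_Groups"
    "HOL-Number_Theory.Prime_Powers"
    "Graph_Theory.Graph_Theory"
begin

section \<open>Regular trees\<close>

text \<open>
  A simple graph, possibly infinite, is a symmetric loop-free digraph without parallel arcs:
  every edge is a pair of opposite arcs. In this encoding the walk that traverses an edge and
  returns is a cycle of length 2 in the sense of \<^const>\<open>pre_digraph.cycle\<close>, so
  \<^const>\<open>Digraph_Component.forest\<close> would exclude all edges. The cycles of the simple graph
  are the directed cycles of length at least 3.
\<close>

definition simple_tree :: "'v pair_pre_digraph \<Rightarrow> bool" where
  "simple_tree T \<longleftrightarrow>
     pair_bidirected_digraph T \<and>
     Digraph_Component.connected (with_proj T) \<and>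
     \<not> (\<exists>p. pre_digraph.cycle (with_proj T) p \<and> length p \<ge> 3)"

definition regular_tree :: "nat \<Rightarrow> 'v pair_pre_digraph \<Rightarrow> bool" where
  "regular_tree k T \<longleftrightarrow>
     simple_tree T \<and>
     (\<forall>v\<in>pverts T. finite (out_arcs (with_proj T) v) \<and> out_degree (with_proj T) v = k)"


section \<open>Automorphism groups of graphs\<close>

text \<open>
  As in \<^const>\<open>BijGroup\<close>, automorphisms are extensional functions, so that they are points of
  \<^const>\<open>product_topology\<close>.
\<close>

definition graph_auts :: "'v pair_pre_digraph \<Rightarrow> ('v \<Rightarrow> 'v) set" where
  "graph_auts T =
     {f \<in> Bij (pverts T). \<forall>u\<in>pverts T. \<forall>v\<in>pverts T. (f u, f v) \<in> parcs T \<longleftrightarrow> (u, v) \<in> parcs T}"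

definition aut_group :: "'v pair_pre_digraph \<Rightarrow> ('v \<Rightarrow> 'v) monoid" where
  "aut_group T = BijGroup (pverts T) \<lparr>carrier := graph_auts T\<rparr>"

definition aut_topology :: "'v pair_pre_digraph \<Rightarrow> ('v \<Rightarrow> 'v) topology" where
  "aut_topology T =
     subtopology (product_topology (\<lambda>_. discrete_topology (pverts T)) (pverts T)) (graph_auts T)"

lemma carrier_aut_group [simp]: "carrier (aut_group T) = graph_auts T"
  by (simp add: aut_group_def)

lemma topspace_aut_topology [simp]: "topspace (aut_topology T) = graph_auts T"
  by (auto simp: aut_topology_def graph_auts_def Bij_def PiE_def bij_betw_def)

lemma group_aut_group: "group (aut_group T)"
proof -
  let ?V = "pverts T"
  interpret B: group "BijGroup ?V" by (rule group_BijGroup)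
  have "subgroup (graph_auts T) (BijGroup ?V)"
  proof (rule B.subgroupI)
    show "graph_auts T \<subseteq> carrier (BijGroup ?V)"
      by (auto simp: graph_auts_def BijGroup_def)
    show "graph_auts T \<noteq> {}"
      using id_Bij[of ?V] by (auto simp: graph_auts_def intro!: exI[of _ "\<lambda>x\<in>?V. x"])
  next
    fix f assume f: "f \<in> graph_auts T"
    then have fB: "f \<in> Bij ?V" by (simp add: graph_auts_def)
    then have inv: "inv\<^bsub>BijGroup ?V\<^esub> f = (\<lambda>x\<in>?V. inv_into ?V f x)" by (rule inv_BijGroup)
    have mem: "inv_into ?V f u \<in> ?V" "f (inv_into ?V f u) = u" if "u \<in> ?V" for u
      using fB that by (auto simp: Bij_inv_into_mem Bij_def bij_betw_def intro: f_inv_into_f)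
    show "inv\<^bsub>BijGroup ?V\<^esub> f \<in> graph_auts T"
      unfolding inv graph_auts_def
    proof (intro CollectI conjI ballI)
      show "(\<lambda>x\<in>?V. inv_into ?V f x) \<in> Bij ?V" by (rule restrict_inv_into_Bij[OF fB])
      fix u v assume uv: "u \<in> ?V" "v \<in> ?V"
      have "(f (inv_into ?V f u), f (inv_into ?V f v)) \<in> parcs T
              \<longleftrightarrow> (inv_into ?V f u, inv_into ?V f v) \<in> parcs T"
        using f mem uv unfolding graph_auts_def by blast
      then show "((\<lambda>x\<in>?V. inv_into ?V f x) u, (\<lambda>x\<in>?V. inv_into ?V f x) v) \<in> parcs T
              \<longleftrightarrow> (u, v) \<in> parcs T"
        using mem uv by simp
    qed
  next
    fix f g assume fg: "f \<in> graph_auts T" "g \<in> graph_auts T"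
    then have B: "f \<in> Bij ?V" "g \<in> Bij ?V" by (auto simp: graph_auts_def)
    have "g v \<in> ?V" if "v \<in> ?V" for v
      using Bij_imp_funcset[OF B(2)] that by auto
    then show "f \<otimes>\<^bsub>BijGroup ?V\<^esub> g \<in> graph_auts T"
      using fg B by (auto simp: BijGroup_def graph_auts_def compose_Bij compose_eq)
  qed
  then show ?thesis
    unfolding aut_group_def by (rule B.subgroup_imp_group)
qed


section \<open>Lattices in topological groups\<close>

text \<open>The quotient topology on the set of left cosets, for a topology on the carrier of a group.\<close>

definition coset_topology ::
    "('a, 'b) monoid_scheme \<Rightarrow> 'a topology \<Rightarrow> 'a set \<Rightarrow> 'a set topology" where
  "coset_topology G \<tau> H =
     topology (\<lambda>U. U \<subseteq> lcosets\<^bsub>G\<^esub> H \<and> openin \<tau> {g \<in> carrier G. g <#\<^bsub>G\<^esub> H \<in> U})"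

lemma openin_coset_topology:
  "openin (coset_topology G \<tau> H) U \<longleftrightarrow>
     U \<subseteq> lcosets\<^bsub>G\<^esub> H \<and> openin \<tau> {g \<in> carrier G. g <#\<^bsub>G\<^esub> H \<in> U}"
proof -
  have "istopology (\<lambda>U. U \<subseteq> lcosets\<^bsub>G\<^esub> H \<and> openin \<tau> {g \<in> carrier G. g <#\<^bsub>G\<^esub> H \<in> U})"
    (is "istopology ?P")
    unfolding istopology_def
  proof (intro conjI allI impI)
    fix S U assume "?P S" "?P U"
    moreover have "{g \<in> carrier G. g <#\<^bsub>G\<^esub> H \<in> S \<inter> U} =
        {g \<in> carrier G. g <#\<^bsub>G\<^esub> H \<in> S} \<inter> {g \<in> carrier G. g <#\<^bsub>G\<^esub> H \<in> U}" by auto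
    ultimately show "openin \<tau> {g \<in> carrier G. g <#\<^bsub>G\<^esub> H \<in> S \<inter> U}" by (simp only: openin_Int)
    from \<open>?P S\<close> show "S \<inter> U \<subseteq> lcosets\<^bsub>G\<^esub> H" by auto
  next
    fix K assume K: "\<forall>U\<in>K. ?P U"
    have "{g \<in> carrier G. g <#\<^bsub>G\<^esub> H \<in> \<Union>K} = (\<Union>U\<in>K. {g \<in> carrier G. g <#\<^bsub>G\<^esub> H \<in> U})" by auto
    also have "openin \<tau> \<dots>" using K by auto
    finally show "openin \<tau> {g \<in> carrier G. g <#\<^bsub>G\<^esub> H \<in> \<Union>K}" .
    show "\<Union>K \<subseteq> lcosets\<^bsub>G\<^esub> H" using K by auto
  qed
  then show ?thesis
    by (simp add: coset_topology_def topology_inverse')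
qed

lemma topspace_coset_topology:
  assumes "topspace \<tau> = carrier G"
  shows "topspace (coset_topology G \<tau> H) = lcosets\<^bsub>G\<^esub> H"
proof -
  have "{g \<in> carrier G. g <#\<^bsub>G\<^esub> H \<in> lcosets\<^bsub>G\<^esub> H} = topspace \<tau>"
    using assms by (auto simp: LCOSETS_def)
  then have "openin (coset_topology G \<tau> H) (lcosets\<^bsub>G\<^esub> H)"
    by (simp add: openin_coset_topology)
  then show ?thesis
    by (metis openin_coset_topology openin_subset openin_topspace subset_antisym)
qed

lemma quotient_map_coset_topology:
  assumes "topspace \<tau> = carrier G"
  shows "quotient_map \<tau> (coset_topology G \<tau> H) (\<lambda>g. g <#\<^bsub>G\<^esub> H)"
  using assms by (auto simp: quotient_map_def topspace_coset_topology openin_coset_topology LCOSETS_def)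

definition discrete_in :: "'a topology \<Rightarrow> 'a set \<Rightarrow> bool" where
  "discrete_in \<tau> S \<longleftrightarrow> subtopology \<tau> S = discrete_topology S"

text \<open>A finite invariant measure is required to be nonzero, and it is a Borel measure.\<close>

definition finite_invariant_measure ::
    "('a, 'b) monoid_scheme \<Rightarrow> 'a topology \<Rightarrow> 'a set \<Rightarrow> 'a set measure \<Rightarrow> bool" where
  "finite_invariant_measure G \<tau> H M \<longleftrightarrow>
     sets M = sets (sigma (lcosets\<^bsub>G\<^esub> H) {U. openin (coset_topology G \<tau> H) U}) \<and>
     finite_measure M \<and>
     emeasure M (space M) \<noteq> 0 \<and>
     (\<forall>g\<in>carrier G. \<forall>A\<in>sets M. emeasure M ((\<lambda>C. g <#\<^bsub>G\<^esub> C) ` A) = emeasure M A)"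

definition lattice_in :: "('a, 'b) monoid_scheme \<Rightarrow> 'a topology \<Rightarrow> 'a set \<Rightarrow> bool" where
  "lattice_in G \<tau> H \<longleftrightarrow>
     subgroup H G \<and> discrete_in \<tau> H \<and> (\<exists>M. finite_invariant_measure G \<tau> H M)"

definition cocompact_lattice_in :: "('a, 'b) monoid_scheme \<Rightarrow> 'a topology \<Rightarrow> 'a set \<Rightarrow> bool" where
  "cocompact_lattice_in G \<tau> H \<longleftrightarrow> lattice_in G \<tau> H \<and> compact_space (coset_topology G \<tau> H)"


section \<open>Products of automorphism groups\<close>

definition prod_aut_group ::
    "'i set \<Rightarrow> ('i \<Rightarrow> 'v pair_pre_digraph) \<Rightarrow> ('i \<Rightarrow> 'v \<Rightarrow> 'v) monoid" where
  "prod_aut_group I T = product_group I (\<lambda>i. aut_group (T i))"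

definition prod_aut_topology ::
    "'i set \<Rightarrow> ('i \<Rightarrow> 'v pair_pre_digraph) \<Rightarrow> ('i \<Rightarrow> 'v \<Rightarrow> 'v) topology" where
  "prod_aut_topology I T = product_topology (\<lambda>i. aut_topology (T i)) I"

lemma group_prod_aut_group: "group (prod_aut_group I T)"
  by (simp add: prod_aut_group_def group_aut_group)

lemma topspace_prod_aut_topology:
  "topspace (prod_aut_topology I T) = carrier (prod_aut_group I T)"
  by (simp add: prod_aut_topology_def prod_aut_group_def)

definition vertex_transitive ::
    "'i set \<Rightarrow> ('i \<Rightarrow> 'v pair_pre_digraph) \<Rightarrow> ('i \<Rightarrow> 'v \<Rightarrow> 'v) set \<Rightarrow> bool" where
  "vertex_transitive I T H \<longleftrightarrow>
     (\<forall>x \<in> (\<Pi>\<^sub>E i\<in>I. pverts (T i)). \<forall>y \<in> (\<Pi>\<^sub>E i\<in>I. pverts (T i)).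
        \<exists>h\<in>H. \<forall>i\<in>I. h i (x i) = y i)"

definition ascending_lattice_chain ::
    "'i set \<Rightarrow> ('i \<Rightarrow> 'v pair_pre_digraph) \<Rightarrow> (nat \<Rightarrow> ('i \<Rightarrow> 'v \<Rightarrow> 'v) set) \<Rightarrow> bool" where
  "ascending_lattice_chain I T \<Gamma> \<longleftrightarrow>
     (\<forall>m. cocompact_lattice_in (prod_aut_group I T) (prod_aut_topology I T) (\<Gamma> m) \<and>
          vertex_transitive I T (\<Gamma> m) \<and>
          \<Gamma> m \<subset> \<Gamma> (Suc m))"

end

(*
  Let A be the localisation of (Z/b)[x] at finitely many monic polynomials p_i, r_i, s that are
  pairwise coprime modulo b, with r_1 = 1, degree r_i = degree p_i for i > 1 and p_1 a power of x.
  The element t_i = p_i / r_i has a zero at p_i and a pole at r_i (at infinity for i = 1), and it is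
  a unit at all other places under consideration. Let O_i be the ring of elements regular at the
  zeros and poles of t_i. The cosets of the O_i-modules t_i^c O_i form a 2 b^(deg p_i)-regular graph
  X_i, in which a coset of t_i^c O_i is joined to the cosets of t_i^(c+1) O_i and t_i^(c-1) O_i that
  it meets.
  The elements of A with poles of order at most m at s form a subgroup K_m, and the group generated
  by K_m and the t_i acts on the product of the X_i, transitively on vertices by strong
  approximation and with finite stabilisers. All lifts of this action to the universal covers T_i
  form a cocompact lattice Gamma_m, and the element 1/s^(m+1) shows that Gamma_m increases strictly.
  The lifts of the powers of t_j that fix base vertices in all coordinates other than j give
  arbitrarily small nontrivial elements in these coordinates.
*)

theory Submission
  imports Defs "HOL-Computational_Algebra.Computational_Algebra"
begin

section \<open>Coverings of graphs by trees\<close>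

text \<open>The coefficient ring Z/b need not be a field: for \<open>b = 9\<close>, say, Z/9 takes
  the place of the field with nine elements. What survives is enough: monic polynomials can be
  divided by and cancelled modulo \<open>b\<close>, and Bezout identities replace coprimality. The
  reduction is never carried out. All elements stay in the fraction field of Z[x], where multiples
  of \<open>b\<close> act trivially on every graph. The graphs contain cycles, so trees enter only
  as universal covers, and a group acting on the graphs has to be replaced by the group of its
  lifts. The invariant measure comes from counting rather than from a Haar measure: a vertex
  stabiliser is compact and open and, by transitivity, meets every coset of the lattice, so
  proportions of small cosets inside it define a premeasure. In (ii) both factors must have the same
  degree, which requires two zeros and two poles of equal size. The projective line over the field
  with two elements has three rational points only, whence \<open>q \<ge> 3\<close>; for larger even
  \<open>q\<close> the missing point is replaced by a place of degree \<open>e\<close> modulo 2,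
  where \<open>q = 2 ^ e\<close>.\<close>

definition nbrs :: "'v pair_pre_digraph \<Rightarrow> 'v \<Rightarrow> 'v set" where
  "nbrs T u = {w. (u, w) \<in> parcs T}"

definition tdist :: "'v pair_pre_digraph \<Rightarrow> 'v \<Rightarrow> 'v \<Rightarrow> nat" where
  "tdist T v u = (LEAST k. (v, u) \<in> parcs T ^^ k)"

locale tree_graph =
  fixes T :: "'v pair_pre_digraph"
  assumes tree: "simple_tree T"
begin

abbreviation "V \<equiv> pverts T"
abbreviation "N \<equiv> nbrs T"

lemma bidirected: "pair_bidirected_digraph T"
  using tree by (simp add: simple_tree_def)

lemma nbrs_verts:
  assumes "w \<in> N u"
  shows "w \<in> V" "u \<in> V"
proof -
  interpret pair_bidirected_digraph T by (rule bidirected)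
  show "w \<in> V" "u \<in> V"
    using assms in_arcsD1 in_arcsD2 unfolding nbrs_def by auto
qed

lemma nbrs_sym: "w \<in> N u \<longleftrightarrow> u \<in> N w"
proof -
  interpret pair_bidirected_digraph T by (rule bidirected)
  show ?thesis
    using pair_sym_arcs unfolding nbrs_def symmetric_def sym_def by auto
qed

lemma nbrs_irrefl: "u \<notin> N u"
proof -
  interpret pair_bidirected_digraph T by (rule bidirected)
  show ?thesis using pair_no_loops unfolding nbrs_def by fastforce
qed

lemma verts_nonempty: "V \<noteq> {}"
  using tree unfolding simple_tree_def connected_conv by auto

section \<open>Connectedness, distance from a root, and parents\<close>

lemma parcs_rtrancl:
  assumes "u \<in> V" "v \<in> V"
  shows "(u, v) \<in> (parcs T)\<^sup>*"
proof -
  have "(u, v) \<in> rtrancl_on V ((parcs T)\<^sup>s)"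
    using tree assms unfolding simple_tree_def connected_conv by auto
  moreover have "(parcs T)\<^sup>s = parcs T"
    using nbrs_sym unfolding symcl_def nbrs_def by auto
  ultimately show ?thesis
    using rtrancl_on_rtranclI[of u v V "parcs T"] by simp
qed

lemma connected_induct [consumes 2, case_names base step]:
  assumes "u \<in> V" "v \<in> V" "P v"
    and "\<And>u w. u \<in> V \<Longrightarrow> P u \<Longrightarrow> w \<in> N u \<Longrightarrow> P w"
  shows "P u"
  using parcs_rtrancl[OF \<open>v \<in> V\<close> \<open>u \<in> V\<close>]
proof (induction rule: rtrancl_induct)
  case (step y z)
  then have z: "z \<in> N y" by (simp add: nbrs_def)
  from nbrs_verts(2)[OF z] step(3) z show ?case by (rule assms(4))
qed (rule assms(3))

lemma tdist_relpow:
  assumes "u \<in> V" "v \<in> V"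
  shows "(v, u) \<in> parcs T ^^ tdist T v u"
  unfolding tdist_def using parcs_rtrancl[OF assms(2,1)] by (auto simp: rtrancl_power intro: LeastI_ex)

lemma tdist_le: "(v, u) \<in> parcs T ^^ k \<Longrightarrow> tdist T v u \<le> k"
  unfolding tdist_def by (rule Least_le)

lemma tdist_self [simp]: "tdist T v v = 0"
  using tdist_le[of v v 0] by simp

lemma tdist_eq_0:
  assumes "u \<in> V" "v \<in> V" "tdist T v u = 0"
  shows "u = v"
  using tdist_relpow[OF assms(1,2)] assms(3) by simp

lemma tdist_nbr_le:
  assumes "v \<in> V" "w \<in> N u"
  shows "tdist T v w \<le> Suc (tdist T v u)"
proof -
  have "(v, u) \<in> parcs T ^^ tdist T v u"
    using assms nbrs_verts by (intro tdist_relpow) auto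
  then have "(v, w) \<in> parcs T ^^ Suc (tdist T v u)"
    using assms by (auto simp: nbrs_def)
  then show ?thesis by (rule tdist_le)
qed

lemma tdist_pred:
  assumes "v \<in> V" "u \<in> V" "tdist T v u = Suc k"
  obtains w where "w \<in> N u" "tdist T v w = k"
proof -
  obtain w where w: "(v, w) \<in> parcs T ^^ k" "(w, u) \<in> parcs T"
    using tdist_relpow[OF assms(2,1)] assms(3) by (auto elim: relpow_Suc_E)
  then have "w \<in> N u" using nbrs_sym by (auto simp: nbrs_def)
  moreover have "tdist T v w \<le> k" using w by (intro tdist_le)
  moreover have "Suc k \<le> Suc (tdist T v w)"
    using assms nbrs_sym[of w u] \<open>w \<in> N u\<close> tdist_nbr_le[of v u w] by auto
  ultimately show ?thesis using that by auto
qed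

text \<open>
  Two neighbours of \<open>u\<close> that are not farther from the root than \<open>u\<close> would be joined by a path
  avoiding \<open>u\<close>, and closing it up at \<open>u\<close> gives a cycle.
\<close>

lemma tdist_nbr_unique:
  assumes v: "v \<in> V" and w: "w \<in> N u" "tdist T v w \<le> tdist T v u"
    and w': "w' \<in> N u" "tdist T v w' \<le> tdist T v u"
  shows "w = w'"
proof (rule ccontr)
  assume ne: "w \<noteq> w'"
  define R where "R = {(a, b) \<in> parcs T. a \<noteq> u \<and> b \<noteq> u}"
  define H where "H = \<lparr>pverts = V - {u}, parcs = R\<rparr>"
  \<comment> \<open>Going back along predecessors the distance drops strictly below that of
    \<open>u\<close>, so the path never meets \<open>u\<close>.\<close>
  have reach: "(v, x) \<in> R\<^sup>*" if "x \<in> V" "x \<noteq> u" "tdist T v x \<le> tdist T v u" for x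
    using that
  proof (induction "tdist T v x" arbitrary: x)
    case 0
    then show ?case using tdist_eq_0[OF \<open>x \<in> V\<close> v] by simp
  next
    case (Suc k)
    then obtain y where y: "y \<in> N x" "tdist T v y = k"
      using tdist_pred[OF v \<open>x \<in> V\<close>] by metis
    have "y \<noteq> u" using Suc y by auto
    moreover have "(v, y) \<in> R\<^sup>*"
      using Suc y \<open>y \<noteq> u\<close> nbrs_verts by (intro Suc(1)) auto
    moreover have "(y, x) \<in> R"
      using y \<open>y \<noteq> u\<close> Suc.prems nbrs_sym unfolding R_def nbrs_def by auto
    ultimately show ?case by auto
  qed
  have symR: "sym R"
    using nbrs_sym unfolding R_def sym_def nbrs_def by auto
  have wV: "w \<in> V - {u}" "w' \<in> V - {u}"
    using w w' nbrs_verts nbrs_irrefl by blast+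
  have "(w, w') \<in> R\<^sup>*"
  proof -
    have "(v, w) \<in> R\<^sup>*" "(v, w') \<in> R\<^sup>*"
      using reach[of w] reach[of w'] wV w w' by auto
    then show ?thesis
      using symD[OF sym_rtrancl[OF symR]] rtrancl_trans by metis
  qed
  interpret H: pair_wf_digraph H
    by unfold_locales (use nbrs_verts in \<open>auto simp: H_def R_def nbrs_def\<close>)
  have RH: "R = parcs H" "pverts H = V - {u}" by (simp_all add: H_def)
  have "w \<rightarrow>\<^sup>*\<^bsub>with_proj H\<^esub> w'"
    using H.reachable_conv'[of w w'] \<open>(w, w') \<in> R\<^sup>*\<close> wV by (simp add: H_def)
  then obtain p where p: "H.apath w p w'"
    using H.reachable_apath by blast
  have p1: "set p \<subseteq> R" "pcas w p w'" "distinct (pawalk_verts w p)"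
    using p unfolding RH(1) by (simp_all only: H.apath_def H.awalk_def)
  have p2: "set (pawalk_verts w p) \<subseteq> V - {u}"
    using p by (metis H.apath_def H.awalk_conv RH(2))
  have "p \<noteq> []" using p1 ne by auto
  interpret pair_bidirected_digraph T by (rule bidirected)
  have cas_app: "pcas a (p @ [(w', u)]) u" if "pcas a p w'" for a
    using that by (induction p arbitrary: a) auto
  have verts_app: "pawalk_verts a (p @ [(w', u)]) = pawalk_verts a p @ [u]" if "pcas a p w'" for a
    using that by (induction p arbitrary: a) auto
  let ?c = "(u, w) # p @ [(w', u)]"
  have "awalk u ?c u"
    using cas_app[OF p1(2)] p1(1) w w' nbrs_verts nbrs_sym[of w' u]
    by (auto simp: awalk_def R_def nbrs_def)
  moreover have "distinct (tl (pawalk_verts u ?c))"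
    using verts_app[OF p1(2)] p1(3) p2 by auto
  ultimately have "cycle ?c"
    unfolding cycle_def by auto
  \<comment> \<open>The path between \<open>w\<close> and \<open>w'\<close> is nonempty, so this is
    a genuine cycle and not the closed walk of length 2 along an edge.\<close>
  moreover have "length ?c \<ge> 3" using \<open>p \<noteq> []\<close> by (cases p) auto
  ultimately show False
    using tree unfolding simple_tree_def by blast
qed

lemma parent_ex1:
  assumes "v \<in> V" "u \<in> V" "u \<noteq> v"
  shows "\<exists>!w. w \<in> N u \<and> tdist T v w \<le> tdist T v u"
proof -
  obtain k where "tdist T v u = Suc k"
    using assms tdist_eq_0 by (cases "tdist T v u") auto
  then obtain w where "w \<in> N u" "tdist T v w = k" "k \<le> tdist T v u"
    using tdist_pred[OF assms(1,2)] by (metis le_SucI order_refl)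
  then show ?thesis using tdist_nbr_unique[OF assms(1)] by (intro ex1I[of _ w]) auto
qed

definition parent :: "'v \<Rightarrow> 'v \<Rightarrow> 'v" where
  "parent v u = (THE w. w \<in> N u \<and> tdist T v w \<le> tdist T v u)"

lemma parent:
  assumes "v \<in> V" "u \<in> V" "u \<noteq> v"
  shows "parent v u \<in> N u" "tdist T v u = Suc (tdist T v (parent v u))"
proof -
  have *: "parent v u \<in> N u \<and> tdist T v (parent v u) \<le> tdist T v u"
    unfolding parent_def by (rule theI'[OF parent_ex1[OF assms]])
  then show "parent v u \<in> N u" by simp
  obtain k where k: "tdist T v u = Suc k"
    using assms tdist_eq_0 by (cases "tdist T v u") auto
  then obtain w where "w \<in> N u" "tdist T v w = k"
    using tdist_pred[OF assms(1,2)] by metis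
  then have "w = parent v u"
    using * tdist_nbr_unique[OF assms(1)] k by auto
  then show "tdist T v u = Suc (tdist T v (parent v u))"
    using k \<open>tdist T v w = k\<close> by simp
qed

text \<open>Only the parent is at most as far from the root as \<open>u\<close>; every other
  neighbour is farther and therefore has \<open>u\<close> as its own parent. The root is treated
  apart because \<open>parent v v\<close> has no meaning.\<close>

lemma child:
  assumes v: "v \<in> V" and w: "w \<in> N u" and ne: "u = v \<or> w \<noteq> parent v u"
  shows "w \<noteq> v" "parent v w = u"
proof -
  note uw = nbrs_verts[OF w]
  have le: "tdist T v u \<le> tdist T v w"
  proof (cases "u = v")
    case False
    note p = parent[OF v uw(2) False]
    have "\<not> tdist T v w \<le> tdist T v u"
    proof
      assume "tdist T v w \<le> tdist T v u"
      then have "w = parent v u" using tdist_nbr_unique[OF v w _ p(1)] p(2) by simp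
      then show False using ne False by simp
    qed
    then show ?thesis by simp
  qed simp
  show "w \<noteq> v"
  proof
    assume "w = v"
    then have "tdist T v u = 0" using le by simp
    then show False using tdist_eq_0[OF uw(2) v] \<open>w = v\<close> w nbrs_irrefl by auto
  qed
  then have p: "parent v w \<in> N w" "tdist T v (parent v w) \<le> tdist T v w"
    using parent[OF v uw(1)] by auto
  have "u \<in> N w" using w nbrs_sym[of w u] by simp
  then show "parent v w = u"
    using tdist_nbr_unique[OF v p(1,2) _ le] by simp
qed

text \<open>
  A locally bijective map is built along the tree, one vertex at a time: the neighbours of a vertex
  are mapped once its parent is. The relation \<open>C\<close> expresses what has to be preserved; it is
  trivial when a covering is constructed and commutation with two coverings when a map is lifted.
\<close>

lemma locally_bijective_map_exists:
  assumes v: "v \<in> V" and C0: "C v x0"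
    and root: "\<And>u x. u \<in> V \<Longrightarrow> C u x \<Longrightarrow> \<exists>\<beta>. bij_betw \<beta> (N u) (E x) \<and> (\<forall>w\<in>N u. C w (\<beta> w))"
    and nonroot: "\<And>u x p y. u \<in> V \<Longrightarrow> C u x \<Longrightarrow> p \<in> N u \<Longrightarrow> C p y \<Longrightarrow> y \<in> E x \<Longrightarrow>
        \<exists>\<beta>. bij_betw \<beta> (N u) (E x) \<and> (\<forall>w\<in>N u. C w (\<beta> w)) \<and> \<beta> p = y"
    and sym: "\<And>u x y. u \<in> V \<Longrightarrow> C u x \<Longrightarrow> y \<in> E x \<Longrightarrow> x \<in> E y"
  shows "\<exists>f. f v = x0 \<and> (\<forall>u\<in>V. C u (f u) \<and> bij_betw f (N u) (E (f u)))"
proof -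
  \<comment> \<open>The last conjunct makes the choice at \<open>u\<close> compatible with the value
    already given to its parent; the root has no parent to respect.\<close>
  define P where "P u x p y \<beta> \<longleftrightarrow> bij_betw \<beta> (N u) (E x) \<and> (\<forall>w\<in>N u. C w (\<beta> w)) \<and> (u \<noteq> v \<longrightarrow> \<beta> p = y)"
    for u x p y \<beta>
  define B where "B u x p y = (SOME \<beta>. P u x p y \<beta>)" for u x p y
  define step where "step F u = (let p = parent v u in
      B p (F p) (parent v p) (F (parent v p)) u)" for F u
  \<comment> \<open>Stage \<open>n\<close> of the recursion is final on the ball of radius
    \<open>n\<close>; values farther out are provisional and get overwritten.\<close>
  define G where "G = rec_nat (\<lambda>_. x0) (\<lambda>n F u. if tdist T v u \<le> n then F u else step F u)"
  have G0: "G 0 = (\<lambda>_. x0)" by (simp add: G_def)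
  have GS: "G (Suc n) = (\<lambda>u. if tdist T v u \<le> n then G n u else step (G n) u)" for n
    by (rule ext) (simp add: G_def)
  define f where "f u = G (tdist T v u) u" for u
  have Gf: "G n u = f u" if "tdist T v u \<le> n" for n u
    using that
  proof (induction n)
    case (Suc n)
    show ?case
    proof (cases "tdist T v u \<le> n")
      case True
      then show ?thesis using Suc by (simp add: GS)
    next
      case False
      then have "tdist T v u = Suc n" using Suc by simp
      then show ?thesis by (simp add: f_def)
    qed
  qed (auto simp: f_def)
  have fv: "f v = x0" by (simp add: f_def G0)
  define b where "b u = B u (f u) (parent v u) (f (parent v u))" for u
  have fstep: "f w = b (parent v w) w" if "w \<in> V" "w \<noteq> v" for w
  proof -
    let ?p = "parent v w"
    have p: "?p \<in> N w" "tdist T v w = Suc (tdist T v ?p)" using parent[OF v that] by auto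
    let ?n = "tdist T v ?p"
    have "f w = step (G ?n) w" by (simp add: f_def p(2) GS)
    moreover have "G ?n (parent v ?p) = f (parent v ?p)" if "?p \<noteq> v"
      using parent[OF v _ that] nbrs_verts p(1) by (intro Gf) auto
    \<comment> \<open>At the root the predicate \<open>P\<close> ignores the data of the parent, so
      the two choices coincide although \<open>parent v v\<close> is arbitrary.\<close>
    moreover have "B ?p x y z = B ?p x y z'" if "?p = v" for x y z z'
      using that by (simp add: B_def P_def)
    moreover have "G ?n ?p = f ?p" by (simp add: Gf)
    ultimately show ?thesis
      unfolding step_def Let_def b_def by metis
  qed
  have main: "C u (f u) \<and> P u (f u) (parent v u) (f (parent v u)) (b u)" if "u \<in> V" for u
    using that
  proof (induction "tdist T v u" arbitrary: u)
    case 0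
    then have u: "u = v" using tdist_eq_0[OF _ v] by auto
    have "\<exists>\<beta>. P u (f u) (parent v u) (f (parent v u)) \<beta>"
      using root[OF v C0] by (simp add: u fv P_def)
    then have "P u (f u) (parent v u) (f (parent v u)) (b u)"
      unfolding b_def B_def by (rule someI_ex)
    then show ?case using C0 by (simp add: u fv)
  next
    case (Suc k)
    then have u: "u \<noteq> v" by auto
    let ?p = "parent v u"
    have p: "?p \<in> N u" "tdist T v u = Suc (tdist T v ?p)" "?p \<in> V"
      using parent[OF v \<open>u \<in> V\<close> u] nbrs_verts by auto
    have IH: "C ?p (f ?p)" "P ?p (f ?p) (parent v ?p) (f (parent v ?p)) (b ?p)"
      using Suc p by auto
    have "u \<in> N ?p" using p nbrs_sym[of ?p u] by auto
    then have fu: "C u (f u)" "f u \<in> E (f ?p)"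
      using IH fstep[OF \<open>u \<in> V\<close> u] by (auto simp: P_def bij_betw_def)
    have "\<exists>\<beta>. P u (f u) ?p (f ?p) \<beta>"
      using nonroot[OF \<open>u \<in> V\<close> fu(1) p(1) IH(1)] sym[OF p(3) IH(1) fu(2)] by (auto simp: P_def)
    then have "P u (f u) ?p (f ?p) (b u)"
      unfolding b_def B_def by (rule someI_ex)
    then show ?case using fu by simp
  qed
  \<comment> \<open>A neighbour is either the parent, where \<open>P\<close> forces agreement, or a
    child, whose value was defined through \<open>b u\<close>.\<close>
  have feq: "f w = b u w" if "u \<in> V" "w \<in> N u" for u w
  proof (cases "u \<noteq> v \<and> w = parent v u")
    case True
    then show ?thesis using main[OF that(1)] by (auto simp: P_def)
  next
    case False
    then show ?thesis using child[OF v that(2)] fstep nbrs_verts[OF that(2)] by auto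
  qed
  have "bij_betw f (N u) (E (f u))" if "u \<in> V" for u
    using main[OF that] feq[OF that] bij_betw_cong[of "N u" f "b u"] by (auto simp: P_def)
  then show ?thesis using fv main by blast
qed

section \<open>Coverings of a graph by a tree, and their lifts\<close>

definition covering :: "('x \<Rightarrow> 'x set) \<Rightarrow> ('v \<Rightarrow> 'x) \<Rightarrow> bool" where
  "covering E \<pi> \<longleftrightarrow> (\<forall>u\<in>V. bij_betw \<pi> (N u) (E (\<pi> u)))"

lemma covering_inj: "covering E \<pi> \<Longrightarrow> w \<in> N u \<Longrightarrow> w' \<in> N u \<Longrightarrow> \<pi> w = \<pi> w' \<Longrightarrow> w = w'"
  using nbrs_verts(2) unfolding covering_def bij_betw_def inj_on_def by blast

lemma covering_lift_nbr:
  assumes "covering E \<pi>" "u \<in> V" "y \<in> E (\<pi> u)"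
  obtains w where "w \<in> N u" "\<pi> w = y"
proof -
  have "y \<in> \<pi> ` N u" using assms unfolding covering_def bij_betw_def by blast
  then show ?thesis using that by blast
qed

lemma covering_lift_rtrancl:
  assumes "covering E \<pi>" "u \<in> V" "(\<pi> u, y) \<in> {(a, b). b \<in> E a}\<^sup>*"
  obtains w where "w \<in> V" "\<pi> w = y"
proof -
  from assms(3) have "\<exists>w\<in>V. \<pi> w = y"
  proof (induction rule: rtrancl_induct)
    case base
    then show ?case using assms by auto
  next
    case (step y z)
    then show ?case using covering_lift_nbr[OF assms(1)] nbrs_verts by auto metis
  qed
  then show ?thesis using that by auto
qed

text \<open>Equal degrees are all that a local bijection needs, since the only condition to carry
  along is membership in \<open>X\<close>.\<close>

lemma covering_exists:
  assumes "v \<in> V" "x0 \<in> X" "\<And>u. u \<in> V \<Longrightarrow> finite (N u) \<and> card (N u) = k"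
    and E: "\<And>x. x \<in> X \<Longrightarrow> finite (E x) \<and> card (E x) = k \<and> E x \<subseteq> X"
    and sym: "\<And>x y. x \<in> X \<Longrightarrow> y \<in> E x \<Longrightarrow> x \<in> E y"
  obtains \<pi> where "covering E \<pi>" "\<pi> v = x0" "\<pi> ` V \<subseteq> X"
proof -
  have *: "\<exists>\<beta>. bij_betw \<beta> (N u) (E x) \<and> (\<forall>w\<in>N u. \<beta> w \<in> X)" if u: "u \<in> V" "x \<in> X" for u x
  proof -
    obtain \<beta> where "bij_betw \<beta> (N u) (E x)"
      using finite_same_card_bij[of "N u" "E x"] assms(3)[OF u(1)] E[OF u(2)] by auto
    then show ?thesis using E[OF u(2)] unfolding bij_betw_def by blast
  qed
  have "\<exists>f. f v = x0 \<and> (\<forall>u\<in>V. f u \<in> X \<and> bij_betw f (N u) (E (f u)))"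
  proof (rule locally_bijective_map_exists[where C = "\<lambda>_ x. x \<in> X"])
    fix u x p y assume u: "u \<in> V" "x \<in> X" "p \<in> N u" "y \<in> X" "y \<in> E x"
    then obtain \<beta> where b: "bij_betw \<beta> (N u) (E x)" using * by blast
    \<comment> \<open>A transposition inside \<open>E x\<close> corrects an arbitrary bijection so
      that the parent gets its prescribed image.\<close>
    let ?s = "Transposition.transpose (\<beta> p) y"
    have "?s permutes E x"
      using b u by (intro permutes_swap_id) (auto simp: bij_betw_def)
    then have "bij_betw (?s \<circ> \<beta>) (N u) (E x)"
      using b bij_betw_trans permutes_imp_bij by blast
    moreover have "(?s \<circ> \<beta>) p = y" by simp
    ultimately show "\<exists>\<beta>. bij_betw \<beta> (N u) (E x) \<and> (\<forall>w\<in>N u. \<beta> w \<in> X) \<and> \<beta> p = y"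
      using E[OF u(2)] unfolding bij_betw_def by blast
  qed (use assms * in auto)
  then show ?thesis using that unfolding covering_def by blast
qed

text \<open>Over a common image both coverings identify the neighbourhoods with the same set
  \<open>E\<close>, so the local bijection is forced. It then automatically has the right value at
  the parent, which is the last conjunct of the auxiliary fact.\<close>

lemma covering_lift:
  assumes \<pi>: "covering E \<pi>" and \<rho>: "covering E \<rho>" and xy: "x \<in> V" "y \<in> V" "\<rho> y = \<pi> x"
  obtains f where "f x = y" "f \<in> V \<rightarrow> V" "\<And>u. u \<in> V \<Longrightarrow> \<rho> (f u) = \<pi> u"
    "\<And>u w. w \<in> N u \<Longrightarrow> f w \<in> N (f u)"
proof -
  let ?C = "\<lambda>u z. z \<in> V \<and> \<rho> z = \<pi> u"
  have *: "\<exists>\<beta>. bij_betw \<beta> (N u) (N z) \<and> (\<forall>w\<in>N u. ?C w (\<beta> w)) \<and> (\<forall>p q. p \<in> N u \<longrightarrow> q \<in> N z \<longrightarrow> ?C p q \<longrightarrow> \<beta> p = q)"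
    if "u \<in> V" "?C u z" for u z
  proof -
    let ?b = "the_inv_into (N z) \<rho> \<circ> \<pi>"
    have b1: "bij_betw \<rho> (N z) (E (\<pi> u))" and b2: "bij_betw \<pi> (N u) (E (\<pi> u))"
      using that \<pi> \<rho> unfolding covering_def by auto
    have "bij_betw ?b (N u) (N z)"
      using bij_betw_trans[OF b2 bij_betw_the_inv_into[OF b1]] .
    moreover have b: "?b w \<in> N z" "\<rho> (?b w) = \<pi> w" if w: "w \<in> N u" for w
    proof -
      show "?b w \<in> N z" using \<open>bij_betw ?b (N u) (N z)\<close> w by (rule bij_betw_apply)
      show "\<rho> (?b w) = \<pi> w"
        using f_the_inv_into_f_bij_betw[OF b1] bij_betw_apply[OF b2 w] by simp
    qed
    moreover have "?b p = q" if "p \<in> N u" "q \<in> N z" "?C p q" for p q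
      using inj_onD[OF bij_betw_imp_inj_on[OF b1], of "?b p" q] b[OF that(1)] that by simp
    moreover have "?C w (?b w)" if "w \<in> N u" for w
      using b[OF that] nbrs_verts by blast
    ultimately show ?thesis by (intro exI[of _ ?b]) simp
  qed
  have "\<exists>f. f x = y \<and> (\<forall>u\<in>V. ?C u (f u) \<and> bij_betw f (N u) (N (f u)))"
  proof (rule locally_bijective_map_exists)
    fix u z p q assume "u \<in> V" "?C u z" "p \<in> N u" "?C p q" "q \<in> N z"
    then show "\<exists>\<beta>. bij_betw \<beta> (N u) (N z) \<and> (\<forall>w\<in>N u. ?C w (\<beta> w)) \<and> \<beta> p = q"
      using *[of u z] by blast
  next
    fix u z q assume "u \<in> V" "?C u z" "q \<in> N z"
    then show "z \<in> N q" using nbrs_sym[of q z] by simp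
  qed (use xy * in blast)+
  then obtain f where f: "f x = y" "\<forall>u\<in>V. ?C u (f u) \<and> bij_betw f (N u) (N (f u))" by auto
  have "f w \<in> N (f u)" if "w \<in> N u" for u w
    using f that nbrs_verts[OF that] by (auto simp: bij_betw_def)
  then show ?thesis using f(2) by (intro that[of f] f(1)) auto
qed

text \<open>Agreement spreads along edges: where \<open>f\<close> and \<open>g\<close> coincide,
  their values at a neighbour are neighbours of one vertex with the same image, and a covering
  separates these.\<close>

lemma lift_unique:
  assumes \<rho>: "covering E \<rho>" and x: "x \<in> V" "f x = g x"
    and eq: "\<And>u. u \<in> V \<Longrightarrow> \<rho> (f u) = \<rho> (g u)"
    and f: "\<And>u w. w \<in> N u \<Longrightarrow> f w \<in> N (f u)" and g: "\<And>u w. w \<in> N u \<Longrightarrow> g w \<in> N (g u)"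
    and u: "u \<in> V"
  shows "f u = g u"
  using u x(1)
proof (induction rule: connected_induct)
  case (step u w)
  have w: "w \<in> V" using step nbrs_verts by blast
  have "f w \<in> N (f u)" "g w \<in> N (f u)" using f[OF \<open>w \<in> N u\<close>] g[OF \<open>w \<in> N u\<close>] \<open>f u = g u\<close> by auto
  then show ?case using eq[OF w] covering_inj[OF \<rho>] by blast
qed (use x in auto)

end

section \<open>Cocompact lattices\<close>

lemma finite_image_factor:
  assumes "finite (g ` S)" "\<And>a c. a \<in> S \<Longrightarrow> c \<in> S \<Longrightarrow> g a = g c \<Longrightarrow> f a = f c"
  shows "finite (f ` S)"
proof -
  have "f a = f (inv_into S g (g a))" if "a \<in> S" for a
    using that by (intro assms(2)) (auto simp: inv_into_into f_inv_into_f)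
  then have "f ` S \<subseteq> (\<lambda>y. f (inv_into S g y)) ` g ` S" by blast
  then show ?thesis using assms(1) finite_surj by blast
qed

section \<open>Counting right cosets\<close>

context group
begin

lemma cancel_left_inv [simp]:
  assumes "x \<in> carrier G" "y \<in> carrier G"
  shows "inv x \<otimes> (x \<otimes> y) = y" "x \<otimes> (inv x \<otimes> y) = y"
  using assms by (simp_all add: m_assoc[symmetric])

lemma r_coset_eq_iff:
  assumes "subgroup H G" "a \<in> carrier G" "c \<in> carrier G"
  shows "H #> a = H #> c \<longleftrightarrow> a \<otimes> inv c \<in> H"
proof -
  have "a \<in> H #> c \<longleftrightarrow> a \<otimes> inv c \<in> H"
    using subgroup.rcos_module[OF assms(1) is_group assms(3,2)] .
  moreover have "H #> a = H #> c" if "a \<in> H #> c"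
    using repr_independence[OF that assms(3,1)] by simp
  moreover have "a \<in> H #> a" by (rule rcos_self[OF assms(2,1)])
  ultimately show ?thesis by auto
qed

abbreviation coset_count :: "'a set \<Rightarrow> 'a set \<Rightarrow> nat" where
  "coset_count H S \<equiv> card ((\<lambda>a. H #> a) ` S)"

text \<open>Multiplicativity of the index, with a union of right cosets of \<open>H\<close> in place
  of a larger group.\<close>

lemma coset_count_mult:
  assumes H: "subgroup H G" and W: "subgroup W G" "W \<subseteq> H"
    and S: "S \<subseteq> carrier G" "\<And>u s. u \<in> H \<Longrightarrow> s \<in> S \<Longrightarrow> u \<otimes> s \<in> S"
    and fin: "finite ((\<lambda>a. W #> a) ` H)" "finite ((\<lambda>a. H #> a) ` S)"
  shows "coset_count W S = coset_count W H * coset_count H S"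
proof -
  note Hc = subgroup.mem_carrier[OF H]
  have Wc: "W \<subseteq> carrier G" using subgroup.subset[OF W(1)] .
  define F where "F D = (\<lambda>x. W #> x) ` D" for D
  have HS: "H #> s \<subseteq> S" if "s \<in> S" for s
    using S(2)[OF _ that] unfolding r_coset_def by auto
  have un: "(\<lambda>a. W #> a) ` S = (\<Union>D\<in>(\<lambda>a. H #> a) ` S. F D)"
  proof (intro equalityI subsetI)
    fix D assume "D \<in> (\<lambda>a. W #> a) ` S"
    then obtain a where a: "a \<in> S" "D = W #> a" by blast
    then have "a \<in> H #> a" using rcos_self[OF _ H] S(1) by blast
    then show "D \<in> (\<Union>D\<in>(\<lambda>a. H #> a) ` S. F D)" using a unfolding F_def by blast
  next
    fix D assume "D \<in> (\<Union>D\<in>(\<lambda>a. H #> a) ` S. F D)"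
    then obtain s where s: "s \<in> S" "D \<in> F (H #> s)" by blast
    then show "D \<in> (\<lambda>a. W #> a) ` S" using HS[OF s(1)] unfolding F_def by blast
  qed
  have cF: "finite (F (H #> s)) \<and> card (F (H #> s)) = coset_count W H" if s: "s \<in> S" for s
  proof -
    have sc: "s \<in> carrier G" using s S(1) by auto
    \<comment> \<open>Right translation by \<open>s\<close> carries the \<open>W\<close>-cosets
      inside \<open>H\<close> bijectively to those inside \<open>H #> s\<close>.\<close>
    have "F (H #> s) = (\<lambda>D. D #> s) ` (\<lambda>a. W #> a) ` H"
    proof -
      have "H #> s = (\<lambda>u. u \<otimes> s) ` H" by (auto simp: r_coset_def)
      then show ?thesis
        unfolding F_def by (simp add: image_image coset_mult_assoc[OF Wc Hc sc])
    qed
    moreover have "inj_on (\<lambda>D. D #> s) ((\<lambda>a. W #> a) ` H)"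
    proof (rule inj_onI)
      fix D D' assume "D \<in> (\<lambda>a. W #> a) ` H" "D' \<in> (\<lambda>a. W #> a) ` H" "D #> s = D' #> s"
      then obtain a c where ac: "a \<in> H" "c \<in> H" "D = W #> a" "D' = W #> c"
        "W #> (a \<otimes> s) = W #> (c \<otimes> s)"
        using coset_mult_assoc[OF Wc Hc sc] by auto
      then have "a \<otimes> s \<otimes> inv (c \<otimes> s) \<in> W"
        using r_coset_eq_iff[OF W(1)] Hc sc by simp
      also have "a \<otimes> s \<otimes> inv (c \<otimes> s) = a \<otimes> inv c"
        using Hc[OF ac(1)] Hc[OF ac(2)] sc by (simp add: inv_mult_group m_assoc)
      finally show "D = D'" using ac r_coset_eq_iff[OF W(1)] Hc by simp
    qed
    ultimately show ?thesis using fin(1) by (simp add: card_image)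
  qed
  have disj: "F D \<inter> F D' = {}" if D: "D \<in> (\<lambda>a. H #> a) ` S" "D' \<in> (\<lambda>a. H #> a) ` S" "D \<noteq> D'" for D D'
  proof (rule ccontr)
    assume "F D \<inter> F D' \<noteq> {}"
    then obtain x y where xy: "x \<in> D" "y \<in> D'" "W #> x = W #> y" unfolding F_def by auto
    obtain a c where ac: "a \<in> S" "c \<in> S" "D = H #> a" "D' = H #> c" using D by auto
    have xyS: "x \<in> carrier G" "y \<in> carrier G" using xy ac HS S(1) by blast+
    then have "x \<otimes> inv y \<in> H" using xy r_coset_eq_iff[OF W(1)] W(2) by auto
    then have "H #> x = H #> y" using r_coset_eq_iff[OF H] xyS by simp
    moreover have "D = H #> x" "D' = H #> y"
      using repr_independence[OF _ _ H] xy ac S(1) by auto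
    ultimately show False using D(3) by simp
  qed
  have "coset_count W S = (\<Sum>D\<in>(\<lambda>a. H #> a) ` S. card (F D))"
    unfolding un using fin(2) cF disj by (intro card_UN_disjoint) auto
  also have "\<dots> = (\<Sum>D\<in>(\<lambda>a. H #> a) ` S. coset_count W H)"
    using cF by (intro sum.cong) auto
  finally show ?thesis by simp
qed

end

text \<open>
  \<open>C\<close> is a compact open subgroup with a neighbourhood basis \<open>U\<close> of subgroups, and it meets every
  coset of \<open>\<Gamma>\<close>. The invariant measure gives a \<open>U r\<close>-invariant set of cosets the proportion of right
  \<open>U r\<close>-cosets of \<open>C\<close> that lie over it.
\<close>

locale cocompact_setting = group G for G (structure) +
  fixes \<tau> :: "'a topology" and C :: "'a set" and U :: "nat \<Rightarrow> 'a set" and \<Gamma> :: "'a set"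
  assumes topspace_eq: "topspace \<tau> = carrier G"
    and C: "subgroup C G" and \<Gamma>: "subgroup \<Gamma> G" and U: "\<And>r. subgroup (U r) G" "\<And>r. U r \<subseteq> C"
    and U_dec: "\<And>r. U (Suc r) \<subseteq> U r"
    and open_iff: "\<And>A. openin \<tau> A \<longleftrightarrow> A \<subseteq> carrier G \<and> (\<forall>g\<in>A. \<exists>r. U r #> g \<subseteq> A)"
    and compact: "compactin \<tau> C"
    and fin: "finite (C \<inter> \<Gamma>)"
    and prod: "\<And>g. g \<in> carrier G \<Longrightarrow> \<exists>k\<in>C. \<exists>\<gamma>\<in>\<Gamma>. g = k \<otimes> \<gamma>"
    and conj: "\<And>g r. g \<in> carrier G \<Longrightarrow> \<exists>r'. \<forall>u\<in>U r'. inv g \<otimes> u \<otimes> g \<in> U r"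
    and Inter: "(\<Inter>r. U r) = {\<one>}"
begin

abbreviation "X \<equiv> lcosets \<Gamma>"

lemma U_le: "r \<le> r' \<Longrightarrow> U r' \<subseteq> U r"
  using lift_Suc_antimono_le[of U, OF U_dec] .

lemmas Cc = subgroup.mem_carrier[OF C]
lemmas Gc = subgroup.mem_carrier[OF \<Gamma>]
lemmas Uc = subgroup.mem_carrier[OF U(1)]

text \<open>Right cosets of \<open>U r\<close> are open and disjoint, so a finite subcover of the
  compact set \<open>C\<close> has to contain all of them.\<close>

lemma finite_cosets_C: "finite ((\<lambda>a. U r #> a) ` C)"
proof -
  have op: "openin \<tau> (U r #> a)" if a: "a \<in> carrier G" for a
  proof -
    have "U r #> g \<subseteq> U r #> a" if "g \<in> U r #> a" for g
      using repr_independence[OF that a U(1)] by simp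
    then show ?thesis
      unfolding open_iff using r_coset_subset_G[OF subgroup.subset[OF U(1)] a] by blast
  qed
  have "C \<subseteq> \<Union>((\<lambda>a. U r #> a) ` C)" using rcos_self[OF Cc U(1)] by blast
  then obtain F where F: "finite F" "F \<subseteq> (\<lambda>a. U r #> a) ` C" "C \<subseteq> \<Union>F"
    using compactinD[OF compact, of "(\<lambda>a. U r #> a) ` C"] op Cc by (metis (no_types, lifting) image_iff)
  have "(\<lambda>a. U r #> a) ` C \<subseteq> F"
  proof
    fix D assume "D \<in> (\<lambda>a. U r #> a) ` C"
    then obtain a where a: "a \<in> C" "D = U r #> a" by auto
    then obtain E where E: "E \<in> F" "a \<in> E" using F(3) by auto
    then obtain c where "c \<in> C" "E = U r #> c" using F(2) by auto
    then show "D \<in> F" using repr_independence[of a "U r" c] E a Cc U(1) by auto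
  qed
  then show ?thesis using F(1) finite_subset by blast
qed

lemma finite_cosets_sub: "S \<subseteq> C \<Longrightarrow> finite ((\<lambda>a. U r #> a) ` S)"
  using finite_cosets_C finite_subset image_mono by metis

section \<open>Invariant sets of cosets and the premeasure on them\<close>

definition lift :: "'a set set \<Rightarrow> 'a set" where
  "lift E = {g \<in> carrier G. g <# \<Gamma> \<in> E}"

lemma lift_carrier: "lift E \<subseteq> carrier G"
  by (auto simp: lift_def)

lemma lift_right: "a \<in> lift E \<Longrightarrow> \<gamma> \<in> \<Gamma> \<Longrightarrow> a \<otimes> \<gamma> \<in> lift E"
proof -
  assume a: "a \<in> lift E" "\<gamma> \<in> \<Gamma>"
  then have "(a \<otimes> \<gamma>) <# \<Gamma> = a <# \<Gamma>"
    using Gc[of \<gamma>] lcos_m_assoc[OF subgroup.subset[OF \<Gamma>], of a \<gamma>] coset_join3[of \<gamma> \<Gamma>] \<Gamma>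
    by (auto simp: lift_def)
  then show ?thesis using a Gc[of \<gamma>] by (auto simp: lift_def)
qed

text \<open>Unions of orbits of the open group \<open>U r\<close> on the quotient. They are open
  together with their complements, and over all \<open>r\<close> they form the algebra on which the
  measure is first defined.\<close>

definition inv_sets :: "nat \<Rightarrow> 'a set set set" where
  "inv_sets r = {E. E \<subseteq> X \<and> (\<forall>u\<in>U r. \<forall>c\<in>E. u <# c \<in> E)}"

lemma X_cases:
  assumes "c \<in> X"
  obtains k where "k \<in> C" "c = k <# \<Gamma>"
proof -
  obtain g where g: "g \<in> carrier G" "c = g <# \<Gamma>" using assms by (auto simp: LCOSETS_def)
  then obtain k \<gamma> where k: "k \<in> C" "\<gamma> \<in> \<Gamma>" "g = k \<otimes> \<gamma>" using prod by blast
  then have "c = k <# \<Gamma>"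
    using g Cc[of k] Gc[of \<gamma>] lcos_m_assoc[OF subgroup.subset[OF \<Gamma>], of k \<gamma>] coset_join3[of \<gamma> \<Gamma>] \<Gamma>
    by auto
  then show ?thesis using that k by blast
qed

lemma act_mult: "g \<in> carrier G \<Longrightarrow> h \<in> carrier G \<Longrightarrow> g <# (h <# \<Gamma>) = (g \<otimes> h) <# \<Gamma>"
  using lcos_m_assoc[OF subgroup.subset[OF \<Gamma>]] .

lemma act_X: "g \<in> carrier G \<Longrightarrow> c \<in> X \<Longrightarrow> g <# c \<in> X"
  using act_mult by (auto simp: LCOSETS_def)

lemma act_inv: "g \<in> carrier G \<Longrightarrow> c \<in> X \<Longrightarrow> inv g <# (g <# c) = c"
  by (auto simp: LCOSETS_def act_mult m_assoc[symmetric])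

lemma lift_left:
  assumes "E \<in> inv_sets r" "u \<in> U r" "a \<in> lift E"
  shows "u \<otimes> a \<in> lift E"
  using assms act_mult[OF Uc[OF assms(2)]] Uc[OF assms(2)] by (fastforce simp: lift_def inv_sets_def)

lemma inv_sets_mono: "r \<le> r' \<Longrightarrow> inv_sets r \<subseteq> inv_sets r'"
  using U_le unfolding inv_sets_def by blast

text \<open>For a right Haar measure this would be the measure of the part of \<open>C\<close> above
  \<open>E\<close> divided by that of \<open>U r\<close>. Compactness of \<open>C\<close> keeps it
  finite.\<close>

definition cnt :: "nat \<Rightarrow> 'a set set \<Rightarrow> nat" where
  "cnt r E = coset_count (U r) (lift E \<inter> C)"

lemma lift_X: "lift X = carrier G"
  by (auto simp: lift_def LCOSETS_def)

lemma X_inv_sets: "X \<in> inv_sets r"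
  using act_X Uc by (auto simp: inv_sets_def)

lemma cnt_mult:
  assumes "E \<in> inv_sets r" "r \<le> r'"
  shows "cnt r' E = coset_count (U r') (U r) * cnt r E"
  unfolding cnt_def
proof (rule coset_count_mult)
  show "u \<otimes> s \<in> lift E \<inter> C" if "u \<in> U r" "s \<in> lift E \<inter> C" for u s
    using lift_left[OF assms(1) that(1)] that U(2) subgroup.m_closed[OF C] by blast
  show "lift E \<inter> C \<subseteq> carrier G" using lift_carrier by blast
qed (use U U_le assms finite_cosets_sub in auto)

lemma cnt_X_pos: "cnt r X > 0"
proof -
  have "lift X \<inter> C \<noteq> {}" using subgroup.one_closed[OF C] lift_X by auto
  then show ?thesis
    unfolding cnt_def using finite_cosets_sub[of "lift X \<inter> C" r] by (simp add: card_gt_0_iff)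
qed

definition \<mu> :: "nat \<Rightarrow> 'a set set \<Rightarrow> real" where
  "\<mu> r E = real (cnt r E) / real (cnt r X)"

text \<open>Refining the level multiplies numerator and denominator by the same index.\<close>

lemma \<mu>_level:
  assumes "E \<in> inv_sets r" "r \<le> r'"
  shows "\<mu> r' E = \<mu> r E"
proof -
  have "coset_count (U r') (U r) > 0"
    using cnt_mult[OF X_inv_sets assms(2)] cnt_X_pos[of r'] by (metis gr0I mult_0 not_gr0)
  then show ?thesis
    using cnt_mult[OF assms] cnt_mult[OF X_inv_sets assms(2)] by (simp add: \<mu>_def)
qed

definition \<A> :: "'a set set set" where "\<A> = (\<Union>r. inv_sets r)"

text \<open>\<open>LEAST\<close> merely picks one admissible level; by \<open>\<mu>_level\<close>
  the value does not depend on it.\<close>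

definition f :: "'a set set \<Rightarrow> ennreal" where
  "f E = ennreal (\<mu> (LEAST r. E \<in> inv_sets r) E)"

lemma f_eq: "E \<in> inv_sets r \<Longrightarrow> f E = ennreal (\<mu> r E)"
proof -
  assume E: "E \<in> inv_sets r"
  let ?P = "\<lambda>r. E \<in> inv_sets r"
  have "\<mu> r E = \<mu> (Least ?P) E"
    by (rule \<mu>_level[OF LeastI[of ?P, OF E] Least_le[of ?P, OF E]])
  then show "f E = ennreal (\<mu> r E)" unfolding f_def by simp
qed

lemma common_level:
  assumes "E \<in> \<A>" "F \<in> \<A>"
  obtains r where "E \<in> inv_sets r" "F \<in> inv_sets r"
proof -
  obtain r r' where "E \<in> inv_sets r" "F \<in> inv_sets r'" using assms by (auto simp: \<A>_def)
  then have "E \<in> inv_sets (max r r')" "F \<in> inv_sets (max r r')"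
    using subsetD[OF inv_sets_mono[OF max.cobounded1[of r r']]]
      subsetD[OF inv_sets_mono[OF max.cobounded2[of r' r]]] by blast+
  then show ?thesis by (rule that)
qed

lemma inv_sets_Diff:
  assumes "E \<in> inv_sets r" "F \<in> inv_sets r"
  shows "E - F \<in> inv_sets r"
proof -
  have "u <# c \<notin> F" if uc: "u \<in> U r" "c \<in> E - F" for u c
  proof
    assume "u <# c \<in> F"
    then have "inv u <# (u <# c) \<in> F"
      using assms(2) subgroup.m_inv_closed[OF U(1) uc(1)] unfolding inv_sets_def by blast
    moreover have "c \<in> X" using assms(1) uc unfolding inv_sets_def by blast
    ultimately show False using act_inv[OF Uc[OF uc(1)]] uc by simp
  qed
  then show ?thesis using assms unfolding inv_sets_def by blast
qed

lemma inv_sets_Un: "E \<in> inv_sets r \<Longrightarrow> F \<in> inv_sets r \<Longrightarrow> E \<union> F \<in> inv_sets r"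
  and inv_sets_Int: "E \<in> inv_sets r \<Longrightarrow> F \<in> inv_sets r \<Longrightarrow> E \<inter> F \<in> inv_sets r"
  unfolding inv_sets_def by blast+

lemma algebra_\<A>: "algebra X \<A>"
  unfolding algebra_iff_Un
proof (intro conjI ballI)
  show "\<A> \<subseteq> Pow X" by (auto simp: \<A>_def inv_sets_def)
  show "{} \<in> \<A>" by (auto simp: \<A>_def inv_sets_def)
  show "X - E \<in> \<A>" if "E \<in> \<A>" for E
    using that inv_sets_Diff[OF X_inv_sets] by (auto simp: \<A>_def)
  show "E \<union> F \<in> \<A>" if EF: "E \<in> \<A>" "F \<in> \<A>" for E F
  proof -
    obtain r where "E \<in> inv_sets r" "F \<in> inv_sets r" using common_level[OF EF] .
    then show ?thesis using inv_sets_Un unfolding \<A>_def by blast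
  qed
qed

lemma cnt_Un:
  assumes E: "E \<in> inv_sets r" "F \<in> inv_sets r" "E \<inter> F = {}"
  shows "cnt r (E \<union> F) = cnt r E + cnt r F"
proof -
  let ?h = "\<lambda>E. (\<lambda>a. U r #> a) ` (lift E \<inter> C)"
  have "?h (E \<union> F) = ?h E \<union> ?h F" by (auto simp: lift_def)
  moreover have "?h E \<inter> ?h F = {}"
  proof (rule ccontr)
    assume "?h E \<inter> ?h F \<noteq> {}"
    then obtain a c where ac: "a \<in> lift E" "c \<in> lift F" "U r #> a = U r #> c" by blast
    have c: "a \<in> carrier G" "c \<in> carrier G" using ac lift_carrier by blast+
    then have "a \<otimes> inv c \<in> U r" using ac r_coset_eq_iff[OF U(1)] by simp
    then have "a \<otimes> inv c \<otimes> c \<in> lift F" using lift_left[OF E(2) _ ac(2)] by blast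
    moreover have "a \<otimes> inv c \<otimes> c = a" using c by (simp add: m_assoc)
    ultimately have "a <# \<Gamma> \<in> E \<inter> F" using ac by (simp add: lift_def)
    then show False using E(3) by simp
  qed
  moreover have "finite (?h E)" for E by (rule finite_cosets_sub) simp
  ultimately show ?thesis unfolding cnt_def by (simp add: card_Un_disjoint)
qed

lemma additive_f: "additive \<A> f"
  unfolding additive_def
proof (intro ballI impI)
  fix E F assume EF: "E \<in> \<A>" "F \<in> \<A>" "E \<inter> F = {}"
  obtain r where r: "E \<in> inv_sets r" "F \<in> inv_sets r" using common_level[OF EF(1,2)] .
  then show "f (E \<union> F) = f E + f F"
    using cnt_Un[OF r EF(3)] inv_sets_Un[OF r]
    by (simp add: f_eq \<mu>_def add_divide_distrib ennreal_plus)
qed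

lemma positive_f: "positive \<A> f"
  unfolding positive_def using f_eq[of "{}" 0] by (simp add: inv_sets_def \<mu>_def cnt_def lift_def)

lemma lift_open:
  assumes "E \<in> inv_sets r"
  shows "openin \<tau> (lift E)"
  unfolding open_iff
proof (intro conjI ballI lift_carrier exI[of _ r])
  fix g assume "g \<in> lift E"
  then show "U r #> g \<subseteq> lift E" using lift_left[OF assms] by (auto simp: r_coset_def)
qed

text \<open>Compactness replaces an estimate: the lifted complements form an open cover of
  \<open>C\<close>, so the decreasing sequence is actually empty from some index on. This continuity
  is what Caratheodory's extension theorem asks for.\<close>

lemma empty_continuous:
  assumes A: "range A \<subseteq> \<A>" "decseq A" "(\<Inter>i. A i) = {}"
  shows "(\<lambda>i. f (A i)) \<longlonglongrightarrow> 0"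
proof -
  interpret algebra X \<A> by (rule algebra_\<A>)
  let ?W = "range (\<lambda>n. lift (X - A n))"
  have "openin \<tau> (lift E)" if "E \<in> \<A>" for E using that lift_open by (auto simp: \<A>_def)
  moreover have "X - A n \<in> \<A>" for n using A(1) by (intro compl_sets) blast
  ultimately have op: "\<And>W. W \<in> ?W \<Longrightarrow> openin \<tau> W" by blast
  have "C \<subseteq> \<Union>?W"
  proof
    fix k assume k: "k \<in> C"
    then obtain n where "k <# \<Gamma> \<notin> A n" using A(3) by blast
    then have "k \<in> lift (X - A n)" using Cc[OF k] by (auto simp: lift_def LCOSETS_def)
    then show "k \<in> \<Union>?W" by blast
  qed
  then obtain F where F: "finite F" "F \<subseteq> ?W" "C \<subseteq> \<Union>F"
    using compactinD[OF compact op, of ?W] by blast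
  obtain J where J: "finite J" "F = (\<lambda>n. lift (X - A n)) ` J"
    using finite_subset_image[OF F(1,2)] by blast
  have "A n = {}" if n: "n \<ge> Max (insert 0 J)" for n
  proof (rule ccontr)
    assume "A n \<noteq> {}"
    then obtain c where c: "c \<in> A n" by blast
    then have "c \<in> X" using A(1) sets_into_space by blast
    then obtain k where k: "k \<in> C" "c = k <# \<Gamma>" by (rule X_cases)
    then obtain j where j: "j \<in> J" "k \<in> lift (X - A j)" using F(3) J by blast
    then have "j \<le> n" using n J(1) by (meson Max_ge finite.insertI insertI2 le_trans)
    then have "A n \<subseteq> A j" using A(2) by (simp add: decseq_def)
    then show False using j c k by (auto simp: lift_def)
  qed
  then have "\<forall>\<^sub>F n in sequentially. f (A n) = 0"
    using positive_f unfolding eventually_sequentially positive_def by metis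
  then show ?thesis by (rule tendsto_eventually)
qed

section \<open>Invariance of the premeasure\<close>

lemma act_inv_sets:
  assumes g: "g \<in> carrier G" and E: "E \<in> inv_sets r" and r': "\<forall>u\<in>U r'. inv g \<otimes> u \<otimes> g \<in> U r"
  shows "(\<lambda>c. g <# c) ` E \<in> inv_sets r'"
proof -
  have EX: "E \<subseteq> X" using E by (simp add: inv_sets_def)
  have "u <# (g <# c) \<in> (\<lambda>c. g <# c) ` E" if uc: "u \<in> U r'" "c \<in> E" for u c
  proof -
    obtain h where h: "h \<in> carrier G" "c = h <# \<Gamma>" using uc EX by (auto simp: LCOSETS_def)
    have u: "u \<in> carrier G" using Uc uc by blast
    have "(inv g \<otimes> u \<otimes> g) <# c \<in> E" using E r' uc by (auto simp: inv_sets_def)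
    moreover have "g <# ((inv g \<otimes> u \<otimes> g) <# c) = u <# (g <# c)"
      using g u h by (simp add: act_mult m_assoc)
    ultimately show ?thesis by (metis imageI)
  qed
  then show ?thesis using EX act_X[OF g] unfolding inv_sets_def by blast
qed

text \<open>
  Both \<open>C\<close> and \<open>g C\<close> meet every coset of \<open>\<Gamma>\<close> in as many points as \<open>C \<inter> \<Gamma>\<close> has.
\<close>

lemma coset_count_translate:
  assumes g: "g \<in> carrier G" and H: "subgroup H G" "H \<subseteq> C" "\<And>h. h \<in> H \<Longrightarrow> inv g \<otimes> h \<otimes> g \<in> C"
    and A: "A \<subseteq> carrier G" "\<And>a \<gamma>. a \<in> A \<Longrightarrow> \<gamma> \<in> \<Gamma> \<Longrightarrow> a \<otimes> \<gamma> \<in> A"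
    and finH: "finite ((\<lambda>a. H #> a) ` C)"
  shows "coset_count H (A \<inter> C) = coset_count H (A \<inter> (g <# C))"
proof -
  have gC: "x \<in> g <# C \<longleftrightarrow> x \<in> carrier G \<and> inv g \<otimes> x \<in> C" for x
  proof
    assume "x \<in> g <# C"
    then obtain c where "c \<in> C" "x = g \<otimes> c" by (auto simp: l_coset_def)
    then show "x \<in> carrier G \<and> inv g \<otimes> x \<in> C"
      using g Cc by (simp add: m_assoc)
  next
    assume x: "x \<in> carrier G \<and> inv g \<otimes> x \<in> C"
    then have "x = g \<otimes> (inv g \<otimes> x)" using g by (simp add: m_assoc)
    then show "x \<in> g <# C" using x unfolding l_coset_def by blast
  qed
  \<comment> \<open>With \<open>a = k \<otimes> \<gamma>0\<close> and \<open>k\<close> in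
    \<open>C\<close> the condition becomes \<open>\<gamma>0 \<otimes> inv \<gamma> \<in> C\<close>,
    so the solutions are a translate of the inverses of \<open>C \<inter> \<Gamma>\<close>.\<close>
  have card_trans: "card {\<gamma>\<in>\<Gamma>. a \<otimes> inv \<gamma> \<in> C} = card (C \<inter> \<Gamma>)"
    "finite {\<gamma>\<in>\<Gamma>. a \<otimes> inv \<gamma> \<in> C}" if a: "a \<in> carrier G" for a
  proof -
    obtain k \<gamma>0 where k: "k \<in> C" "\<gamma>0 \<in> \<Gamma>" "a = k \<otimes> \<gamma>0" using prod a by blast
    have bij: "bij_betw (\<lambda>\<delta>. inv \<delta> \<otimes> \<gamma>0) (C \<inter> \<Gamma>) {\<gamma>\<in>\<Gamma>. a \<otimes> inv \<gamma> \<in> C}"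
    proof (rule bij_betw_byWitness[where f' = "\<lambda>\<gamma>. \<gamma>0 \<otimes> inv \<gamma>"])
      show "\<forall>\<delta>\<in>C \<inter> \<Gamma>. \<gamma>0 \<otimes> inv (inv \<delta> \<otimes> \<gamma>0) = \<delta>"
        using k Gc by (auto simp: inv_mult_group m_assoc)
      show "\<forall>\<gamma>\<in>{\<gamma>\<in>\<Gamma>. a \<otimes> inv \<gamma> \<in> C}. inv (\<gamma>0 \<otimes> inv \<gamma>) \<otimes> \<gamma>0 = \<gamma>"
        using k Gc by (auto simp: inv_mult_group m_assoc)
      show "(\<lambda>\<delta>. inv \<delta> \<otimes> \<gamma>0) ` (C \<inter> \<Gamma>) \<subseteq> {\<gamma>\<in>\<Gamma>. a \<otimes> inv \<gamma> \<in> C}"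
      proof
        fix \<gamma> assume "\<gamma> \<in> (\<lambda>\<delta>. inv \<delta> \<otimes> \<gamma>0) ` (C \<inter> \<Gamma>)"
        then obtain \<delta> where \<delta>: "\<delta> \<in> C" "\<delta> \<in> \<Gamma>" "\<gamma> = inv \<delta> \<otimes> \<gamma>0" by auto
        have "a \<otimes> inv \<gamma> = k \<otimes> \<delta>"
          using k \<delta> Cc Gc by (simp add: inv_mult_group m_assoc)
        then show "\<gamma> \<in> {\<gamma>\<in>\<Gamma>. a \<otimes> inv \<gamma> \<in> C}"
          using k \<delta> subgroup.m_closed[OF C] subgroup.m_closed[OF \<Gamma>] subgroup.m_inv_closed[OF \<Gamma>] by simp
      qed
      show "(\<lambda>\<gamma>. \<gamma>0 \<otimes> inv \<gamma>) ` {\<gamma>\<in>\<Gamma>. a \<otimes> inv \<gamma> \<in> C} \<subseteq> C \<inter> \<Gamma>"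
      proof
        fix \<delta> assume "\<delta> \<in> (\<lambda>\<gamma>. \<gamma>0 \<otimes> inv \<gamma>) ` {\<gamma>\<in>\<Gamma>. a \<otimes> inv \<gamma> \<in> C}"
        then obtain \<gamma> where \<gamma>: "\<gamma> \<in> \<Gamma>" "a \<otimes> inv \<gamma> \<in> C" "\<delta> = \<gamma>0 \<otimes> inv \<gamma>" by auto
        have "\<delta> = inv k \<otimes> (a \<otimes> inv \<gamma>)"
          using k \<gamma> Cc Gc by (simp add: m_assoc)
        then have "\<delta> \<in> C"
          using subgroup.m_closed[OF C subgroup.m_inv_closed[OF C k(1)] \<gamma>(2)] by (simp only:)
        moreover have "\<delta> \<in> \<Gamma>"
          using subgroup.m_closed[OF \<Gamma> k(2) subgroup.m_inv_closed[OF \<Gamma> \<gamma>(1)]] \<gamma>(3) by (simp only:)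
        ultimately show "\<delta> \<in> C \<inter> \<Gamma>" by blast
      qed
    qed
    show "card {\<gamma>\<in>\<Gamma>. a \<otimes> inv \<gamma> \<in> C} = card (C \<inter> \<Gamma>)" "finite {\<gamma>\<in>\<Gamma>. a \<otimes> inv \<gamma> \<in> C}"
      using fin bij_betw_same_card[OF bij] bij_betw_finite[OF bij] by simp_all
  qed
  have inv_Gamma: "card {\<gamma>\<in>\<Gamma>. a \<otimes> \<gamma> \<in> C} = card {\<gamma>\<in>\<Gamma>. a \<otimes> inv \<gamma> \<in> C}" for a
    by (rule bij_betw_same_card[where f = "\<lambda>\<gamma>. inv \<gamma>"], rule bij_betw_byWitness[where f' = "\<lambda>\<gamma>. inv \<gamma>"])
      (use Gc subgroup.m_inv_closed[OF \<Gamma>] in auto)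
  \<comment> \<open>Double counting of pairs of an \<open>H\<close>-coset and a lattice element
    carrying it from \<open>C\<close> into \<open>g <# C\<close> by right multiplication with the
    inverse. Read from either end, every fibre has \<open>card (C \<inter> \<Gamma>)\<close>
    elements.\<close>
  define Q1 where "Q1 D = {\<gamma>\<in>\<Gamma>. \<exists>x\<in>D. x \<otimes> inv \<gamma> \<in> g <# C}" for D
  define Q2 where "Q2 D = {\<gamma>\<in>\<Gamma>. \<exists>x\<in>D. x \<otimes> \<gamma> \<in> C}" for D
  let ?S1 = "(\<lambda>a. H #> a) ` (A \<inter> C)" and ?S2 = "(\<lambda>a. H #> a) ` (A \<inter> (g <# C))"
  note Hc = subgroup.mem_carrier[OF H(1)]
  have Q1: "Q1 (H #> a) = {\<gamma>\<in>\<Gamma>. inv g \<otimes> a \<otimes> inv \<gamma> \<in> C}" if a: "a \<in> carrier G" for a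
  proof -
    have "(\<exists>x\<in>H #> a. x \<otimes> inv \<gamma> \<in> g <# C) \<longleftrightarrow> inv g \<otimes> a \<otimes> inv \<gamma> \<in> C" if \<gamma>: "\<gamma> \<in> \<Gamma>" for \<gamma>
    proof
      assume "\<exists>x\<in>H #> a. x \<otimes> inv \<gamma> \<in> g <# C"
      then obtain h where h: "h \<in> H" "inv g \<otimes> (h \<otimes> a \<otimes> inv \<gamma>) \<in> C"
        unfolding gC by (auto simp: r_coset_def)
      have eq: "inv g \<otimes> a \<otimes> inv \<gamma> = inv (inv g \<otimes> h \<otimes> g) \<otimes> (inv g \<otimes> (h \<otimes> a \<otimes> inv \<gamma>))"
        using g a h Hc Gc[OF \<gamma>] by (simp add: inv_mult_group m_assoc)
      show "inv g \<otimes> a \<otimes> inv \<gamma> \<in> C"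
        unfolding eq by (intro subgroup.m_closed[OF C] subgroup.m_inv_closed[OF C] H(3) h)
    next
      assume "inv g \<otimes> a \<otimes> inv \<gamma> \<in> C"
      then have "a \<otimes> inv \<gamma> \<in> g <# C" unfolding gC using a g Gc[OF \<gamma>] by (simp add: m_assoc)
      then show "\<exists>x\<in>H #> a. x \<otimes> inv \<gamma> \<in> g <# C" using rcos_self[OF a H(1)] by blast
    qed
    then show ?thesis unfolding Q1_def by blast
  qed
  have Q2: "Q2 (H #> a) = {\<gamma>\<in>\<Gamma>. a \<otimes> \<gamma> \<in> C}" if a: "a \<in> carrier G" for a
  proof -
    have "(\<exists>x\<in>H #> a. x \<otimes> \<gamma> \<in> C) \<longleftrightarrow> a \<otimes> \<gamma> \<in> C" if \<gamma>: "\<gamma> \<in> \<Gamma>" for \<gamma>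
    proof
      assume "\<exists>x\<in>H #> a. x \<otimes> \<gamma> \<in> C"
      then obtain h where h: "h \<in> H" "h \<otimes> a \<otimes> \<gamma> \<in> C" by (auto simp: r_coset_def)
      have eq: "a \<otimes> \<gamma> = inv h \<otimes> (h \<otimes> a \<otimes> \<gamma>)"
        using a h Hc Gc[OF \<gamma>] by (simp add: m_assoc)
      have "inv h \<in> C" using h(1) H(2) subgroup.m_inv_closed[OF C] by blast
      then show "a \<otimes> \<gamma> \<in> C"
        unfolding eq using h(2) by (rule subgroup.m_closed[OF C])
    qed (use rcos_self[OF a H(1)] in blast)
    then show ?thesis unfolding Q2_def by blast
  qed
  have Ac: "a \<in> carrier G" if "a \<in> A" for a using A(1) that by blast
  have c1: "card (Q1 D) = card (C \<inter> \<Gamma>)" "finite (Q1 D)" if D: "D \<in> ?S1" for D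
    using D Q1 card_trans Ac g by auto
  have c2: "card (Q2 D) = card (C \<inter> \<Gamma>)" if D: "D \<in> ?S2" for D
    using D Q2 card_trans Ac inv_Gamma by auto
  have Fpos: "card (C \<inter> \<Gamma>) > 0"
    using fin subgroup.one_closed[OF C] subgroup.one_closed[OF \<Gamma>] by (auto simp: card_gt_0_iff)
  have f2: "finite (Q2 D)" if "D \<in> ?S2" for D
    using c2[OF that] Fpos card_ge_0_finite by metis
  have Hsub: "H \<subseteq> carrier G" using Hc by blast
  have bij: "bij_betw (\<lambda>(D, \<gamma>). (D #> inv \<gamma>, \<gamma>)) (Sigma ?S1 Q1) (Sigma ?S2 Q2)"
  proof (rule bij_betw_byWitness[where f' = "\<lambda>(D, \<gamma>). (D #> \<gamma>, \<gamma>)"])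
    show "\<forall>x\<in>Sigma ?S1 Q1. (\<lambda>(D, \<gamma>). (D #> \<gamma>, \<gamma>)) ((\<lambda>(D, \<gamma>). (D #> inv \<gamma>, \<gamma>)) x) = x"
      using Ac Gc by (auto simp: Q1_def coset_mult_assoc[OF Hsub] m_assoc)
    show "\<forall>x\<in>Sigma ?S2 Q2. (\<lambda>(D, \<gamma>). (D #> inv \<gamma>, \<gamma>)) ((\<lambda>(D, \<gamma>). (D #> \<gamma>, \<gamma>)) x) = x"
      using Ac Gc by (auto simp: Q2_def coset_mult_assoc[OF Hsub] m_assoc)
    show "(\<lambda>(D, \<gamma>). (D #> inv \<gamma>, \<gamma>)) ` Sigma ?S1 Q1 \<subseteq> Sigma ?S2 Q2"
    proof (clarsimp, intro conjI)
      fix a \<gamma> assume a: "a \<in> A" "a \<in> C" and "\<gamma> \<in> Q1 (H #> a)"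
      then have \<gamma>: "\<gamma> \<in> \<Gamma>" "inv g \<otimes> a \<otimes> inv \<gamma> \<in> C" using Q1[OF Ac[OF a(1)]] by auto
      have eq: "H #> a #> inv \<gamma> = H #> (a \<otimes> inv \<gamma>)"
        using Ac[OF a(1)] Gc[OF \<gamma>(1)] by (simp add: coset_mult_assoc[OF Hsub])
      have "a \<otimes> inv \<gamma> \<in> A" using A(2)[OF a(1)] subgroup.m_inv_closed[OF \<Gamma> \<gamma>(1)] by blast
      moreover have "a \<otimes> inv \<gamma> \<in> g <# C"
        unfolding gC using \<gamma> Gc[OF \<gamma>(1)] Ac[OF a(1)] g by (simp add: m_assoc)
      ultimately show "H #> a #> inv \<gamma> \<in> (#>) H ` (A \<inter> (g <# C))" unfolding eq by blast
      show "\<gamma> \<in> Q2 (H #> a #> inv \<gamma>)"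
        unfolding eq using Q2 \<gamma>(1) a Ac[OF a(1)] Gc[OF \<gamma>(1)] by (simp add: m_assoc)
    qed
    show "(\<lambda>(D, \<gamma>). (D #> \<gamma>, \<gamma>)) ` Sigma ?S2 Q2 \<subseteq> Sigma ?S1 Q1"
    proof (clarsimp, intro conjI)
      fix a \<gamma> assume a: "a \<in> A" "a \<in> g <# C" and "\<gamma> \<in> Q2 (H #> a)"
      then have \<gamma>: "\<gamma> \<in> \<Gamma>" "a \<otimes> \<gamma> \<in> C" using Q2[OF Ac[OF a(1)]] by auto
      have eq: "H #> a #> \<gamma> = H #> (a \<otimes> \<gamma>)"
        using Ac[OF a(1)] Gc[OF \<gamma>(1)] by (simp add: coset_mult_assoc[OF Hsub])
      show "H #> a #> \<gamma> \<in> (#>) H ` (A \<inter> C)" unfolding eq using A(2)[OF a(1) \<gamma>(1)] \<gamma>(2) by blast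
      have "inv g \<otimes> (a \<otimes> \<gamma>) \<otimes> inv \<gamma> = inv g \<otimes> a"
        using Ac[OF a(1)] Gc[OF \<gamma>(1)] g by (simp add: m_assoc)
      then show "\<gamma> \<in> Q1 (H #> a #> \<gamma>)"
        unfolding eq using Q1 \<gamma>(1) a(2) Ac[OF a(1)] Gc[OF \<gamma>(1)] unfolding gC by simp
    qed
  qed
  have fin1: "finite ?S1" using finH by (rule finite_subset[rotated]) blast
  have "finite (Sigma ?S1 Q1)" using fin1 c1 by (intro finite_SigmaI) auto
  then have "finite (Sigma ?S2 Q2)" using bij bij_betw_finite by blast
  \<comment> \<open>All fibres are nonempty, so finiteness on the side of \<open>g <# C\<close> can
    be read off from the bijection.\<close>
  moreover have "?S2 \<subseteq> fst ` Sigma ?S2 Q2"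
  proof
    fix D assume D: "D \<in> ?S2"
    have "Q2 D \<noteq> {}" using c2[OF D] Fpos by auto
    then show "D \<in> fst ` Sigma ?S2 Q2" using D by force
  qed
  ultimately have fin2: "finite ?S2" by (meson finite_imageI finite_subset)
  have "card (Sigma ?S1 Q1) = card ?S1 * card (C \<inter> \<Gamma>)"
    using fin1 c1 by (subst card_SigmaI) auto
  moreover have "card (Sigma ?S2 Q2) = card ?S2 * card (C \<inter> \<Gamma>)"
    using fin2 c2 f2 by (subst card_SigmaI) auto
  ultimately show ?thesis using bij_betw_same_card[OF bij] Fpos by simp
qed

text \<open>Translating by \<open>g\<close> turns \<open>U r'\<close>-cosets in
  \<open>g <# C\<close> into cosets in \<open>C\<close> of the conjugate group \<open>?W\<close>,
  and \<open>coset_count_translate\<close> lets \<open>g <# C\<close> stand in for \<open>C\<close>.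
  The index of \<open>?W\<close> in \<open>U r\<close> then appears for \<open>E\<close> and for the
  whole space alike and cancels.\<close>

lemma \<mu>_invariant:
  assumes g: "g \<in> carrier G" and E: "E \<in> inv_sets r" and r': "r \<le> r'" "\<forall>u\<in>U r'. inv g \<otimes> u \<otimes> g \<in> U r"
  shows "\<mu> r' ((\<lambda>c. g <# c) ` E) = \<mu> r E"
proof -
  let ?H = "U r'" and ?W = "(\<lambda>u. inv g \<otimes> u \<otimes> g) ` U r'"
  have W: "subgroup ?W G"
  proof (rule subgroupI)
    show "?W \<subseteq> carrier G" using g Uc by auto
    show "?W \<noteq> {}" using subgroup.one_closed[OF U(1)] by blast
    show "inv x \<in> ?W" if x: "x \<in> ?W" for x
    proof -
      obtain u where u: "u \<in> ?H" "x = inv g \<otimes> u \<otimes> g" using x by blast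
      have "inv x = inv g \<otimes> inv u \<otimes> g" using u g Uc by (simp add: inv_mult_group m_assoc)
      then show ?thesis using subgroup.m_inv_closed[OF U(1) u(1)] by blast
    qed
    show "x \<otimes> y \<in> ?W" if xy: "x \<in> ?W" "y \<in> ?W" for x y
    proof -
      obtain u w where u: "u \<in> ?H" "x = inv g \<otimes> u \<otimes> g" "w \<in> ?H" "y = inv g \<otimes> w \<otimes> g" using xy by blast
      have "x \<otimes> y = inv g \<otimes> (u \<otimes> w) \<otimes> g"
        using u g Uc[OF u(1)] Uc[OF u(3)] by (simp add: m_assoc)
      then show ?thesis using subgroup.m_closed[OF U(1) u(1,3)] by blast
    qed
  qed
  have WU: "?W \<subseteq> U r" using r'(2) by blast
  have ginv: "inv g \<in> carrier G" using g by simp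
  \<comment> \<open>A still smaller group of the basis lies inside \<open>?W\<close>, which bounds
    the index of \<open>?W\<close> in \<open>U r\<close>.\<close>
  obtain r'' where r'': "\<forall>u\<in>U r''. inv (inv g) \<otimes> u \<otimes> inv g \<in> U r'" using conj[OF ginv] by blast
  have "finite ((\<lambda>a. ?W #> a) ` U r)"
  proof -
    have "U r'' \<subseteq> ?W"
    proof
      fix u assume u: "u \<in> U r''"
      have "u = inv g \<otimes> (g \<otimes> u \<otimes> inv g) \<otimes> g"
        using g Uc[OF u] by (simp add: m_assoc)
      then show "u \<in> ?W" using r'' u g by auto
    qed
    show ?thesis
    proof (rule finite_image_factor[OF finite_cosets_sub[OF U(2)]])
      fix a c assume ac: "a \<in> U r" "c \<in> U r" "U r'' #> a = U r'' #> c"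
      then have "a \<otimes> inv c \<in> ?W"
        using r_coset_eq_iff[OF U(1)] Uc \<open>U r'' \<subseteq> ?W\<close> by blast
      then show "?W #> a = ?W #> c" using r_coset_eq_iff[OF W] ac Uc by blast
    qed
  qed
  note finW = this
  have main: "cnt r' ((\<lambda>c. g <# c) ` E) = coset_count ?W (U r) * cnt r E" if E: "E \<in> inv_sets r" for E
  proof -
    let ?E = "(\<lambda>c. g <# c) ` E"
    have EX: "E \<subseteq> X" using E by (simp add: inv_sets_def)
    have lift_gE: "lift ?E = g <# lift E"
    proof (intro equalityI subsetI)
      fix a assume a: "a \<in> lift ?E"
      then obtain c where c: "c \<in> E" "a <# \<Gamma> = g <# c" "a \<in> carrier G" by (auto simp: lift_def)
      have "(inv g \<otimes> a) <# \<Gamma> = inv g <# (a <# \<Gamma>)" using act_mult[OF ginv c(3)] by simp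
      also have "\<dots> = c" using c act_inv[OF g] EX by auto
      finally have "inv g \<otimes> a \<in> lift E" using c g by (simp add: lift_def)
      moreover have "a = g \<otimes> (inv g \<otimes> a)" using c g by (simp add: m_assoc)
      ultimately show "a \<in> g <# lift E" unfolding l_coset_def by blast
    next
      fix a assume "a \<in> g <# lift E"
      then obtain c where "c \<in> lift E" "a = g \<otimes> c" by (auto simp: l_coset_def)
      then show "a \<in> lift ?E" using g act_mult[OF g, of c] by (auto simp: lift_def)
    qed
    have "cnt r' ?E = coset_count ?H (lift ?E \<inter> (g <# C))"
      unfolding cnt_def
      by (rule coset_count_translate[OF g U _ lift_carrier lift_right finite_cosets_C])
        (use r'(2) U(2) in blast)
    also have "lift ?E \<inter> (g <# C) = (\<lambda>x. g \<otimes> x) ` (lift E \<inter> C)"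
    proof -
      have "g <# S = (\<lambda>x. g \<otimes> x) ` S" for S by (auto simp: l_coset_def)
      moreover have "inj_on (\<lambda>x. g \<otimes> x) (carrier G)" using g by (auto intro!: inj_onI)
      then have "(\<lambda>x. g \<otimes> x) ` (lift E \<inter> C) = (\<lambda>x. g \<otimes> x) ` lift E \<inter> (\<lambda>x. g \<otimes> x) ` C"
        using lift_carrier subgroup.subset[OF C] by (rule inj_on_image_Int)
      ultimately show ?thesis unfolding lift_gE by simp
    qed
    also have "coset_count ?H ((\<lambda>x. g \<otimes> x) ` (lift E \<inter> C)) = coset_count ?W (lift E \<inter> C)"
    proof -
      have eq: "?H #> (g \<otimes> s) = g <# (?W #> s)" if s: "s \<in> carrier G" for s
      proof -
        have "g \<otimes> (inv g \<otimes> u \<otimes> g \<otimes> s) = u \<otimes> (g \<otimes> s)" if "u \<in> ?H" for u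
          using s g Uc[OF that] by (simp add: m_assoc)
        then show ?thesis unfolding r_coset_def l_coset_def by auto
      qed
      have "(\<lambda>a. ?H #> a) ` (\<lambda>x. g \<otimes> x) ` (lift E \<inter> C) = (\<lambda>D. g <# D) ` (\<lambda>a. ?W #> a) ` (lift E \<inter> C)"
        unfolding image_image using eq Cc by (intro image_cong) auto
      moreover have "inj_on (\<lambda>D. g <# D) ((\<lambda>a. ?W #> a) ` (lift E \<inter> C))"
      proof (rule inj_on_inverseI)
        fix D assume "D \<in> (\<lambda>a. ?W #> a) ` (lift E \<inter> C)"
        then have "D \<subseteq> carrier G" using r_coset_subset_G[OF subgroup.subset[OF W]] Cc by blast
        then show "inv g <# (g <# D) = D" using lcos_m_assoc[of D "inv g" g] g lcos_mult_one by simp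
      qed
      ultimately show ?thesis by (simp add: card_image)
    qed
    also have "\<dots> = coset_count ?W (U r) * coset_count (U r) (lift E \<inter> C)"
    proof (rule coset_count_mult[OF U(1) W WU])
      show "lift E \<inter> C \<subseteq> carrier G" using Cc by blast
      show "u \<otimes> s \<in> lift E \<inter> C" if "u \<in> U r" "s \<in> lift E \<inter> C" for u s
        using lift_left[OF E that(1)] that U(2) subgroup.m_closed[OF C] by blast
    qed (use finW finite_cosets_sub in auto)
    finally show ?thesis by (simp add: cnt_def)
  qed
  have "(\<lambda>c. g <# c) ` X = X"
  proof (intro equalityI subsetI)
    fix c assume c: "c \<in> X"
    have "g <# (inv g <# c) = c" using act_inv[OF ginv c] g by simp
    then show "c \<in> (\<lambda>c. g <# c) ` X" using act_X[OF ginv c] by (metis imageI)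
  qed (use act_X[OF g] in blast)
  then have "cnt r' X = coset_count ?W (U r) * cnt r X" using main[OF X_inv_sets] by simp
  then show ?thesis
    using main[OF E] cnt_X_pos[of r'] cnt_X_pos[of r] by (simp add: \<mu>_def)
qed

lemma f_invariant:
  assumes g: "g \<in> carrier G" and E: "E \<in> \<A>"
  shows "(\<lambda>c. g <# c) ` E \<in> \<A>" "f ((\<lambda>c. g <# c) ` E) = f E"
proof -
  obtain r where r: "E \<in> inv_sets r" using E by (auto simp: \<A>_def)
  obtain r0 where r0: "\<forall>u\<in>U r0. inv g \<otimes> u \<otimes> g \<in> U r" using conj[OF g] by blast
  let ?r = "max r r0"
  have r': "r \<le> ?r" "\<forall>u\<in>U ?r. inv g \<otimes> u \<otimes> g \<in> U r" using r0 U_le[of r0 ?r] by auto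
  have gE: "(\<lambda>c. g <# c) ` E \<in> inv_sets ?r" by (rule act_inv_sets[OF g r r'(2)])
  then show "(\<lambda>c. g <# c) ` E \<in> \<A>" by (auto simp: \<A>_def)
  show "f ((\<lambda>c. g <# c) ` E) = f E"
    using \<mu>_invariant[OF g r r'] f_eq[OF gE] f_eq[OF r] by simp
qed

text \<open>The groups \<open>U r\<close> form a countable neighbourhood basis, so an open set is
  the countable union of its largest \<open>U r\<close>-invariant parts. Hence the algebra generates
  the Borel sets.\<close>

lemma open_coset_Union:
  assumes W: "openin (coset_topology G \<tau> \<Gamma>) W"
  shows "W \<in> sigma_sets X \<A>"
proof -
  have W': "W \<subseteq> X" "openin \<tau> {g \<in> carrier G. g <# \<Gamma> \<in> W}"
    using W by (auto simp: openin_coset_topology)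
  define E where "E r = {c \<in> X. \<forall>u\<in>U r. u <# c \<in> W}" for r
  have "E r \<in> inv_sets r" for r
  proof -
    have "u <# c \<in> E r" if u: "u \<in> U r" "c \<in> E r" for u c
    proof -
      obtain h where h: "h \<in> carrier G" "c = h <# \<Gamma>" using u by (auto simp: E_def LCOSETS_def)
      have "w <# (u <# c) \<in> W" if w: "w \<in> U r" for w
      proof -
        have "w <# (u <# c) = (w \<otimes> u) <# c"
          using h Uc[OF w] Uc[OF u(1)] by (simp add: act_mult m_assoc)
        then show ?thesis using u subgroup.m_closed[OF U(1) w u(1)] by (simp add: E_def)
      qed
      then show ?thesis using u act_X[OF Uc[OF u(1)]] by (simp add: E_def)
    qed
    then show ?thesis unfolding inv_sets_def E_def by blast
  qed
  then have "E r \<in> \<A>" for r unfolding \<A>_def by blast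
  moreover have "W = (\<Union>r. E r)"
  proof (intro equalityI subsetI)
    fix c assume c: "c \<in> W"
    then obtain k where k: "k \<in> C" "c = k <# \<Gamma>" using W' X_cases by blast
    then obtain r where r: "U r #> k \<subseteq> {g \<in> carrier G. g <# \<Gamma> \<in> W}"
      using W'(2) c Cc unfolding open_iff by blast
    have "u <# c \<in> W" if u: "u \<in> U r" for u
    proof -
      have "u \<otimes> k \<in> U r #> k" using u by (auto simp: r_coset_def)
      then have "(u \<otimes> k) <# \<Gamma> \<in> W" using r by blast
      then show ?thesis using k Cc Uc[OF u] by (simp add: act_mult)
    qed
    then show "c \<in> (\<Union>r. E r)" using c W' unfolding E_def by blast
  next
    fix c assume "c \<in> (\<Union>r. E r)"
    then obtain r where r: "c \<in> X" "\<forall>u\<in>U r. u <# c \<in> W" unfolding E_def by blast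
    then have "\<one> <# c \<in> W" using subgroup.one_closed[OF U(1)] by blast
    moreover have "\<one> <# c = c" using r by (auto simp: LCOSETS_def act_mult)
    ultimately show "c \<in> W" by simp
  qed
  ultimately show ?thesis by (auto intro: sigma_sets.Union)
qed

lemma \<A>_open:
  assumes "E \<in> \<A>"
  shows "openin (coset_topology G \<tau> \<Gamma>) E"
  using assms lift_open by (auto simp: openin_coset_topology \<A>_def inv_sets_def lift_def)

lemma invariant_measure_exists: "\<exists>M. finite_invariant_measure G \<tau> \<Gamma> M"
proof -
  interpret algebra X \<A> by (rule algebra_\<A>)
  have "f E \<noteq> \<infinity>" for E by (simp add: f_def)
  then obtain m where m: "\<forall>E\<in>\<A>. m E = f E" "measure_space X (sigma_sets X \<A>) m"
    using caratheodory_empty_continuous[OF positive_f additive_f] empty_continuous by blast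
  define M where "M = measure_of X \<A> m"
  have \<A>X: "\<A> \<subseteq> Pow X" by (rule space_closed)
  have sets_M: "sets M = sigma_sets X \<A>" and space_M: "space M = X"
    using \<A>X by (simp_all add: M_def)
  have em: "emeasure M E = m E" if "E \<in> sigma_sets X \<A>" for E
    using that m(2) by (intro emeasure_measure_of[OF M_def \<A>X]) (auto simp: measure_space_def sets_M)
  have em\<A>: "emeasure M E = f E" if "E \<in> \<A>" for E using em[of E] m(1) that by auto
  have X\<A>: "X \<in> \<A>" by (rule top)
  have emX: "emeasure M X = 1"
    using em\<A>[OF X\<A>] f_eq[OF X_inv_sets, of 0] cnt_X_pos[of 0] by (simp add: \<mu>_def)
  have act_image: "(\<lambda>c. g <# c) ` A = (\<lambda>c. inv g <# c) -` A \<inter> X" if g: "g \<in> carrier G" and A: "A \<subseteq> X" for g A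
  proof (intro equalityI subsetI)
    fix c assume "c \<in> (\<lambda>c. inv g <# c) -` A \<inter> X"
    then have c: "inv g <# c \<in> A" "c \<in> X" by auto
    have "g <# (inv g <# c) = c" using act_inv[OF inv_closed[OF g] c(2)] g by simp
    then show "c \<in> (\<lambda>c. g <# c) ` A" using c by (metis imageI)
  qed (use act_X[OF g] act_inv[OF g] A in auto)
  have "finite_invariant_measure G \<tau> \<Gamma> M"
    unfolding finite_invariant_measure_def
  proof (intro conjI ballI)
    have "topspace (coset_topology G \<tau> \<Gamma>) = X" by (rule topspace_coset_topology[OF topspace_eq])
    then have opX: "{U. openin (coset_topology G \<tau> \<Gamma>) U} \<subseteq> Pow X" using openin_subset by blast
    have "sigma_sets X \<A> = sigma_sets X {U. openin (coset_topology G \<tau> \<Gamma>) U}"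
    proof (rule sigma_sets_eqI)
      show "E \<in> sigma_sets X {U. openin (coset_topology G \<tau> \<Gamma>) U}" if "E \<in> \<A>" for E
        using \<A>_open[OF that] by (intro sigma_sets.Basic) simp
      show "E \<in> sigma_sets X \<A>" if "E \<in> {U. openin (coset_topology G \<tau> \<Gamma>) U}" for E
        using open_coset_Union that by blast
    qed
    then show "sets M = sets (sigma X {U. openin (coset_topology G \<tau> \<Gamma>) U})"
      using opX sets_M by simp
    show "finite_measure M" by (rule finite_measureI) (simp add: space_M emX)
    show "emeasure M (space M) \<noteq> 0" by (simp add: space_M emX)
  next
    fix g A assume g: "g \<in> carrier G" and A: "A \<in> sets M"
    have AX: "A \<subseteq> X" using A sets.sets_into_space space_M by blast
    have meas: "(\<lambda>c. inv g <# c) \<in> measurable M M"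
    proof (rule measurable_sigma_sets[OF sets_M \<A>X])
      show "(\<lambda>c. inv g <# c) \<in> space M \<rightarrow> X" using act_X g by (auto simp: space_M)
      show "(\<lambda>c. inv g <# c) -` E \<inter> space M \<in> sets M" if E: "E \<in> \<A>" for E
      proof -
        have "E \<subseteq> X" using E \<A>X by blast
        then show ?thesis
          using f_invariant(1)[OF g E] act_image[OF g] sets_M space_M by auto
      qed
    qed
    \<comment> \<open>Both finite measures agree on an intersection-stable generator, so invariance
      passes from the algebra to all Borel sets.\<close>
    have "M = distr M M (\<lambda>c. inv g <# c)"
    proof (rule measure_eqI_generator_eq[where E = \<A> and \<Omega> = X and A = "\<lambda>_. X"])
      show "Int_stable \<A>" by (rule Int_stable) 
      show "emeasure M E = emeasure (distr M M (\<lambda>c. inv g <# c)) E" if E: "E \<in> \<A>" for E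
      proof -
        have "E \<subseteq> X" "E \<in> sets M" using E \<A>X sets_M by auto
        then show ?thesis
          using f_invariant[OF g E] act_image[OF g] em\<A> E
          by (simp add: emeasure_distr[OF meas] space_M)
      qed
    qed (use \<A>X X\<A> sets_M emX in auto)
    then have "emeasure M A = emeasure (distr M M (\<lambda>c. inv g <# c)) A" by simp
    also have "\<dots> = emeasure M ((\<lambda>c. g <# c) ` A)"
      using act_image[OF g AX] A by (simp add: emeasure_distr[OF meas] space_M)
    finally show "emeasure M ((\<lambda>c. g <# c) ` A) = emeasure M A" by simp
  qed
  then show ?thesis by blast
qed

text \<open>The finitely many nontrivial elements of \<open>C \<inter> \<Gamma>\<close> are all
  excluded by one small \<open>U r\<close>, whose translates then isolate the points of
  \<open>\<Gamma>\<close>.\<close>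

lemma discrete: "discrete_in \<tau> \<Gamma>"
proof -
  have "\<exists>r. U r \<inter> \<Gamma> = {\<one>}"
  proof -
    let ?F = "C \<inter> \<Gamma> - {\<one>}"
    have "\<forall>x\<in>?F. \<exists>r. x \<notin> U r" using Inter by blast
    then obtain \<rho> where \<rho>: "\<forall>x\<in>?F. x \<notin> U (\<rho> x)" by metis
    let ?r = "Max (insert 0 (\<rho> ` ?F))"
    have "x \<notin> U ?r" if x: "x \<in> ?F" for x
    proof -
      have "\<rho> x \<le> ?r" using fin x by (intro Max_ge) auto
      then show ?thesis using \<rho> x U_le by blast
    qed
    then have "U ?r \<inter> \<Gamma> = {\<one>}"
      using U(2) subgroup.one_closed[OF U(1)] subgroup.one_closed[OF \<Gamma>] by blast
    then show ?thesis by blast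
  qed
  then obtain r where r: "U r \<inter> \<Gamma> = {\<one>}" by blast
  have "openin (subtopology \<tau> \<Gamma>) {\<gamma>}" if \<gamma>: "\<gamma> \<in> \<Gamma>" for \<gamma>
  proof -
    have \<gamma>c: "\<gamma> \<in> carrier G" using \<gamma> Gc by blast
    have "openin \<tau> (U r #> \<gamma>)"
      unfolding open_iff
    proof (intro conjI ballI exI[of _ r])
      show "U r #> \<gamma> \<subseteq> carrier G" by (rule r_coset_subset_G[OF subgroup.subset[OF U(1)] \<gamma>c])
      show "U r #> g \<subseteq> U r #> \<gamma>" if "g \<in> U r #> \<gamma>" for g
        using repr_independence[OF that \<gamma>c U(1)] by simp
    qed
    moreover have "(U r #> \<gamma>) \<inter> \<Gamma> = {\<gamma>}"
    proof (intro equalityI subsetI)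
      fix x assume x: "x \<in> (U r #> \<gamma>) \<inter> \<Gamma>"
      then obtain u where u: "u \<in> U r" "x = u \<otimes> \<gamma>" by (auto simp: r_coset_def)
      have "u = x \<otimes> inv \<gamma>" using u \<gamma>c Uc by (simp add: m_assoc)
      then have "u \<in> \<Gamma>" using x \<gamma> subgroup.m_closed[OF \<Gamma>] subgroup.m_inv_closed[OF \<Gamma>] by simp
      then have "u = \<one>" using r u by blast
      then show "x \<in> {\<gamma>}" using u \<gamma>c by simp
    qed (use rcos_self[OF \<gamma>c U(1)] \<gamma> in auto)
    ultimately show ?thesis unfolding openin_subtopology by (metis)
  qed
  moreover have "topspace (subtopology \<tau> \<Gamma>) = \<Gamma>" using topspace_eq Gc by auto
  ultimately show ?thesis
    unfolding discrete_in_def by (metis discrete_topology_unique)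
qed

theorem cocompact_lattice: "cocompact_lattice_in G \<tau> \<Gamma>"
  unfolding cocompact_lattice_in_def lattice_in_def
proof (intro conjI \<Gamma> discrete invariant_measure_exists)
  have "continuous_map \<tau> (coset_topology G \<tau> \<Gamma>) (\<lambda>g. g <# \<Gamma>)"
    by (rule quotient_imp_continuous_map[OF quotient_map_coset_topology[OF topspace_eq]])
  then have "compactin (coset_topology G \<tau> \<Gamma>) ((\<lambda>g. g <# \<Gamma>) ` C)"
    by (rule image_compactin[OF compact])
  moreover have "(\<lambda>g. g <# \<Gamma>) ` C = X"
  proof (intro equalityI subsetI)
    fix c assume "c \<in> X"
    then show "c \<in> (\<lambda>g. g <# \<Gamma>) ` C" by (rule X_cases) blast
  qed (use Cc in \<open>auto simp: LCOSETS_def\<close>)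
  ultimately show "compact_space (coset_topology G \<tau> \<Gamma>)"
    unfolding compact_space_def topspace_coset_topology[OF topspace_eq] by simp
qed

end

section \<open>Polynomials modulo an integer\<close>

declare mult_pCons_left [simp del] mult_pCons_right [simp del]

abbreviation monic :: "int poly \<Rightarrow> bool" where "monic f \<equiv> lead_coeff f = 1"

lemma monic_mult: "monic f \<Longrightarrow> monic g \<Longrightarrow> monic (f * g)"
  by (simp add: lead_coeff_mult)

lemma monic_power: "monic f \<Longrightarrow> monic (f ^ n)"
  by (simp add: lead_coeff_power)

definition reduce_coeffs :: "int \<Rightarrow> int poly \<Rightarrow> int poly" where
  "reduce_coeffs b f = map_poly (\<lambda>c. c mod b) f"

lemma coeff_reduce_coeffs [simp]: "coeff (reduce_coeffs b f) n = coeff f n mod b"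
  by (simp add: reduce_coeffs_def coeff_map_poly)

lemma dvd_diff_reduce_coeffs: "[:b:] dvd f - reduce_coeffs b f"
  by (simp add: const_poly_dvd_iff minus_mod_eq_mult_div)

lemma reduce_coeffs_eq_0_iff: "reduce_coeffs b f = 0 \<longleftrightarrow> [:b:] dvd f"
  by (auto simp: const_poly_dvd_iff poly_eq_iff dvd_eq_mod_eq_0)

text \<open>Normal forms for the polynomials over Z/b of degree less than \<open>d\<close>.
  Vanishing of coefficients is used instead of a degree bound so that the zero polynomial and
  \<open>d = 0\<close> are no exceptions.\<close>

definition reduced_polys :: "int \<Rightarrow> nat \<Rightarrow> int poly set" where
  "reduced_polys b d = {h. (\<forall>n\<ge>d. coeff h n = 0) \<and> (\<forall>n. 0 \<le> coeff h n \<and> coeff h n < b)}"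

lemma card_reduced_polys:
  assumes "b \<ge> 2"
  shows "card (reduced_polys b d) = nat b ^ d" "finite (reduced_polys b d)"
proof -
  let ?L = "{xs :: int list. set xs \<subseteq> {0..<b} \<and> length xs = d}"
  have co: "coeff (Poly xs) n = (if n < d then xs ! n else 0)" if "xs \<in> ?L" for xs n
    using that by (auto simp: nth_default_def)
  have "bij_betw Poly ?L (reduced_polys b d)"
  proof (rule bij_betw_byWitness[where f' = "\<lambda>h. map (coeff h) [0..<d]"])
    show "\<forall>xs\<in>?L. map (coeff (Poly xs)) [0..<d] = xs"
      using co by (auto intro!: nth_equalityI)
    show "\<forall>h\<in>reduced_polys b d. Poly (map (coeff h) [0..<d]) = h"
      by (auto simp: reduced_polys_def poly_eq_iff nth_default_def)
    show "Poly ` ?L \<subseteq> reduced_polys b d"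
    proof
      fix h assume "h \<in> Poly ` ?L"
      then obtain xs where xs: "xs \<in> ?L" "h = Poly xs" by auto
      have "xs ! n \<in> {0..<b}" if "n < d" for n using xs that nth_mem by blast
      then show "h \<in> reduced_polys b d"
        using co[OF xs(1)] assms unfolding xs(2) reduced_polys_def by auto
    qed
    show "(\<lambda>h. map (coeff h) [0..<d]) ` reduced_polys b d \<subseteq> ?L"
      by (auto simp: reduced_polys_def)
  qed
  then show "card (reduced_polys b d) = nat b ^ d" "finite (reduced_polys b d)"
    using card_lists_length_eq[of "{0..<b}" d] finite_lists_length_eq[of "{0..<b}" d]
    by (auto simp: bij_betw_same_card[symmetric] bij_betw_finite)
qed

lemma reduced_polys_diff_eq_0:
  assumes "h \<in> reduced_polys b d" "h' \<in> reduced_polys b d" "[:b:] dvd h - h'"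
  shows "h = h'"
proof (rule poly_eqI)
  fix n
  have "b dvd coeff h n - coeff h' n" using assms(3) by (simp add: const_poly_dvd_iff)
  then have "coeff h n mod b = coeff h' n mod b" by (simp add: mod_eq_dvd_iff)
  then show "coeff h n = coeff h' n" using assms(1,2) by (simp add: reduced_polys_def)
qed

lemma reduce_coeffs_mem:
  assumes "b \<ge> 2" "f = 0 \<or> degree f < d"
  shows "reduce_coeffs b f \<in> reduced_polys b d"
proof -
  have "coeff f n = 0" if "n \<ge> d" for n using assms that by (auto intro: coeff_eq_0)
  then show ?thesis using assms by (simp add: reduced_polys_def)
qed

text \<open>Pseudo-division scales the dividend by a power of the leading coefficient of the
  divisor, which is 1 here.\<close>

lemma monic_division:
  fixes f g :: "int poly"
  assumes "monic g"
  obtains q r where "f = g * q + r" "r = 0 \<or> degree r < degree g"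
proof -
  obtain q r where qr: "pseudo_divmod f g = (q, r)" by force
  have "g \<noteq> 0" using assms by auto
  show ?thesis
    by (rule that[of q r]) (use pseudo_divmod[OF \<open>g \<noteq> 0\<close> qr] assms in auto)
qed

text \<open>A leading coefficient 1 survives reduction and is not a zero divisor, so degrees add
  modulo \<open>b\<close>. The typical use has \<open>h\<close> of degree less than that of
  \<open>g\<close>, which leaves only the divisibility of \<open>f\<close>; thus monic factors can
  be cancelled modulo \<open>b\<close>.\<close>

lemma monic_mult_cong:
  fixes f g h :: "int poly"
  assumes b: "b \<ge> 2" and g: "monic g" and "[:b:] dvd g * f - h"
  shows "[:b:] dvd f \<or> h \<noteq> 0 \<and> degree g + degree (reduce_coeffs b f) \<le> degree h"
proof (rule ccontr)
  let ?f = "reduce_coeffs b f"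
  assume neg: "\<not> ?thesis"
  then have f0: "?f \<noteq> 0" by (simp add: reduce_coeffs_eq_0_iff)
  let ?n = "degree g + degree ?f"
  have h0: "coeff h ?n = 0" using neg by (auto intro: coeff_eq_0)
  have "[:b:] dvd (g * f - h) - g * (f - ?f)"
    by (rule dvd_diff[OF assms(3) dvd_mult[OF dvd_diff_reduce_coeffs]])
  also have "(g * f - h) - g * (f - ?f) = g * ?f - h" by (simp add: algebra_simps)
  finally have "b dvd coeff (g * ?f - h) ?n" unfolding const_poly_dvd_iff by blast
  then have "b dvd lead_coeff ?f" using h0 g by (simp add: coeff_mult_degree_sum del: coeff_reduce_coeffs)
  moreover have "0 \<le> lead_coeff ?f" "lead_coeff ?f < b" using b by simp_all
  moreover have "lead_coeff ?f \<noteq> 0" using f0 by (simp only: leading_coeff_0_iff not_False_eq_True)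
  ultimately show False using zdvd_not_zless[of "lead_coeff ?f" b] by linarith
qed

text \<open>The images of \<open>f\<close> and \<open>g\<close> generate the unit ideal of (Z/b)[x].
  Over a ring with zero divisors this is the usable form of coprimality.\<close>

definition comaximal_mod :: "int \<Rightarrow> int poly \<Rightarrow> int poly \<Rightarrow> bool" where
  "comaximal_mod b f g \<longleftrightarrow> (\<exists>u v z. u * f + v * g = 1 + [:b:] * z)"

lemma comaximal_mod_commute: "comaximal_mod b f g \<longleftrightarrow> comaximal_mod b g f"
  unfolding comaximal_mod_def by (metis add.commute)

lemma comaximal_mod_1 [simp]: "comaximal_mod b f 1"
  unfolding comaximal_mod_def by (rule exI[of _ 0], rule exI[of _ 1], rule exI[of _ 0]) simp

lemma comaximal_mod_mult:
  assumes "comaximal_mod b f g" "comaximal_mod b f h"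
  shows "comaximal_mod b f (g * h)"
proof -
  obtain u v z u' v' z' where *: "u * f + v * g = 1 + [:b:] * z" "u' * f + v' * h = 1 + [:b:] * z'"
    using assms unfolding comaximal_mod_def by blast
  have "(u * f + v * g) * (u' * f + v' * h) = (1 + [:b:] * z) * (1 + [:b:] * z')"
    by (simp only: *)
  then have "(u * u' * f + u * v' * h + v * g * u') * f + (v * v') * (g * h) = 1 + [:b:] * (z + z' + [:b:] * z * z')"
    by (simp add: algebra_simps)
  then show ?thesis unfolding comaximal_mod_def by blast
qed

lemma comaximal_mod_power: "comaximal_mod b f g \<Longrightarrow> comaximal_mod b f (g ^ n)"
  by (induction n) (auto intro: comaximal_mod_mult)

lemma comaximal_mod_power2: "comaximal_mod b f g \<Longrightarrow> comaximal_mod b (f ^ m) (g ^ n)"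
  using comaximal_mod_power comaximal_mod_commute by blast

lemma comaximal_mod_prod:
  assumes "\<And>i. i \<in> A \<Longrightarrow> comaximal_mod b f (g i)"
  shows "comaximal_mod b f (prod g A)"
  using assms by (induction A rule: infinite_finite_induct) (auto intro: comaximal_mod_mult)

text \<open>A common factor of positive degree would divide 1 modulo \<open>b\<close>.\<close>

lemma not_comaximal_mod_multiple:
  assumes b: "b \<ge> 2" and f: "monic f" "degree f > 0" and dvd: "[:b:] dvd g - f * h"
  shows "\<not> comaximal_mod b f g"
proof
  assume "comaximal_mod b f g"
  then obtain u v z where uv: "u * f + v * g = 1 + [:b:] * z" unfolding comaximal_mod_def by blast
  have "f * (u + v * h) - 1 = [:b:] * z - v * (g - f * h)"
    using uv by (simp add: algebra_simps)
  then have *: "[:b:] dvd f * (u + v * h) - 1"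
    using dvd by (simp only: dvd_diff dvd_mult dvd_triv_left)
  then have "[:b:] dvd u + v * h" using monic_mult_cong[OF b f(1) *] f(2) by auto
  then have "[:b:] dvd f * (u + v * h) - (f * (u + v * h) - 1)" by (rule dvd_diff[OF dvd_mult *])
  then have "[:b:] dvd [:1:]" by (simp add: one_pCons)
  then have "b dvd 1" unfolding const_poly_dvd_const_poly_iff .
  then show False using b by simp
qed

section \<open>Localisation at a monic polynomial, and local rings modulo b\<close>

abbreviation em :: "int poly \<Rightarrow> int poly fract" where "em \<equiv> to_fract"

lemma em_power: "em (f ^ n) = em f ^ n"
  by (induction n) simp_all

locale localization =
  fixes b :: int and D :: "int poly"
  assumes b: "b \<ge> 2" and monic_D: "monic D"
begin

lemma monic_D_power: "monic (D ^ n)"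
  using monic_D by (rule monic_power)

lemma em_D_nz [simp]: "em D \<noteq> 0"
  using monic_D by auto

lemma monic_em_nz: "monic f \<Longrightarrow> em f \<noteq> 0"
  by auto

abbreviation \<beta> :: "int poly fract" where "\<beta> \<equiv> em [:b:]"

text \<open>The ring Z[x][1/D] before reduction. As \<open>D\<close> is monic, inverting it does not
  make \<open>b\<close> invertible.\<close>

definition K :: "int poly fract set" where
  "K = {x. \<exists>n f. em D ^ n * x = em f}"

lemma K_em [simp]: "em f \<in> K"
  unfolding K_def by (intro CollectI exI[of _ 0] exI[of _ f]) simp

lemma K_0 [simp]: "0 \<in> K" and K_1 [simp]: "1 \<in> K"
  using K_em[of 0] K_em[of 1] by simp_all

lemma K_add [intro]: "x \<in> K \<Longrightarrow> y \<in> K \<Longrightarrow> x + y \<in> K"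
proof -
  assume "x \<in> K" "y \<in> K"
  then obtain m f n g where *: "em D ^ m * x = em f" "em D ^ n * y = em g" unfolding K_def by auto
  have "em D ^ (m + n) * (x + y) = em (D ^ n * f + D ^ m * g)"
    by (simp add: power_add em_power *[symmetric] algebra_simps)
  then show ?thesis unfolding K_def by blast
qed

lemma K_mult [intro]: "x \<in> K \<Longrightarrow> y \<in> K \<Longrightarrow> x * y \<in> K"
proof -
  assume "x \<in> K" "y \<in> K"
  then obtain m f n g where *: "em D ^ m * x = em f" "em D ^ n * y = em g" unfolding K_def by auto
  have "em D ^ (m + n) * (x * y) = em (f * g)"
    by (simp add: power_add *[symmetric] algebra_simps)
  then show ?thesis unfolding K_def by blast
qed

lemma K_uminus [intro]: "x \<in> K \<Longrightarrow> - x \<in> K"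
  using K_mult[of "em (- 1)" x] K_em[of "- 1"] by simp

lemma K_diff [intro]: "x \<in> K \<Longrightarrow> y \<in> K \<Longrightarrow> x - y \<in> K"
  using K_add[of x "- y"] by auto

lemma K_power [intro]: "x \<in> K \<Longrightarrow> x ^ n \<in> K"
  by (induction n) auto

lemma K_inverse:
  assumes "f dvd D ^ n"
  shows "1 / em f \<in> K"
proof -
  obtain g where g: "D ^ n = f * g" using assms by auto
  then have "f \<noteq> 0" using monic_D_power[of n] by auto
  then have "em D ^ n * (1 / em f) = em g" by (simp add: em_power[symmetric] g)
  then show ?thesis unfolding K_def by blast
qed

text \<open>The way back from the localisation to Z[x]: after clearing the denominator, its power of
  the monic \<open>D\<close> is cancelled modulo \<open>b\<close>.\<close>

lemma em_mod_cong:
  assumes "k \<in> K" "\<beta> * k = em z"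
  shows "[:b:] dvd z"
proof -
  obtain n f where f: "em D ^ n * k = em f" using assms unfolding K_def by auto
  have "em (D ^ n * z) = em ([:b:] * f)"
    using f assms(2)[symmetric] by (simp add: em_power algebra_simps)
  then have "D ^ n * z - 0 = [:b:] * f" by (simp only: to_fract_eq_iff diff_zero)
  then have "[:b:] dvd D ^ n * z - 0" by (rule dvdI)
  then show ?thesis using monic_mult_cong[OF b monic_D_power] by blast
qed

text \<open>
  The elements of \<open>K\<close> that are, modulo \<open>b\<close>, regular at all zeros of \<open>w\<close>: any denominator prime
  to \<open>w\<close> may be replaced by one of the form \<open>1 - u w\<close>.
\<close>

definition Loc :: "int poly \<Rightarrow> int poly fract set" where
  "Loc w = {x \<in> K. \<exists>u f. \<exists>k\<in>K. (1 - em u * em w) * x = em f + \<beta> * k}"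

lemma LocI: "x \<in> K \<Longrightarrow> k \<in> K \<Longrightarrow> (1 - em u * em w) * x = em f + \<beta> * k \<Longrightarrow> x \<in> Loc w"
  unfolding Loc_def by blast

lemma Loc_K: "x \<in> Loc w \<Longrightarrow> x \<in> K"
  unfolding Loc_def by blast

lemma Loc_em [simp]: "em f \<in> Loc w"
  by (rule LocI[of _ 0 0 _ f]) auto

lemma Loc_beta: "k \<in> K \<Longrightarrow> \<beta> * k \<in> Loc w"
  by (rule LocI[of _ k 0 _ 0]) auto

lemma Loc_add [intro]:
  assumes "x \<in> Loc w" "y \<in> Loc w"
  shows "x + y \<in> Loc w"
proof -
  obtain u f k u' f' k' where *: "k \<in> K" "(1 - em u * em w) * x = em f + \<beta> * k"
    "k' \<in> K" "(1 - em u' * em w) * y = em f' + \<beta> * k'" using assms unfolding Loc_def by blast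
  let ?a = "1 - em u * em w" and ?a' = "1 - em u' * em w"
  have "(1 - em (u + u' - u * u' * w) * em w) * (x + y) = ?a' * (?a * x) + ?a * (?a' * y)"
    by (simp add: algebra_simps)
  also have "\<dots> = em ((1 - u' * w) * f + (1 - u * w) * f') + \<beta> * (?a' * k + ?a * k')"
    unfolding * by (simp add: algebra_simps)
  finally have eq: "(1 - em (u + u' - u * u' * w) * em w) * (x + y) = \<dots>" .
  show ?thesis
    using assms * by (intro LocI[OF _ _ eq]) (auto dest: Loc_K intro!: K_add K_mult K_diff)
qed

lemma Loc_mult [intro]:
  assumes "x \<in> Loc w" "y \<in> Loc w"
  shows "x * y \<in> Loc w"
proof -
  obtain u f k u' f' k' where *: "k \<in> K" "(1 - em u * em w) * x = em f + \<beta> * k"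
    "k' \<in> K" "(1 - em u' * em w) * y = em f' + \<beta> * k'" using assms unfolding Loc_def by blast
  let ?a = "1 - em u * em w" and ?a' = "1 - em u' * em w"
  have "(1 - em (u + u' - u * u' * w) * em w) * (x * y) = (?a * x) * (?a' * y)"
    by (simp add: algebra_simps)
  also have "\<dots> = em (f * f') + \<beta> * (em f * k' + k * em f' + \<beta> * (k * k'))"
    unfolding * by (simp add: algebra_simps)
  finally have eq: "(1 - em (u + u' - u * u' * w) * em w) * (x * y) = \<dots>" .
  show ?thesis
    using assms * by (intro LocI[OF _ _ eq]) (auto dest: Loc_K intro!: K_add K_mult K_diff)
qed

lemma Loc_uminus [intro]: "x \<in> Loc w \<Longrightarrow> - x \<in> Loc w"
  using Loc_mult[of "em (- 1)" w x] Loc_em[of "- 1" w] by simp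

lemma Loc_diff [intro]: "x \<in> Loc w \<Longrightarrow> y \<in> Loc w \<Longrightarrow> x - y \<in> Loc w"
  using Loc_add[of x w "- y"] by auto

text \<open>The Bezout identity says that a multiple of \<open>a\<close> is congruent to
  \<open>1 - u * w\<close>, which is the shape of denominator that \<open>Loc\<close>
  admits.\<close>

lemma Loc_inverse:
  assumes "comaximal_mod b w a" "1 / em a \<in> K" "a \<noteq> 0"
  shows "1 / em a \<in> Loc w"
proof -
  obtain u v z where uv: "u * w + v * a = 1 + [:b:] * z"
    using assms unfolding comaximal_mod_def by blast
  have "em (u * w + v * a) = em (1 + [:b:] * z)" by (simp only: uv)
  then have "1 - em u * em w = em v * em a - \<beta> * em z" by (simp add: algebra_simps)
  then have eq: "(1 - em u * em w) * (1 / em a) = em v + \<beta> * (- (em z * (1 / em a)))"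
    using assms(3) by (simp add: field_simps)
  show ?thesis
    by (rule LocI[OF assms(2) K_uminus[OF K_mult[OF K_em assms(2)]] eq])
qed

text \<open>A geometric sum turns the denominator \<open>1 - u * w\<close> into
  \<open>1 - (u * w) ^ n\<close>. Regularity at \<open>w\<close> thereby allows residues modulo
  every power of \<open>w\<close> to be taken.\<close>

lemma Loc_power:
  assumes "x \<in> Loc w"
  shows "x \<in> Loc (w ^ n)"
proof -
  obtain u f k where *: "k \<in> K" "(1 - em u * em w) * x = em f + \<beta> * k"
    using assms unfolding Loc_def by blast
  let ?S = "\<Sum>i<n. (u * w) ^ i"
  have "em (1 - (u * w) ^ n) = em ((1 - u * w) * ?S)" by (simp only: one_diff_power_eq)
  then have S: "1 - em (u ^ n) * em (w ^ n) = (1 - em u * em w) * em ?S"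
    by (simp only: power_mult_distrib to_fract_mult to_fract_diff to_fract_1)
  have "(1 - em (u ^ n) * em (w ^ n)) * x = em ?S * ((1 - em u * em w) * x)"
    unfolding S by (simp only: ac_simps)
  also have "\<dots> = em (?S * f) + \<beta> * (em ?S * k)"
    unfolding * by (simp only: to_fract_mult distrib_left ac_simps)
  finally have eq: "(1 - em (u ^ n) * em (w ^ n)) * x = \<dots>" .
  show ?thesis by (rule LocI[OF Loc_K[OF assms] K_mult[OF K_em *(1)] eq])
qed

lemma Loc_of_power:
  assumes "x \<in> Loc (w ^ Suc n)"
  shows "x \<in> Loc w"
proof -
  obtain u f k where *: "k \<in> K" "(1 - em u * em (w ^ Suc n)) * x = em f + \<beta> * k"
    using assms unfolding Loc_def by blast
  then have eq: "(1 - em (u * w ^ n) * em w) * x = em f + \<beta> * k"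
    by (simp add: algebra_simps)
  show ?thesis by (rule LocI[OF _ _ eq]) (use * Loc_K[OF assms] in auto)
qed

text \<open>The residue ring is (Z/b)[x]/(w). The common denominator \<open>g0\<close> is a unit
  there and only permutes the residues; a power of \<open>s\<close> in this role gives
  representatives without poles at the other places.\<close>

lemma Loc_residue:
  assumes w: "monic w" "1 / em w \<in> K" and g0: "g0 \<noteq> 0" "comaximal_mod b w g0" "1 / em g0 \<in> K"
    and x: "x \<in> Loc w"
  shows "\<exists>!h. h \<in> reduced_polys b (degree w) \<and> (x - em h / em g0) / em w \<in> Loc w"
proof -
  have w0: "em w \<noteq> 0" and g00: "em g0 \<noteq> 0" using w g0 by auto
  obtain u f k where *: "k \<in> K" "(1 - em u * em w) * x = em f + \<beta> * k"
    using x unfolding Loc_def by blast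
  obtain q h0 where q: "f * g0 = w * q + h0" "h0 = 0 \<or> degree h0 < degree w"
    using monic_division[OF w(1)] by blast
  define h where "h = reduce_coeffs b h0"
  obtain y where y: "h0 - h = [:b:] * y" using dvd_diff_reduce_coeffs[of b h0] by (auto simp: h_def)
  have e1: "em f * em g0 = em w * em q + em h + \<beta> * em y"
  proof -
    have "f * g0 = w * q + h + [:b:] * y" using q(1) y by (simp add: algebra_simps)
    then show ?thesis by (metis to_fract_add to_fract_mult)
  qed
  define G W where "G = 1 / em g0" and "W = 1 / em w"
  have GW: "em g0 * G = 1" "em w * W = 1" using w0 g00 by (simp_all add: G_def W_def)
  let ?y = "em u * (x - em h * G) + (em q + em u * em h) * G + \<beta> * ((k + em y * G) * W)"
  have "em w * ?y = em u * em w * x + \<beta> * k * (em w * W) + (em w * em q + \<beta> * em y * (em w * W)) * G"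
    by (simp add: algebra_simps)
  also have "\<dots> = em u * em w * x + \<beta> * k + (em f * em g0 - em h) * G"
    unfolding GW using e1 by simp
  also have "\<dots> = (em u * em w * x + \<beta> * k + em f) - em h * G"
    using GW(1) by (simp add: algebra_simps)
  also have "\<dots> = x - em h * G" using *(2) by (simp add: algebra_simps)
  finally have "(x - em h / em g0) / em w = ?y" using w0 by (simp add: field_simps G_def)
  moreover have "1 / em g0 \<in> Loc w" using g0 by (intro Loc_inverse)
  then have "?y \<in> Loc w"
    using x w(2) g0(3) * unfolding G_def W_def
    by (intro Loc_add Loc_mult Loc_diff Loc_beta K_add K_mult) simp_all
  moreover have "h \<in> reduced_polys b (degree w)"
    unfolding h_def using b q(2) by (rule reduce_coeffs_mem)
  moreover have "h1 = h2" if h12: "h1 \<in> reduced_polys b (degree w)" "(x - em h1 / em g0) / em w \<in> Loc w"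
    "h2 \<in> reduced_polys b (degree w)" "(x - em h2 / em g0) / em w \<in> Loc w" for h1 h2
  proof (rule reduced_polys_diff_eq_0[OF h12(1,3)])
    let ?d = "h1 - h2"
    have "(x - em h2 / em g0) / em w - (x - em h1 / em g0) / em w = em ?d / em g0 / em w"
      by (simp add: diff_divide_distrib)
    then have "em ?d / em g0 / em w \<in> Loc w" using Loc_diff[OF h12(4,2)] by simp
    then obtain u f k where *: "k \<in> K" "(1 - em u * em w) * (em ?d / em g0 / em w) = em f + \<beta> * k"
      unfolding Loc_def by blast
    have "\<beta> * (em w * em g0 * k) = em (?d - w * (u * ?d + g0 * f))"
      using *(2) w0 g00 by (simp add: field_simps)
    then have "[:b:] dvd ?d - w * (u * ?d + g0 * f)"
      by (rule em_mod_cong[OF K_mult[OF K_mult[OF K_em K_em] *(1)]])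
    then have dvd: "[:b:] dvd w * (u * ?d + g0 * f) - ?d" by (subst dvd_minus_iff[symmetric]) simp
    have "coeff ?d n = 0" if "n \<ge> degree w" for n
      using h12(1,3) that by (simp add: reduced_polys_def)
    then have "?d = 0 \<or> degree ?d < degree w"
      by (metis leading_coeff_0_iff not_le_imp_less)
    \<comment> \<open>A multiple of \<open>w\<close> congruent to a polynomial of degree less than
      that of \<open>w\<close> must vanish modulo \<open>b\<close>.\<close>
    then have "[:b:] dvd u * ?d + g0 * f"
      using monic_mult_cong[OF b w(1) dvd] by auto
    then have "[:b:] dvd w * (u * ?d + g0 * f) - (w * (u * ?d + g0 * f) - ?d)"
      by (rule dvd_diff[OF dvd_mult dvd])
    moreover have "w * (u * ?d + g0 * f) - (w * (u * ?d + g0 * f) - ?d) = ?d" by simp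
    ultimately show "[:b:] dvd ?d" by (simp only:)
  qed
  ultimately show ?thesis by auto
qed

text \<open>The elements of \<open>K\<close> that are, modulo \<open>b\<close>, regular at infinity.\<close>

definition LocInf :: "int poly fract set" where
  "LocInf = {x \<in> K. \<exists>g f. \<exists>k\<in>K. monic g \<and> degree f \<le> degree g \<and> em g * x = em f + \<beta> * k}"

lemma LocInfI: "x \<in> K \<Longrightarrow> k \<in> K \<Longrightarrow> monic g \<Longrightarrow> degree f \<le> degree g \<Longrightarrow> em g * x = em f + \<beta> * k \<Longrightarrow> x \<in> LocInf"
  unfolding LocInf_def by blast

lemma LocInf_K: "x \<in> LocInf \<Longrightarrow> x \<in> K"
  unfolding LocInf_def by blast

lemma LocInf_beta: "k \<in> K \<Longrightarrow> \<beta> * k \<in> LocInf"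
  by (rule LocInfI[of _ k 1 0]) auto

lemma LocInf_fract:
  assumes "monic g" "degree f \<le> degree g" "1 / em g \<in> K"
  shows "em f / em g \<in> LocInf"
  using assms K_mult[OF K_em[of f] assms(3)] by (intro LocInfI[of _ 0 g f]) auto

lemma degree_mult_monic: "monic g \<Longrightarrow> monic h \<Longrightarrow> degree (g * h) = degree g + degree h"
  for g h :: "int poly"
  by (rule degree_mult_eq) auto

lemma degree_mult_add_le:
  fixes f f' g g' :: "int poly"
  assumes "monic g" "monic g'" "degree f \<le> degree g" "degree f' \<le> degree g'"
  shows "degree (g' * f + g * f') \<le> degree (g * g')" "degree (f * f') \<le> degree (g * g')"
  using degree_mult_le[of g' f] degree_mult_le[of g f'] degree_mult_le[of f f'] assms
  by (auto simp: degree_mult_monic intro!: degree_add_le)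

lemma LocInf_add [intro]:
  assumes "x \<in> LocInf" "y \<in> LocInf"
  shows "x + y \<in> LocInf"
proof -
  obtain g f k g' f' k' where *: "k \<in> K" "monic g" "degree f \<le> degree g" "em g * x = em f + \<beta> * k"
    "k' \<in> K" "monic g'" "degree f' \<le> degree g'" "em g' * y = em f' + \<beta> * k'"
    using assms unfolding LocInf_def by blast
  have "em (g * g') * (x + y) = em g' * (em g * x) + em g * (em g' * y)" by (simp add: algebra_simps)
  also have "\<dots> = em (g' * f + g * f') + \<beta> * (em g' * k + em g * k')"
    unfolding * by (simp add: algebra_simps)
  finally have eq: "em (g * g') * (x + y) = \<dots>" .
  show ?thesis
    by (rule LocInfI[OF _ _ monic_mult[OF *(2,6)] _ eq])
      (use assms * degree_mult_add_le[OF *(2,6,3,7)] in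
        \<open>auto dest: LocInf_K intro!: K_add K_mult K_em\<close>)
qed

lemma LocInf_mult [intro]:
  assumes "x \<in> LocInf" "y \<in> LocInf"
  shows "x * y \<in> LocInf"
proof -
  obtain g f k g' f' k' where *: "k \<in> K" "monic g" "degree f \<le> degree g" "em g * x = em f + \<beta> * k"
    "k' \<in> K" "monic g'" "degree f' \<le> degree g'" "em g' * y = em f' + \<beta> * k'"
    using assms unfolding LocInf_def by blast
  have "em (g * g') * (x * y) = (em g * x) * (em g' * y)" by (simp add: algebra_simps)
  also have "\<dots> = em (f * f') + \<beta> * (em f * k' + k * em f' + \<beta> * (k * k'))"
    unfolding * by (simp add: algebra_simps)
  finally have eq: "em (g * g') * (x * y) = \<dots>" .
  show ?thesis
    by (rule LocInfI[OF _ _ monic_mult[OF *(2,6)] _ eq])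
      (use assms * degree_mult_add_le[OF *(2,6,3,7)] in
        \<open>auto dest: LocInf_K intro!: K_add K_mult K_em\<close>)
qed

lemma LocInf_const: "degree f = 0 \<Longrightarrow> em f \<in> LocInf"
  using LocInf_fract[of 1 f] by simp

lemma LocInf_uminus [intro]: "x \<in> LocInf \<Longrightarrow> - x \<in> LocInf"
  using LocInf_mult[OF LocInf_const[of "- 1"]] by simp

lemma LocInf_diff [intro]: "x \<in> LocInf \<Longrightarrow> y \<in> LocInf \<Longrightarrow> x - y \<in> LocInf"
  using LocInf_add[of x "- y"] by auto

text \<open>At infinity the uniformiser is the inverse of \<open>X\<close>, and residues modulo its
  power \<open>e\<close> are the top \<open>e\<close> coefficients of a numerator over
  \<open>g0\<close>. The exponent in \<open>Y\<close> places those of \<open>h\<close> exactly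
  there, since \<open>h\<close> has degree at most \<open>e - 1\<close> and \<open>h * Y\<close>
  thus at most the degree of \<open>g0\<close>.\<close>

lemma LocInf_residue:
  assumes e: "0 < e" "e \<le> degree g0" and g0: "monic g0" "1 / em g0 \<in> K" and x: "x \<in> LocInf"
  defines "X \<equiv> monom 1 1 :: int poly"
  defines "Y \<equiv> X ^ (degree g0 - e + 1)"
  shows "\<exists>!h. h \<in> reduced_polys b e \<and> (x - em h * em Y / em g0) * em X ^ e \<in> LocInf"
proof -
  let ?d = "degree g0"
  have g00: "em g0 \<noteq> 0" using g0 by auto
  have X: "monic (X ^ n)" "degree (X ^ n) = n" for n
    by (simp_all add: X_def monom_power degree_monom_eq)
  obtain g f k where *: "k \<in> K" "monic g" "degree f \<le> degree g" "em g * x = em f + \<beta> * k"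
    using x unfolding LocInf_def by blast
  have "g \<noteq> 0" using * by auto
  \<comment> \<open>Dividing by \<open>g\<close> makes \<open>w\<close> the numerator of
    \<open>x\<close> over \<open>g0\<close>, up to an error vanishing at infinity; dividing
    \<open>w\<close> by \<open>Y\<close> splits off its top \<open>e\<close> coefficients.\<close>
  obtain w r where w: "f * g0 = g * w + r" "r = 0 \<or> degree r < degree g"
    using monic_division[OF *(2)] by blast
  obtain h0 wl where h0: "w = Y * h0 + wl" "wl = 0 \<or> degree wl < degree Y"
    using monic_division[of Y] X unfolding Y_def by blast
  have degY: "degree Y = ?d - e + 1" unfolding Y_def by (rule X(2))
  have degw: "degree w \<le> ?d"
  proof (cases "w = 0")
    case False
    have "degree (f * g0) \<le> degree g + ?d"
      using degree_mult_le[of f g0] *(3) by simp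
    moreover have "g * w = f * g0 - r" using w(1) by simp
    ultimately have "degree (g * w) \<le> degree g + ?d"
      using w(2) degree_diff_le[of "f * g0" "degree g + ?d" r] by fastforce
    then show ?thesis using degree_mult_eq[OF \<open>g \<noteq> 0\<close> False] by simp
  qed simp
  have degh0: "h0 = 0 \<or> degree h0 < e"
  proof (cases "h0 = 0")
    case False
    have "Y \<noteq> 0" using degY by auto
    then have "degree (Y * h0) = ?d - e + 1 + degree h0"
      using False by (simp add: degree_mult_eq degY)
    moreover have "Y * h0 = w - wl" using h0(1) by simp
    moreover have "degree wl \<le> ?d" using h0(2) degY e by auto
    ultimately have "?d - e + 1 + degree h0 \<le> ?d" using degw degree_diff_le[of w ?d wl] by simp
    then have "degree h0 < e" using e by linarith
    then show ?thesis ..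
  qed simp
  define h where "h = reduce_coeffs b h0"
  obtain y where y: "h0 - h = [:b:] * y" using dvd_diff_reduce_coeffs[of b h0] by (auto simp: h_def)
  have "(x - em h * em Y / em g0) * em X ^ e \<in> LocInf"
  proof (rule LocInfI)
    show xK: "(x - em h * em Y / em g0) * em X ^ e \<in> K"
      using LocInf_K[OF x] K_mult[OF K_em[of "h * Y"] g0(2)] K_em[of X]
      by (intro K_mult K_diff K_power) simp_all
    show "monic (g * g0)" using * g0 by (intro monic_mult)
    show "em X ^ e * (em g * em Y * em y + em g0 * k) \<in> K"
      using * K_em[of X] by (intro K_mult K_add K_power) simp_all
    have "f * g0 = g * (Y * (h + [:b:] * y) + wl) + r"
      using w(1) h0(1) y by (simp add: algebra_simps)
    then have "em (f * g0) = em (g * (Y * (h + [:b:] * y) + wl) + r)" by (simp only:)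
    then have e2: "em f * em g0 = em g * (em Y * (em h + \<beta> * em y) + em wl) + em r"
      by (simp only: to_fract_add to_fract_mult)
    have "em (g * g0) * ((x - em h * em Y / em g0) * em X ^ e) =
        em X ^ e * (em g0 * (em g * x) - em g * em h * em Y)"
      using g00 by (simp add: field_simps)
    also have "\<dots> = em X ^ e * (em f * em g0 + \<beta> * (em g0 * k) - em g * em h * em Y)"
      unfolding *(4) by (simp add: algebra_simps)
    also have "\<dots> = em (X ^ e * (g * wl + r)) + \<beta> * (em X ^ e * (em g * em Y * em y + em g0 * k))"
      unfolding e2 by (simp add: em_power algebra_simps)
    finally show "em (g * g0) * ((x - em h * em Y / em g0) * em X ^ e) = \<dots>" .
    have "degree (g * wl + r) \<le> degree g + (?d - e)"
    proof (rule degree_add_le)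
      show "degree (g * wl) \<le> degree g + (?d - e)"
        using degree_mult_le[of g wl] h0(2) degY by auto
      show "degree r \<le> degree g + (?d - e)" using w(2) by auto
    qed
    then have "degree (X ^ e * (g * wl + r)) \<le> e + (degree g + (?d - e))"
      using degree_mult_le[of "X ^ e" "g * wl + r"] X(2)[of e] by linarith
    then show "degree (X ^ e * (g * wl + r)) \<le> degree (g * g0)"
      using e *(2) g0(1) by (simp add: degree_mult_monic)
  qed
  moreover have "h \<in> reduced_polys b e"
    unfolding h_def using b degh0 by (rule reduce_coeffs_mem)
  moreover have "h1 = h2" if h12: "h1 \<in> reduced_polys b e" "(x - em h1 * em Y / em g0) * em X ^ e \<in> LocInf"
    "h2 \<in> reduced_polys b e" "(x - em h2 * em Y / em g0) * em X ^ e \<in> LocInf" for h1 h2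
  proof (rule reduced_polys_diff_eq_0[OF h12(1,3)])
    let ?\<delta> = "h1 - h2"
    have "(x - em h2 * em Y / em g0) * em X ^ e - (x - em h1 * em Y / em g0) * em X ^ e
        = em ?\<delta> * em Y / em g0 * em X ^ e"
      using g00 by (simp add: field_simps)
    then have "em ?\<delta> * em Y / em g0 * em X ^ e \<in> LocInf" using LocInf_diff[OF h12(4,2)] by simp
    then obtain g f k where *: "k \<in> K" "monic g" "degree f \<le> degree g"
      "em g * (em ?\<delta> * em Y / em g0 * em X ^ e) = em f + \<beta> * k"
      unfolding LocInf_def by blast
    let ?G = "g * Y * X ^ e"
    have "\<beta> * (em g0 * k) = em (?G * ?\<delta> - g0 * f)"
      using *(4) g00 by (simp add: field_simps em_power)
    then have "[:b:] dvd ?G * ?\<delta> - g0 * f"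
      by (rule em_mod_cong[OF K_mult[OF K_em *(1)]])
    moreover have G: "monic ?G" "degree ?G = degree g + (?d - e + 1) + e"
    proof -
      have mY: "monic Y" unfolding Y_def by (rule X(1))
      have m: "monic (g * Y)" using *(2) mY by (rule monic_mult)
      show "monic ?G" using m X(1) by (rule monic_mult)
      show "degree ?G = degree g + (?d - e + 1) + e"
        using degree_mult_monic[OF m X(1)[of e]] degree_mult_monic[OF *(2) mY]
        by (simp only: X(2) degY)
    qed
    moreover have "degree (g0 * f) \<le> ?d + degree g"
      using degree_mult_le[of g0 f] *(3) by simp
    ultimately show "[:b:] dvd ?\<delta>"
      using monic_mult_cong[OF b G(1), of ?\<delta> "g0 * f"] e unfolding G(2) by linarith
  qed
  ultimately show ?thesis by auto
qed

end

section \<open>Places of a rational function ring\<close>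

text \<open>\<open>Q\<close> is membership in an additive subgroup that may reach beyond
  \<open>A\<close>, so what is counted are the cosets meeting \<open>A\<close>, each with one
  representative.\<close>

lemma card_cosets:
  fixes Q :: "'a::ab_group_add \<Rightarrow> bool"
  assumes S: "\<And>h. h \<in> S \<Longrightarrow> \<phi> h \<in> A"
    and ex: "\<And>x. x \<in> A \<Longrightarrow> \<exists>!h. h \<in> S \<and> Q (x - \<phi> h)"
    and Q: "Q 0" "\<And>x y. Q x \<Longrightarrow> Q y \<Longrightarrow> Q (x - y)"
  shows "card ((\<lambda>a. {x. Q (x - a)}) ` A) = card S"
proof -
  have Qe: "{x. Q (x - a)} = {x. Q (x - c)}" if "Q (a - c)" for a c
  proof -
    have "Q (x - a) \<longleftrightarrow> Q (x - c)" for x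
    proof
      assume "Q (x - a)"
      then have "Q (x - a - (0 - (a - c)))" using Q that by blast
      then show "Q (x - c)" by simp
    next
      assume "Q (x - c)"
      then have "Q (x - c - (a - c))" using Q that by blast
      then show "Q (x - a)" by simp
    qed
    then show ?thesis by simp
  qed
  have "bij_betw (\<lambda>h. {x. Q (x - \<phi> h)}) S ((\<lambda>a. {x. Q (x - a)}) ` A)"
  proof (rule bij_betw_imageI)
    show "inj_on (\<lambda>h. {x. Q (x - \<phi> h)}) S"
    proof (rule inj_onI)
      fix h h' assume h: "h \<in> S" "h' \<in> S" "{x. Q (x - \<phi> h)} = {x. Q (x - \<phi> h')}"
      have "\<phi> h \<in> {x. Q (x - \<phi> h)}" using Q(1) by simp
      then have "Q (\<phi> h - \<phi> h')" using h(3) by blast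
      then show "h = h'" using ex[OF S[OF h(1)]] h Q(1) by (metis diff_self)
    qed
    show "(\<lambda>h. {x. Q (x - \<phi> h)}) ` S = (\<lambda>a. {x. Q (x - a)}) ` A"
    proof (intro equalityI subsetI)
      fix C assume "C \<in> (\<lambda>a. {x. Q (x - a)}) ` A"
      then obtain a where a: "a \<in> A" "C = {x. Q (x - a)}" by blast
      then obtain h where "h \<in> S" "Q (a - \<phi> h)" using ex by blast
      then show "C \<in> (\<lambda>h. {x. Q (x - \<phi> h)}) ` S" using a Qe by blast
    qed (use S in blast)
  qed
  then show ?thesis using bij_betw_same_card by metis
qed

lemma reduced_polys_degree:
  assumes "h \<in> reduced_polys b d"
  shows "h = 0 \<or> degree h < d"
proof (rule ccontr)
  assume neg: "\<not> ?thesis"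
  then have "lead_coeff h = 0" using assms unfolding reduced_polys_def by auto
  then show False using neg by simp
qed

text \<open>Putting the pole of the first function at infinity makes regularity at all places bound
  degrees, as finiteness of stabilisers requires. The polynomial \<open>s\<close> avoids every other
  place, so its inverse powers are regular at all of them.\<close>

locale place_system =
  fixes b :: int and I :: "nat set" and p r :: "nat \<Rightarrow> int poly" and s :: "int poly"
  assumes b2: "b \<ge> 2" and fin_I: "finite I" and one_I: "1 \<in> I"
    and monic_p: "\<And>i. i \<in> I \<Longrightarrow> monic (p i)" and deg_p: "\<And>i. i \<in> I \<Longrightarrow> degree (p i) > 0"
    and monic_r: "\<And>i. i \<in> I \<Longrightarrow> monic (r i)"
    and monic_s: "monic s" and deg_s: "degree s > 0"
    and p_1: "p 1 = monom 1 1 ^ degree (p 1)" and r_1: "r 1 = 1"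
    and deg_r: "\<And>i. i \<in> I \<Longrightarrow> i \<noteq> 1 \<Longrightarrow> degree (r i) = degree (p i)"
    and comax_pp: "\<And>i j. i \<in> I \<Longrightarrow> j \<in> I \<Longrightarrow> i \<noteq> j \<Longrightarrow> comaximal_mod b (p i) (p j)"
    and comax_rr: "\<And>i j. i \<in> I \<Longrightarrow> j \<in> I \<Longrightarrow> i \<noteq> j \<Longrightarrow> comaximal_mod b (r i) (r j)"
    and comax_pr: "\<And>i j. i \<in> I \<Longrightarrow> j \<in> I \<Longrightarrow> comaximal_mod b (p i) (r j)"
    and comax_ps: "\<And>i. i \<in> I \<Longrightarrow> comaximal_mod b (p i) s"
    and comax_rs: "\<And>i. i \<in> I \<Longrightarrow> comaximal_mod b (r i) s"
begin

definition P :: "int poly" where "P = (\<Prod>i\<in>I. p i * r i)"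

lemma monic_P: "monic P"
proof -
  have "lead_coeff P = (\<Prod>i\<in>I. lead_coeff (p i * r i))" unfolding P_def by (rule lead_coeff_prod)
  also have "\<dots> = 1" using monic_p monic_r by (intro prod.neutral ballI monic_mult) auto
  finally show ?thesis .
qed

sublocale localization b "s * P"
  using b2 monic_mult[OF monic_s monic_P] by unfold_locales

lemma comax_rp: "i \<in> I \<Longrightarrow> j \<in> I \<Longrightarrow> comaximal_mod b (r i) (p j)"
  using comax_pr comaximal_mod_commute by blast

lemma split_P: "i \<in> I \<Longrightarrow> P = p i * r i * (\<Prod>j\<in>I - {i}. p j * r j)"
  unfolding P_def using fin_I by (simp add: prod.remove)

lemma p_dvd_P: "i \<in> I \<Longrightarrow> p i dvd P" and r_dvd_P: "i \<in> I \<Longrightarrow> r i dvd P"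
  by (simp_all add: split_P)

lemma em_p_nz: "i \<in> I \<Longrightarrow> em (p i) \<noteq> 0" and em_r_nz: "i \<in> I \<Longrightarrow> em (r i) \<noteq> 0"
  and em_s_nz: "em s \<noteq> 0" and em_P_nz: "em P \<noteq> 0"
  using monic_em_nz monic_p monic_r monic_s monic_P by blast+

lemma p_r_nz [simp]: "i \<in> I \<Longrightarrow> p i \<noteq> 0" "i \<in> I \<Longrightarrow> r i \<noteq> 0" "s \<noteq> 0" "P \<noteq> 0"
  using em_p_nz em_r_nz em_s_nz em_P_nz by (metis to_fract_0)+

lemma K_inv_dvd: "f dvd P \<Longrightarrow> 1 / em f \<in> K"
  using K_inverse[of f 1] by simp

lemma K_inv_s: "1 / em (s ^ m) \<in> K"
  using K_inverse[of "s ^ m" m] by (simp add: power_mult_distrib)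

section \<open>Regular elements and their residues\<close>

definition t :: "nat \<Rightarrow> int poly fract" where "t i = em (p i) / em (r i)"

definition Lp :: "nat \<Rightarrow> int poly fract set" where "Lp i = Loc (p i)"

definition Lm :: "nat \<Rightarrow> int poly fract set" where "Lm i = (if i = 1 then LocInf else Loc (r i))"

definition reg :: "nat \<Rightarrow> int poly fract set" where "reg i = Lp i \<inter> Lm i"

text \<open>Only the pole at \<open>s\<close> is bounded; poles at the zeros of \<open>P\<close> and
  at infinity are free, so the set is stable under multiplication by the \<open>t j\<close> and
  their inverses.\<close>

definition level :: "nat \<Rightarrow> int poly fract set" where
  "level m = {x. \<exists>n f. em P ^ n * em s ^ m * x = em f}"

lemma t_nz: "i \<in> I \<Longrightarrow> t i \<noteq> 0"
  by (simp add: t_def)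

lemma Lp_K: "x \<in> Lp i \<Longrightarrow> x \<in> K" and Lm_K: "x \<in> Lm i \<Longrightarrow> x \<in> K"
  by (auto simp: Lp_def Lm_def dest: Loc_K LocInf_K split: if_splits)

lemma Lp_add: "x \<in> Lp i \<Longrightarrow> y \<in> Lp i \<Longrightarrow> x + y \<in> Lp i"
  and Lp_diff: "x \<in> Lp i \<Longrightarrow> y \<in> Lp i \<Longrightarrow> x - y \<in> Lp i"
  and Lp_mult: "x \<in> Lp i \<Longrightarrow> y \<in> Lp i \<Longrightarrow> x * y \<in> Lp i"
  and Lp_em: "em f \<in> Lp i" and Lp_beta: "k \<in> K \<Longrightarrow> \<beta> * k \<in> Lp i"
  by (auto simp: Lp_def intro: Loc_beta)

lemma Lm_add: "x \<in> Lm i \<Longrightarrow> y \<in> Lm i \<Longrightarrow> x + y \<in> Lm i"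
  and Lm_diff: "x \<in> Lm i \<Longrightarrow> y \<in> Lm i \<Longrightarrow> x - y \<in> Lm i"
  and Lm_mult: "x \<in> Lm i \<Longrightarrow> y \<in> Lm i \<Longrightarrow> x * y \<in> Lm i"
  and Lm_1: "1 \<in> Lm i" and Lm_0: "0 \<in> Lm i" and Lm_beta: "k \<in> K \<Longrightarrow> \<beta> * k \<in> Lm i"
  using LocInf_const[of 1] LocInf_const[of 0] Loc_em[of 1] Loc_em[of 0]
  by (auto simp: Lm_def intro: Loc_beta LocInf_beta)

lemma LmI: "x \<in> LocInf \<Longrightarrow> x \<in> Loc (r i) \<Longrightarrow> x \<in> Lm i"
  by (simp add: Lm_def)

lemma reg_diff: "x \<in> reg i \<Longrightarrow> y \<in> reg i \<Longrightarrow> x - y \<in> reg i"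
  and reg_mult: "x \<in> reg i \<Longrightarrow> y \<in> reg i \<Longrightarrow> x * y \<in> reg i"
  and reg_0: "0 \<in> reg i" and reg_1: "1 \<in> reg i" and reg_K: "x \<in> reg i \<Longrightarrow> x \<in> K"
  and reg_beta: "k \<in> K \<Longrightarrow> \<beta> * k \<in> reg i"
  using Lp_em[of 0] Lp_em[of 1]
  by (auto simp: reg_def Lp_diff Lm_diff Lp_mult Lm_mult Lm_0 Lm_1 Lp_beta Lm_beta dest: Lp_K)

lemma Loc_fract:
  assumes "comaximal_mod b w a" "1 / em a \<in> K" "a \<noteq> 0"
  shows "em f / em a \<in> Loc w"
  using Loc_mult[OF Loc_em[of f] Loc_inverse[OF assms]] by simp

lemma t_Lp:
  assumes "i \<in> I" "j \<in> I"
  shows "t j \<in> Lp i" "i \<noteq> j \<Longrightarrow> inverse (t j) \<in> Lp i"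
  using assms Loc_fract[OF comax_pr[OF assms] K_inv_dvd[OF r_dvd_P] p_r_nz(2)]
    Loc_fract[OF comax_pp[OF assms] K_inv_dvd[OF p_dvd_P] p_r_nz(1)]
  by (simp_all add: t_def Lp_def)

lemma t_Lm:
  assumes "i \<in> I" "j \<in> I"
  shows "i \<noteq> j \<Longrightarrow> t j \<in> Lm i" "inverse (t j) \<in> Lm i"
proof -
  have "r j = 1 \<or> degree (r j) = degree (p j)" using deg_r[OF assms(2)] r_1 by auto
  then have deg: "degree (r j) \<le> degree (p j)" by auto
  show "t j \<in> Lm i" if "i \<noteq> j"
  proof (cases "i = 1")
    case True
    then show ?thesis
      using LocInf_fract[OF monic_r[OF assms(2)] _ K_inv_dvd[OF r_dvd_P[OF assms(2)]], of "p j"]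
        deg_r[OF assms(2)] that by (simp add: Lm_def t_def)
  next
    case False
    then show ?thesis
      using Loc_fract[OF comax_rr[OF assms that] K_inv_dvd[OF r_dvd_P[OF assms(2)]] p_r_nz(2)[OF assms(2)]]
      by (simp add: Lm_def t_def)
  qed
  show "inverse (t j) \<in> Lm i"
    using LocInf_fract[OF monic_p[OF assms(2)] deg K_inv_dvd[OF p_dvd_P[OF assms(2)]]]
      Loc_fract[OF comax_rp[OF assms] K_inv_dvd[OF p_dvd_P[OF assms(2)]] p_r_nz(1)[OF assms(2)]]
    by (simp add: Lm_def t_def)
qed

lemma t_reg:
  assumes "i \<in> I" "j \<in> I" "i \<noteq> j"
  shows "t j \<in> reg i" "inverse (t j) \<in> reg i"
  using t_Lp[OF assms(1,2)] t_Lm[OF assms(1,2)] assms(3) by (simp_all add: reg_def)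

lemma t_K: "j \<in> I \<Longrightarrow> t j \<in> K" "j \<in> I \<Longrightarrow> inverse (t j) \<in> K"
  using t_Lp(1)[of j j] t_Lm(2)[of j j] Lp_K Lm_K by blast+

text \<open>These fractions are regular at every place under consideration at once and supply the
  coset representatives: comaximality handles the finite places and the degree bound handles
  infinity.\<close>

lemma s_fract_reg:
  assumes i: "i \<in> I" and "degree f \<le> degree (s ^ m)"
  shows "em f / em (s ^ m) \<in> reg i"
  using LocInf_fract[OF monic_power[OF monic_s] assms(2) K_inv_s]
    Loc_fract[OF comaximal_mod_power[OF comax_ps[OF i]] K_inv_s]
    Loc_fract[OF comaximal_mod_power[OF comax_rs[OF i]] K_inv_s] p_r_nz(3)
  by (simp add: reg_def Lp_def Lm_def)

lemma degree_s_power: "degree (s ^ m) = m * degree s"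
  using degree_power_eq[OF p_r_nz(3)] by simp

lemma degree_reduced: "h \<in> reduced_polys b d \<Longrightarrow> degree h \<le> d - 1"
  unfolding reduced_polys_def by (intro degree_le) auto

lemma degree_reduced_s:
  assumes "h \<in> reduced_polys b d"
  shows "degree h \<le> degree (s ^ d)"
proof -
  have "d * 1 \<le> d * degree s" using deg_s by (intro mult_le_mono) auto
  then show ?thesis using degree_reduced[OF assms] unfolding degree_s_power by linarith
qed

text \<open>The index of \<open>reg i \<inter> t i reg i\<close> is the number of residues at the zeros of \<open>p i\<close>.\<close>

lemma card_reg_cosets_down:
  assumes i: "i \<in> I"
  shows "card ((\<lambda>a. {x. (x - a) * inverse (t i) \<in> reg i}) ` reg i) = nat b ^ degree (p i)"
proof -
  let ?e = "degree (p i)"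
  let ?g = "s ^ ?e"
  let ?\<phi> = "\<lambda>h. em h / em ?g"
  have g: "monic ?g" "?g \<noteq> 0" "1 / em ?g \<in> K" "comaximal_mod b (p i) ?g"
    using monic_power[OF monic_s] p_r_nz(3) K_inv_s comaximal_mod_power[OF comax_ps[OF i]] by auto
  have \<phi>: "?\<phi> h \<in> reg i" if "h \<in> reduced_polys b ?e" for h
    by (rule s_fract_reg[OF i degree_reduced_s[OF that]])
  \<comment> \<open>Since \<open>inverse (t i)\<close> is regular at the pole of \<open>t i\<close>,
    and \<open>r i\<close> is a unit at the zeros of \<open>p i\<close>, the condition at
    \<open>p i\<close> alone remains.\<close>
  have iff: "y * inverse (t i) \<in> reg i \<longleftrightarrow> y / em (p i) \<in> Loc (p i)" if "y \<in> reg i" for y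
  proof -
    have "y * inverse (t i) \<in> Lm i" using that t_Lm(2)[OF i i] Lm_mult by (auto simp: reg_def)
    moreover have "y * inverse (t i) = y / em (p i) * em (r i)"
      "y / em (p i) = y * inverse (t i) * (em 1 / em (r i))"
      using i by (simp_all add: t_def)
    moreover have "em 1 / em (r i) \<in> Loc (p i)"
      by (rule Loc_fract[OF comax_pr[OF i i] K_inv_dvd[OF r_dvd_P[OF i]] p_r_nz(2)[OF i]])
    ultimately show ?thesis
      by (metis IntD1 IntI Loc_em Loc_mult Lp_def reg_def)
  qed
  have "card ((\<lambda>a. {x. (x - a) * inverse (t i) \<in> reg i}) ` reg i) = card (reduced_polys b ?e)"
  proof (rule card_cosets[where \<phi> = ?\<phi> and Q = "\<lambda>y. y * inverse (t i) \<in> reg i"])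
    fix x assume x: "x \<in> reg i"
    then have "\<exists>!h. h \<in> reduced_polys b ?e \<and> (x - ?\<phi> h) / em (p i) \<in> Loc (p i)"
      by (intro Loc_residue[OF monic_p[OF i] K_inv_dvd[OF p_dvd_P[OF i]] g(2,4,3)])
        (simp add: reg_def Lp_def)
    then show "\<exists>!h. h \<in> reduced_polys b ?e \<and> (x - ?\<phi> h) * inverse (t i) \<in> reg i"
      using iff[OF reg_diff[OF x \<phi>]] by (simp cong: conj_cong)
  qed (use \<phi> reg_0 reg_diff in \<open>auto simp: left_diff_distrib\<close>)
  then show ?thesis using card_reduced_polys[OF b2] by simp
qed

text \<open>This time the residues at the pole of \<open>t i\<close> are counted: at
  \<open>r i\<close>, whose degree equals that of \<open>p i\<close>, or at infinity, where
  \<open>t 1\<close> is a power of \<open>X\<close>. The two halves of a neighbourhood thus have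
  equal size.\<close>

lemma card_reg_cosets_up:
  assumes i: "i \<in> I"
  shows "card ((\<lambda>a. {x. (x - a) * t i \<in> reg i}) ` reg i) = nat b ^ degree (p i)"
proof (cases "i = 1")
  case False
  let ?e = "degree (p i)"
  let ?g = "s ^ ?e"
  let ?\<phi> = "\<lambda>h. em h / em ?g"
  have g: "monic ?g" "?g \<noteq> 0" "1 / em ?g \<in> K" "comaximal_mod b (r i) ?g"
    using monic_power[OF monic_s] p_r_nz(3) K_inv_s comaximal_mod_power[OF comax_rs[OF i]] by auto
  have \<phi>: "?\<phi> h \<in> reg i" if "h \<in> reduced_polys b ?e" for h
    by (rule s_fract_reg[OF i degree_reduced_s[OF that]])
  have iff: "y * t i \<in> reg i \<longleftrightarrow> y / em (r i) \<in> Loc (r i)" if "y \<in> reg i" for y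
  proof -
    have "y * t i \<in> Lp i" using that t_Lp(1)[OF i i] Lp_mult by (auto simp: reg_def)
    moreover have "y * t i = y / em (r i) * em (p i)"
      "y / em (r i) = y * t i * (em 1 / em (p i))"
      using i by (simp_all add: t_def)
    moreover have "em 1 / em (p i) \<in> Loc (r i)"
      by (rule Loc_fract[OF comax_rp[OF i i] K_inv_dvd[OF p_dvd_P[OF i]] p_r_nz(1)[OF i]])
    moreover have "Lm i = Loc (r i)" using False by (simp add: Lm_def)
    ultimately show ?thesis
      by (metis IntD2 IntI Loc_em Loc_mult reg_def)
  qed
  have "card ((\<lambda>a. {x. (x - a) * t i \<in> reg i}) ` reg i) = card (reduced_polys b ?e)"
  proof (rule card_cosets[where \<phi> = ?\<phi> and Q = "\<lambda>y. y * t i \<in> reg i"])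
    fix x assume x: "x \<in> reg i"
    then have "\<exists>!h. h \<in> reduced_polys b (degree (r i)) \<and> (x - ?\<phi> h) / em (r i) \<in> Loc (r i)"
      using False by (intro Loc_residue[OF monic_r[OF i] K_inv_dvd[OF r_dvd_P[OF i]] g(2,4,3)])
        (simp add: reg_def Lm_def)
    then show "\<exists>!h. h \<in> reduced_polys b ?e \<and> (x - ?\<phi> h) * t i \<in> reg i"
      using iff[OF reg_diff[OF x \<phi>]] deg_r[OF i False] by (simp cong: conj_cong)
  qed (use \<phi> reg_0 reg_diff in \<open>auto simp: left_diff_distrib\<close>)
  then show ?thesis using card_reduced_polys[OF b2] by simp
next
  case True
  let ?e = "degree (p i)"
  let ?g = "s ^ ?e"
  let ?X = "monom 1 1 :: int poly"
  let ?Y = "?X ^ (degree ?g - ?e + 1)"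
  let ?\<phi> = "\<lambda>h. em h * em ?Y / em ?g"
  have g: "monic ?g" "1 / em ?g \<in> K" using monic_power[OF monic_s] K_inv_s by auto
  have e: "0 < ?e" "?e \<le> degree ?g" using deg_p[OF i] deg_s by (auto simp: degree_s_power)
  have ti: "t i = em ?X ^ ?e"
    using arg_cong[OF p_1, of em] True r_1 by (simp add: t_def em_power)
  have \<phi>: "?\<phi> h \<in> reg i" if "h \<in> reduced_polys b ?e" for h
  proof -
    have X: "degree (?X ^ k) = k" for k by (simp add: monom_power degree_monom_eq)
    have "degree (h * ?Y) \<le> degree h + degree ?Y" by (rule degree_mult_le)
    also have "degree ?Y = degree ?g - ?e + 1" by (rule X)
    finally have "degree (h * ?Y) \<le> degree ?g" using degree_reduced[OF that] e by linarith
    then show ?thesis using s_fract_reg[OF i, of "h * ?Y" ?e] by (simp only: to_fract_mult)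
  qed
  have iff: "y * t i \<in> reg i \<longleftrightarrow> y * em ?X ^ ?e \<in> LocInf" if "y \<in> reg i" for y
    using that t_Lp(1)[OF i i] Lp_mult True ti by (auto simp: reg_def Lm_def)
  have "card ((\<lambda>a. {x. (x - a) * t i \<in> reg i}) ` reg i) = card (reduced_polys b ?e)"
  proof (rule card_cosets[where \<phi> = ?\<phi> and Q = "\<lambda>y. y * t i \<in> reg i"])
    fix x assume x: "x \<in> reg i"
    then have "\<exists>!h. h \<in> reduced_polys b ?e \<and> (x - ?\<phi> h) * em ?X ^ ?e \<in> LocInf"
      using True by (intro LocInf_residue e g) (auto simp: reg_def Lm_def)
    then show "\<exists>!h. h \<in> reduced_polys b ?e \<and> (x - ?\<phi> h) * t i \<in> reg i"
      using iff[OF reg_diff[OF x \<phi>]] by (simp cong: conj_cong)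
  qed (use \<phi> reg_0 reg_diff in \<open>auto simp: left_diff_distrib\<close>)
  then show ?thesis using card_reduced_polys[OF b2] by simp
qed

section \<open>Elements with bounded poles at s\<close>

lemma level_add: "x \<in> level m \<Longrightarrow> y \<in> level m \<Longrightarrow> x + y \<in> level m"
proof -
  assume "x \<in> level m" "y \<in> level m"
  then obtain n f n' g where *: "em P ^ n * em s ^ m * x = em f" "em P ^ n' * em s ^ m * y = em g"
    unfolding level_def by auto
  have "em P ^ (n + n') * em s ^ m * (x + y) = em (P ^ n' * f + P ^ n * g)"
    by (simp add: power_add em_power *[symmetric] algebra_simps)
  then show ?thesis unfolding level_def by blast
qed

lemma level_em_mult: "x \<in> level m \<Longrightarrow> em g * x \<in> level m"
proof -
  assume "x \<in> level m"
  then obtain n f where *: "em P ^ n * em s ^ m * x = em f" unfolding level_def by auto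
  have "em P ^ n * em s ^ m * (em g * x) = em (g * f)"
    by (simp add: *[symmetric] algebra_simps)
  then show ?thesis unfolding level_def by blast
qed

lemma level_diff: "x \<in> level m \<Longrightarrow> y \<in> level m \<Longrightarrow> x - y \<in> level m"
  using level_add[of x m "em (- 1) * y"] level_em_mult[of y m "- 1"] by simp

lemma level_0: "0 \<in> level m"
  unfolding level_def by (intro CollectI exI[of _ 0]) simp

lemma level_divide:
  assumes "f dvd P ^ k" "x \<in> level m"
  shows "x / em f \<in> level m"
proof -
  obtain g where g: "P ^ k = f * g" using assms(1) by auto
  obtain n h where *: "em P ^ n * em s ^ m * x = em h" using assms unfolding level_def by auto
  have "em P ^ k = em f * em g" "f \<noteq> 0" using g by (auto simp flip: em_power)
  then have "em P ^ (n + k) * em s ^ m * (x / em f) = em (g * h)"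
    by (simp add: power_add *[symmetric] field_simps)
  then show ?thesis unfolding level_def by blast
qed

lemma level_t:
  assumes "j \<in> I" "x \<in> level m"
  shows "t j * x \<in> level m" "inverse (t j) * x \<in> level m"
  using level_em_mult[OF level_divide[of "r j" 1 x m], of "p j"]
    level_em_mult[OF level_divide[of "p j" 1 x m], of "r j"] assms p_dvd_P r_dvd_P
  by (simp_all add: t_def)

lemma em_level: "em f \<in> level m"
  unfolding level_def by (intro CollectI exI[of _ 0] exI[of _ "s ^ m * f"]) (simp add: em_power)

lemma level_Suc: "level m \<subseteq> level (Suc m)"
proof
  fix x assume "x \<in> level m"
  then obtain n f where *: "em P ^ n * em s ^ m * x = em f" unfolding level_def by auto
  have "em P ^ n * em s ^ Suc m * x = em (s * f)"
    by (simp add: *[symmetric] algebra_simps)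
  then show "x \<in> level (Suc m)" unfolding level_def by blast
qed

lemma level_K: "level m \<subseteq> K"
proof
  fix x assume "x \<in> level m"
  then obtain n f where *: "em P ^ n * em s ^ m * x = em f" unfolding level_def by auto
  have "em (s * P) ^ (n + m) * x = em (s ^ n * P ^ m * f)"
    by (simp add: power_add power_mult_distrib em_power *[symmetric] algebra_simps)
  then show "x \<in> K" unfolding K_def by blast
qed

section \<open>Principal parts, approximation and finiteness\<close>

lemma principal_part:
  assumes w: "monic w" "w dvd P" and Dw: "s * P = w * Dw" "comaximal_mod b w Dw" and x: "x \<in> K"
  obtains N h where "h = 0 \<or> degree h < degree (w ^ N)" "x - em h / em (w ^ N) \<in> Loc w"
proof -
  obtain n f where f: "em (s * P) ^ n * x = em f" using x unfolding K_def by auto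
  have "comaximal_mod b w (Dw ^ n)" using Dw(2) by (rule comaximal_mod_power)
  then obtain u v z where uv: "u * w + v * Dw ^ n = 1 + [:b:] * z" unfolding comaximal_mod_def by blast
  have w0: "w \<noteq> 0" using w by auto
  let ?y = "em (w ^ n) * x"
  have K1: "?y \<in> K" using x by (intro K_mult K_em)
  have "em u * em w + em v * em (Dw ^ n) = 1 + \<beta> * em z"
    using arg_cong[OF uv, of em] by simp
  then have e: "1 - em u * em w = em v * em (Dw ^ n) - \<beta> * em z" by (simp add: algebra_simps)
  have "(1 - em u * em w) * ?y = em v * (em (Dw ^ n) * ?y) - \<beta> * (em z * ?y)"
    unfolding e by (simp add: algebra_simps)
  also have "em (Dw ^ n) * ?y = em f"
    unfolding f[symmetric] Dw(1) by (simp add: em_power power_mult_distrib)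
  finally have eq: "(1 - em u * em w) * ?y = em (v * f) + \<beta> * (- (em z * ?y))" by simp
  have y: "?y \<in> Loc w" by (rule LocI[OF K1 K_uminus[OF K_mult[OF K_em K1]] eq])
  have "?y * em w \<in> Loc w" using y by (rule Loc_mult) simp
  \<comment> \<open>One factor of \<open>w\<close> more than the pole order ensures a positive
    exponent; \<open>Loc (w ^ 0)\<close> would impose no condition at \<open>w\<close>.\<close>
  then have y1: "em (w ^ Suc n) * x \<in> Loc (w ^ Suc n)" by (intro Loc_power) (simp add: mult_ac)
  have "w ^ Suc n dvd (s * P) ^ Suc n"
    using w(2) by (intro dvd_power_same) (rule dvd_mult)
  then obtain h where h: "h \<in> reduced_polys b (degree (w ^ Suc n))"
    "(em (w ^ Suc n) * x - em h / em 1) / em (w ^ Suc n) \<in> Loc (w ^ Suc n)"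
    using Loc_residue[OF monic_power[OF w(1)] K_inverse _ _ _ y1, of "Suc n" 1] by auto
  have "x - em h / em (w ^ Suc n) = (em (w ^ Suc n) * x - em h / em 1) / em (w ^ Suc n)"
    using w0 by (simp add: diff_divide_distrib)
  then have "x - em h / em (w ^ Suc n) \<in> Loc w" using Loc_of_power[OF h(2)] by (simp only:)
  moreover have "h = 0 \<or> degree h < degree (w ^ Suc n)"
    using h(1) by (rule reduced_polys_degree)
  ultimately show ?thesis using that by blast
qed

text \<open>Partial fractions: the polar part is a fraction over a power of \<open>p i\<close> whose
  numerator has smaller degree, so it is regular at infinity and, by comaximality, at all other
  places.\<close>

lemma Lp_principal_part:
  assumes i: "i \<in> I" and x: "x \<in> K"
  obtains y where "y \<in> level m" "y - x \<in> Lp i" "y \<in> Lm i" "\<And>j. j \<in> I \<Longrightarrow> j \<noteq> i \<Longrightarrow> y \<in> reg j"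
proof -
  have "s * P = p i * (s * (r i * (\<Prod>j\<in>I - {i}. p j * r j)))"
    using split_P[OF i] by (simp add: mult_ac)
  moreover have "comaximal_mod b (p i) (s * (r i * (\<Prod>j\<in>I - {i}. p j * r j)))"
    using i comax_ps comax_pr comax_pp by (intro comaximal_mod_mult comaximal_mod_prod) auto
  ultimately obtain N h where h: "h = 0 \<or> degree h < degree (p i ^ N)" "x - em h / em (p i ^ N) \<in> Loc (p i)"
    using principal_part[OF monic_p[OF i] p_dvd_P[OF i] _ _ x] by metis
  let ?y = "em h / em (p i ^ N)"
  have dvd: "p i ^ N dvd P ^ N" using p_dvd_P[OF i] by (rule dvd_power_same)
  then have inv: "1 / em (p i ^ N) \<in> K"
    by (intro K_inverse[of _ N]) (simp add: power_mult_distrib)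
  have ne: "p i ^ N \<noteq> 0" using i by simp
  have inf: "?y \<in> LocInf"
    using h(1) by (intro LocInf_fract monic_power monic_p i inv) auto
  show ?thesis
  proof (rule that[of ?y])
    show "?y \<in> level m" using dvd em_level by (rule level_divide)
    show "?y - x \<in> Lp i" using Loc_uminus[OF h(2)] by (simp add: Lp_def)
    have Lr: "?y \<in> Loc (r j)" if "j \<in> I" for j
      using that i by (intro Loc_fract comaximal_mod_power comax_rp inv ne)
    show "?y \<in> Lm i" by (rule LmI[OF inf Lr[OF i]])
    show "?y \<in> reg j" if j: "j \<in> I" "j \<noteq> i" for j
    proof -
      have "?y \<in> Loc (p j)"
        using j i by (intro Loc_fract comaximal_mod_power comax_pp inv ne)
      then show ?thesis
        using LmI[OF inf Lr[OF j(1)]] unfolding reg_def Lp_def by (rule IntI)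
    qed
  qed
qed

lemma Lm_principal_part:
  assumes i: "i \<in> I" and x: "x \<in> K"
  obtains y where "y \<in> level m" "y - x \<in> Lm i" "y \<in> Lp i" "\<And>j. j \<in> I \<Longrightarrow> j \<noteq> i \<Longrightarrow> y \<in> reg j"
proof (cases "i = 1")
  case False
  have "s * P = r i * (s * (p i * (\<Prod>j\<in>I - {i}. p j * r j)))"
    using split_P[OF i] by (simp add: mult_ac)
  moreover have "comaximal_mod b (r i) (s * (p i * (\<Prod>j\<in>I - {i}. p j * r j)))"
    using i comax_rs comax_rp comax_rr by (intro comaximal_mod_mult comaximal_mod_prod) auto
  ultimately obtain N h where h: "h = 0 \<or> degree h < degree (r i ^ N)" "x - em h / em (r i ^ N) \<in> Loc (r i)"
    using principal_part[OF monic_r[OF i] r_dvd_P[OF i] _ _ x] by metis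
  let ?y = "em h / em (r i ^ N)"
  have dvd: "r i ^ N dvd P ^ N" using r_dvd_P[OF i] by (rule dvd_power_same)
  then have inv: "1 / em (r i ^ N) \<in> K"
    by (intro K_inverse[of _ N]) (simp add: power_mult_distrib)
  have ne: "r i ^ N \<noteq> 0" using i by simp
  have inf: "?y \<in> LocInf"
    using h(1) by (intro LocInf_fract monic_power monic_r i inv) auto
  show ?thesis
  proof (rule that[of ?y])
    show "?y \<in> level m" using dvd em_level by (rule level_divide)
    show "?y - x \<in> Lm i" using Loc_uminus[OF h(2)] False by (simp add: Lm_def)
    have Lp: "?y \<in> Lp j" if "j \<in> I" for j
      unfolding Lp_def using that i by (intro Loc_fract comaximal_mod_power comax_pr inv ne)
    show "?y \<in> Lp i" by (rule Lp[OF i])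
    show "?y \<in> reg j" if j: "j \<in> I" "j \<noteq> i" for j
    proof -
      have "?y \<in> Loc (r j)"
        using j i by (intro Loc_fract comaximal_mod_power comax_rr inv ne)
      then show ?thesis
        using LmI[OF inf] Lp[OF j(1)] unfolding reg_def by blast
    qed
  qed
next
  case True
  obtain n f where f: "em (s * P) ^ n * x = em f" using x unfolding K_def by auto
  \<comment> \<open>The polar part at infinity is the polynomial part; the remaining proper fraction
    is regular there.\<close>
  obtain q h where q: "f = (s * P) ^ n * q + h" "h = 0 \<or> degree h < degree ((s * P) ^ n)"
    using monic_division[OF monic_D_power] by blast
  have "em f = em (s * P) ^ n * em q + em h"
    using arg_cong[OF q(1), of em] by (simp add: em_power)
  then have "em (s * P) ^ n * (x - em q) = em h" using f by (simp add: right_diff_distrib)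
  then have "x - em q = em h / em ((s * P) ^ n)"
    using p_r_nz by (simp add: em_power field_simps)
  then have "x - em q \<in> LocInf"
    using q(2) LocInf_fract[OF monic_D_power _ K_inverse[OF dvd_refl], of h n] by auto
  then have "em q - x \<in> Lm i" using LocInf_uminus True by (fastforce simp: Lm_def)
  moreover have "em q \<in> reg j" if "j \<in> I" "j \<noteq> i" for j
    using True that by (simp add: reg_def Lp_def Lm_def)
  ultimately show ?thesis using that[of "em q"] em_level Lp_em by blast
qed

lemma sum_closed:
  assumes "finite A" "\<And>j. j \<in> A \<Longrightarrow> f j \<in> L" "0 \<in> L" "\<And>x y. x \<in> L \<Longrightarrow> y \<in> L \<Longrightarrow> x + y \<in> L"
  shows "sum f A \<in> L"
  using assms(1,2) by (induction A rule: finite_induct) (auto intro: assms(3,4))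

text \<open>Strong approximation: the polar parts at all zeros and poles are added up, each
  disturbing its own place only. None of them has a pole at \<open>s\<close>, so the level is at
  will.\<close>

lemma approximation:
  assumes x: "\<And>i. i \<in> I \<Longrightarrow> x i \<in> K"
  obtains y where "y \<in> level m" "\<And>i. i \<in> I \<Longrightarrow> y - x i \<in> reg i"
proof -
  have "\<forall>i\<in>I. \<exists>a. a \<in> level m \<and> a - x i \<in> Lp i \<and> a \<in> Lm i \<and> (\<forall>j\<in>I. j \<noteq> i \<longrightarrow> a \<in> reg j)"
    using Lp_principal_part[OF _ x] by metis
  then obtain a where a: "\<forall>i\<in>I. a i \<in> level m \<and> a i - x i \<in> Lp i \<and> a i \<in> Lm i \<and> (\<forall>j\<in>I. j \<noteq> i \<longrightarrow> a i \<in> reg j)"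
    by metis
  have "\<forall>i\<in>I. \<exists>c. c \<in> level m \<and> c - x i \<in> Lm i \<and> c \<in> Lp i \<and> (\<forall>j\<in>I. j \<noteq> i \<longrightarrow> c \<in> reg j)"
    using Lm_principal_part[OF _ x] by metis
  then obtain c where c: "\<forall>i\<in>I. c i \<in> level m \<and> c i - x i \<in> Lm i \<and> c i \<in> Lp i \<and> (\<forall>j\<in>I. j \<noteq> i \<longrightarrow> c i \<in> reg j)"
    by metis
  let ?y = "\<Sum>j\<in>I. a j + c j"
  show ?thesis
  proof (rule that[of ?y])
    show "?y \<in> level m"
      using a c by (intro sum_closed fin_I level_add level_0) auto
    fix i assume i: "i \<in> I"
    have reg_add: "u + v \<in> reg i" if "u \<in> reg i" "v \<in> reg i" for u v
      using that by (auto simp: reg_def Lp_add Lm_add)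
    have rest: "(\<Sum>j\<in>I - {i}. a j + c j) \<in> reg i" (is "?z \<in> _")
      using a c fin_I i reg_add by (intro sum_closed reg_0) auto
    have split: "?y = a i + c i + ?z" using fin_I i by (simp add: sum.remove)
    have e: "?y - x i = (a i - x i) + c i + ?z" "?y - x i = (c i - x i) + a i + ?z"
      unfolding split by simp_all
    have "(a i - x i) + c i + ?z \<in> Lp i" "(c i - x i) + a i + ?z \<in> Lm i"
      using a c i rest by (auto simp: reg_def intro!: Lp_add Lm_add)
    then have "?y - x i \<in> Lp i" "?y - x i \<in> Lm i" unfolding e[symmetric] by (simp_all only:)
    then show "?y - x i \<in> reg i" unfolding reg_def by blast
  qed
qed

text \<open>The intersection of all modules in the filtration, that is, the translations fixing
  every coset. \<open>beta_null\<close> and \<open>null_beta\<close> identify it with the multiples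
  of \<open>b\<close>; reduction modulo \<open>b\<close> is present in this form only.\<close>

definition null :: "nat \<Rightarrow> int poly fract set" where
  "null i = {x. \<forall>c. x / t i powi c \<in> reg i}"

lemma t_powi_K: "i \<in> I \<Longrightarrow> 1 / t i powi c \<in> K"
  using t_K[of i] by (cases c rule: int_cases2) (auto simp: power_int_minus divide_inverse power_inverse[symmetric])

lemma beta_null:
  assumes "i \<in> I" "k \<in> K"
  shows "\<beta> * k \<in> null i"
proof -
  have "\<beta> * k / t i powi c \<in> reg i" for c
    using reg_beta[OF K_mult[OF assms(2) t_powi_K[OF assms(1)]], of c i] by simp
  then show ?thesis unfolding null_def by blast
qed

lemma null_beta:
  assumes i: "i \<in> I" and x: "x \<in> null i"
  obtains k where "k \<in> K" "x = \<beta> * k"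
proof -
  have "x / t i powi 0 \<in> reg i" using x unfolding null_def by blast
  then have "x \<in> K" by (simp add: reg_K)
  then obtain n f where f: "em (s * P) ^ n * x = em f" unfolding K_def by auto
  \<comment> \<open>As \<open>p i\<close> has positive degree, this power of it has larger degree
    than the numerator \<open>f\<close>, so divisibility modulo \<open>b\<close> forces
    \<open>f\<close> to vanish modulo \<open>b\<close>.\<close>
  let ?k = "Suc (degree f)"
  have "x / t i powi int ?k \<in> Loc (p i)"
    using x unfolding null_def reg_def Lp_def by blast
  moreover have "(em 1 / em (r i)) ^ ?k \<in> Loc (p i)"
  proof -
    have "em 1 / em (r i) \<in> Loc (p i)"
      by (rule Loc_fract[OF comax_pr[OF i i] K_inv_dvd[OF r_dvd_P[OF i]] p_r_nz(2)[OF i]])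
    then have "(em 1 / em (r i)) ^ k \<in> Loc (p i)" for k
    proof (induction k)
      case 0
      then show ?case using Loc_em[of 1 "p i"] by simp
    next
      case (Suc k)
      then show ?case unfolding power_Suc by (intro Loc_mult)
    qed
    then show ?thesis .
  qed
  ultimately have "x / t i powi int ?k * (em 1 / em (r i)) ^ ?k \<in> Loc (p i)" by (rule Loc_mult)
  moreover have "x / t i powi int k * (em 1 / em (r i)) ^ k = x / em (p i ^ k)" for k
    using i by (simp add: t_def em_power power_divide)
  ultimately have "x / em (p i ^ ?k) \<in> Loc (p i)" by (simp only:)
  then have "x / em (p i ^ ?k) \<in> Loc (p i ^ ?k)" by (rule Loc_power)
  then obtain u g k where g: "k \<in> K" "(1 - em u * em (p i ^ ?k)) * (x / em (p i ^ ?k)) = em g + \<beta> * k"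
    unfolding Loc_def by blast
  let ?w = "p i ^ ?k"
  have w0: "em ?w \<noteq> 0" using i by simp
  have "(1 - em u * em ?w) * x = em ?w * ((1 - em u * em ?w) * (x / em ?w))" using w0 by simp
  also have "\<dots> = em ?w * (em g + \<beta> * k)" by (simp only: g(2))
  finally have "(1 - em u * em ?w) * (em (s * P) ^ n * x) = em (s * P) ^ n * (em ?w * (em g + \<beta> * k))"
    by (simp only: mult.left_commute)
  then have "\<beta> * (em ((s * P) ^ n) * em ?w * k) = em (f - ?w * (u * f + (s * P) ^ n * g))"
    unfolding f by (simp add: em_power algebra_simps)
  then have "[:b:] dvd f - ?w * (u * f + (s * P) ^ n * g)"
    by (rule em_mod_cong[OF K_mult[OF K_mult[OF K_em K_em] g(1)]])
  then have dvd: "[:b:] dvd ?w * (u * f + (s * P) ^ n * g) - f" by (subst dvd_minus_iff[symmetric]) simp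
  have "?k * 1 \<le> ?k * degree (p i)" using deg_p[OF i] by (intro mult_le_mono) auto
  then have "degree ?w \<ge> ?k"
    unfolding degree_power_eq[OF p_r_nz(1)[OF i]] by simp
  then have "[:b:] dvd u * f + (s * P) ^ n * g"
    using monic_mult_cong[OF b monic_power[OF monic_p[OF i]] dvd] by linarith
  then have "[:b:] dvd ?w * (u * f + (s * P) ^ n * g) - (?w * (u * f + (s * P) ^ n * g) - f)"
    by (rule dvd_diff[OF dvd_mult dvd])
  then have "[:b:] dvd f" by simp
  then obtain f' where f': "f = [:b:] * f'" by auto
  have "x = \<beta> * (em f' * (1 / em ((s * P) ^ n)))"
    using f by (simp add: f' em_power field_simps)
  then show ?thesis
    using that[OF K_mult[OF K_em K_inverse[OF dvd_refl]]] by blast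
qed

text \<open>Regularity at the finite places removes all denominators except \<open>s ^ m\<close>,
  and regularity at infinity then bounds the degree of the numerator. Modulo \<open>b\<close>
  finitely many fractions remain.\<close>

lemma finite_stabiliser:
  "\<exists>F. finite F \<and> (\<forall>x\<in>level m. (\<forall>i\<in>I. x \<in> reg i) \<longrightarrow> (\<exists>y\<in>F. \<forall>i\<in>I. x - y \<in> null i))"
proof -
  let ?M = "degree (s ^ m)"
  let ?F = "(\<lambda>h. em h / em (s ^ m)) ` reduced_polys b (Suc ?M)"
  have "\<exists>y\<in>?F. \<forall>i\<in>I. x - y \<in> null i" if x: "x \<in> level m" "\<forall>i\<in>I. x \<in> reg i" for x
  proof -
    obtain n f where f: "em P ^ n * em s ^ m * x = em f" using x(1) unfolding level_def by auto
    let ?y = "em (s ^ m) * x"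
    \<comment> \<open>The ideal of denominators of \<open>s ^ m * x\<close> modulo \<open>b\<close>.
      It contains a power of \<open>P\<close>, and \<open>Q w\<close> below says that it is
      comaximal with \<open>w\<close>. Regularity yields \<open>Q\<close> at each place,
      \<open>Q\<close> is multiplicative, and so the ideal contains 1.\<close>
    define A where "A = {g. \<exists>f. \<exists>k\<in>K. em g * ?y = em f + \<beta> * k}"
    have A_add: "g + h \<in> A" if gh: "g \<in> A" "h \<in> A" for g h
    proof -
      obtain f k f' k' where *: "k \<in> K" "em g * ?y = em f + \<beta> * k" "k' \<in> K" "em h * ?y = em f' + \<beta> * k'"
        using gh unfolding A_def by blast
      have "em (g + h) * ?y = em g * ?y + em h * ?y" by (simp only: to_fract_add distrib_right)
      also have "\<dots> = em (f + f') + \<beta> * (k + k')" unfolding * by (simp add: algebra_simps)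
      finally show ?thesis using K_add[OF *(1,3)] unfolding A_def by blast
    qed
    have A_mult: "h * g \<in> A" if g: "g \<in> A" for g h
    proof -
      obtain f k where *: "k \<in> K" "em g * ?y = em f + \<beta> * k" using g unfolding A_def by blast
      have "em (h * g) * ?y = em h * (em g * ?y)" by (simp only: to_fract_mult mult.assoc)
      also have "\<dots> = em (h * f) + \<beta> * (em h * k)" unfolding *(2) by (simp add: algebra_simps)
      finally show ?thesis using K_mult[OF K_em *(1)] unfolding A_def by blast
    qed
    define Q where "Q w \<longleftrightarrow> (\<exists>u. 1 - u * w \<in> A)" for w
    have Q_mult: "Q (w * w')" if ww: "Q w" "Q w'" for w w'
    proof -
      obtain u u' where "1 - u * w \<in> A" "1 - u' * w' \<in> A" using ww unfolding Q_def by blast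
      then have "(1 - u * w) + (u * w) * (1 - u' * w') \<in> A" using A_add A_mult by blast
      moreover have "(1 - u * w) + (u * w) * (1 - u' * w') = 1 - (u * u') * (w * w')"
        by (simp add: algebra_simps)
      ultimately show ?thesis unfolding Q_def by metis
    qed
    have "0 \<in> A" unfolding A_def by (intro CollectI exI[of _ 0] bexI[of _ 0]) simp_all
    then have Q_1: "Q 1" unfolding Q_def by (intro exI[of _ 1]) simp
    have Q_Loc: "Q w" if w: "x \<in> Loc w" for w
    proof -
      obtain u f k where uf: "k \<in> K" "(1 - em u * em w) * x = em f + \<beta> * k"
        using w unfolding Loc_def by blast
      have "em (1 - u * w) * ?y = em (s ^ m) * ((1 - em u * em w) * x)" by (simp add: algebra_simps)
      also have "\<dots> = em (s ^ m * f) + \<beta> * (em (s ^ m) * k)"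
        unfolding uf(2) by (simp add: algebra_simps)
      finally have "1 - u * w \<in> A" using K_mult[OF K_em uf(1)] unfolding A_def by blast
      then show ?thesis unfolding Q_def by blast
    qed
    have "Q (p i * r i)" if i: "i \<in> I" for i
    proof (rule Q_mult)
      show "Q (p i)" using x(2) i by (intro Q_Loc) (auto simp: reg_def Lp_def)
      show "Q (r i)"
      proof (cases "i = 1")
        case True
        then show ?thesis using r_1 Q_1 by (simp only:)
      next
        case False
        have "x \<in> Lm i" using x(2) i unfolding reg_def by blast
        then show ?thesis using False by (intro Q_Loc) (simp add: Lm_def)
      qed
    qed
    then have "Q (\<Prod>i\<in>A. p i * r i)" if "A \<subseteq> I" for A
      using that
    proof (induction A rule: infinite_finite_induct)
      case (insert i A)
      then show ?case using Q_mult[of "p i * r i"] by simp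
    qed (simp_all add: Q_1)
    then have "Q P" unfolding P_def by blast
    then have "Q (P ^ n)"
    proof (induction n)
      case (Suc n)
      then show ?case unfolding power_Suc by (intro Q_mult)
    qed (simp add: Q_1)
    then obtain u where "1 - u * P ^ n \<in> A" unfolding Q_def by blast
    moreover have "P ^ n \<in> A"
      unfolding A_def using f by (intro CollectI exI[of _ f] bexI[of _ 0]) (simp_all add: em_power mult.assoc)
    ultimately have "(1 - u * P ^ n) + u * P ^ n \<in> A" using A_add A_mult by blast
    then have "1 \<in> A" by simp
    then obtain f k where f: "k \<in> K" "?y = em f + \<beta> * k" unfolding A_def by auto
    \<comment> \<open>Comparing the polynomial numerator with the bounded fraction at infinity gives
      the degree bound.\<close>
    have "x \<in> LocInf" using x(2) one_I by (force simp: reg_def Lm_def)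
    then obtain g f' k' where g: "k' \<in> K" "monic g" "degree f' \<le> degree g" "em g * x = em f' + \<beta> * k'"
      unfolding LocInf_def by blast
    have "em g * ?y = em (s ^ m) * (em g * x)" by (simp only: mult.left_commute)
    then have "em g * (em f + \<beta> * k) = em (s ^ m) * (em f' + \<beta> * k')"
      by (simp only: f(2) g(4))
    then have "\<beta> * (em (s ^ m) * k' - em g * k) = em (g * f - s ^ m * f')"
      by (simp add: algebra_simps)
    then have dvd: "[:b:] dvd g * f - s ^ m * f'"
      by (rule em_mod_cong[OF K_diff[OF K_mult[OF K_em g(1)] K_mult[OF K_em f(1)]]])
    define h where "h = reduce_coeffs b f"
    have "degree (s ^ m * f') \<le> ?M + degree g" using degree_mult_le[of "s ^ m" f'] g(3) by simp
    then have "h = 0 \<or> degree h < Suc ?M"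
      using monic_mult_cong[OF b g(2) dvd] unfolding h_def reduce_coeffs_eq_0_iff by auto
    moreover have "reduce_coeffs b h = h" by (simp add: h_def poly_eq_iff)
    ultimately have h: "h \<in> reduced_polys b (Suc ?M)" using reduce_coeffs_mem[OF b] by metis
    obtain z where z: "f - h = [:b:] * z" using dvd_diff_reduce_coeffs[of b f] unfolding h_def by auto
    have "em f = em h + \<beta> * em z"
      using arg_cong[OF z, of em] by (simp add: algebra_simps)
    then have "em (s ^ m) * x = em h + \<beta> * (em z + k)" using f(2) by (simp add: algebra_simps)
    then have "x - em h / em (s ^ m) = \<beta> * ((em z + k) * (1 / em (s ^ m)))"
      by (simp add: field_simps)
    moreover have "(em z + k) * (1 / em (s ^ m)) \<in> K" using f(1) by (intro K_mult K_add K_em K_inv_s)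
    ultimately have "\<forall>i\<in>I. x - em h / em (s ^ m) \<in> null i" using beta_null by metis
    then show ?thesis using h by blast
  qed
  moreover have "finite ?F" using card_reduced_polys(2)[OF b] by blast
  ultimately show ?thesis by blast
qed

text \<open>A pole of order \<open>m + 1\<close> at \<open>s\<close> cannot be cancelled at level
  \<open>m\<close>: otherwise \<open>s\<close> would divide a power of \<open>P\<close> modulo
  \<open>b\<close>, although the two are comaximal.\<close>

lemma strict_step:
  "\<exists>a\<in>level (Suc m). (\<forall>i\<in>I. a \<in> reg i) \<and> (\<forall>x\<in>level m. a - x \<notin> null 1)"
proof (intro bexI conjI ballI)
  let ?a = "em 1 / em (s ^ Suc m)"
  show "?a \<in> level (Suc m)"
    unfolding level_def by (intro CollectI exI[of _ 0] exI[of _ 1]) (simp add: em_power del: power_Suc)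
  show "?a \<in> reg i" if "i \<in> I" for i
    by (rule s_fract_reg[OF that]) simp
  fix x assume x: "x \<in> level m"
  show "?a - x \<notin> null 1"
  proof
    assume "?a - x \<in> null 1"
    then obtain k where k: "k \<in> K" "?a - x = \<beta> * k" using null_beta[OF one_I] by blast
    obtain n f where f: "em P ^ n * em s ^ m * x = em f" using x unfolding level_def by auto
    have "em P ^ n * em (s ^ Suc m) * ?a - em s * (em P ^ n * em s ^ m * x) = em P ^ n * em (s ^ Suc m) * (?a - x)"
      by (simp add: em_power algebra_simps)
    moreover have "em P ^ n * em (s ^ Suc m) * ?a = em (P ^ n)" by (simp add: em_power del: power_Suc)
    ultimately have "\<beta> * (em (P ^ n) * em (s ^ Suc m) * k) = em (P ^ n - s * f)"
      unfolding f k(2) by (simp add: em_power algebra_simps)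
    then have "[:b:] dvd P ^ n - s * f"
      by (rule em_mod_cong[OF K_mult[OF K_mult[OF K_em K_em] k(1)]])
    then have "\<not> comaximal_mod b s (P ^ n)"
      by (rule not_comaximal_mod_multiple[OF b monic_s deg_s])
    moreover have "comaximal_mod b s P"
      unfolding P_def using comax_ps comax_rs comaximal_mod_commute
      by (intro comaximal_mod_prod comaximal_mod_mult) auto
    ultimately show False using comaximal_mod_power by blast
  qed
qed

text \<open>If the power were 1 modulo \<open>b\<close>, then \<open>p j\<close> would divide a
  power of \<open>r j\<close> modulo \<open>b\<close>. Distinct powers of \<open>t j\<close> are
  thereby told apart in the other coordinates.\<close>

lemma t_power_nontrivial:
  assumes i: "i \<in> I" and j: "j \<in> I" and l: "l \<ge> 1"
  shows "t j ^ l - 1 \<notin> null i"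
proof
  assume "t j ^ l - 1 \<in> null i"
  then obtain k where k: "k \<in> K" "t j ^ l - 1 = \<beta> * k" using null_beta[OF i] by blast
  have "em (r j) ^ l * (t j ^ l - 1) = em (p j ^ l - r j ^ l)"
    using j by (simp add: t_def em_power right_diff_distrib power_divide)
  then have "\<beta> * (em (- 1) * (em (r j ^ l) * k)) = em (r j ^ l - p j ^ l)"
    unfolding k(2) by (simp add: em_power algebra_simps)
  then have "[:b:] dvd r j ^ l - p j ^ l"
    by (rule em_mod_cong[OF K_mult[OF K_em K_mult[OF K_em k(1)]]])
  moreover have "p j ^ l = p j * p j ^ (l - 1)" using l by (cases l) auto
  ultimately have "\<not> comaximal_mod b (p j) (r j ^ l)"
    using not_comaximal_mod_multiple[OF b monic_p[OF j] deg_p[OF j]] by metis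
  then show False using comaximal_mod_power[OF comax_pr[OF j j]] by blast
qed

end

section \<open>Topology of automorphism groups\<close>

lemma openin_pointwise_discrete:
  "openin (product_topology (\<lambda>_. discrete_topology V) V) A \<longleftrightarrow>
     A \<subseteq> (\<Pi>\<^sub>E u\<in>V. V) \<and>
     (\<forall>g\<in>A. \<exists>F. finite F \<and> F \<subseteq> V \<and> {h \<in> \<Pi>\<^sub>E u\<in>V. V. \<forall>u\<in>F. h u = g u} \<subseteq> A)"
  (is "?L \<longleftrightarrow> ?R")
proof
  assume L: ?L
  show ?R
  proof (intro conjI ballI)
    show "A \<subseteq> (\<Pi>\<^sub>E u\<in>V. V)" using openin_subset[OF L] by simp
    fix g assume g: "g \<in> A"
    obtain W where W: "finite {u \<in> V. W u \<noteq> V}" "g \<in> Pi\<^sub>E V W" "Pi\<^sub>E V W \<subseteq> A"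
      using L g unfolding openin_product_topology_alt by force
    have PW: "h \<in> Pi\<^sub>E V W" if h: "h \<in> (\<Pi>\<^sub>E u\<in>V. V)" "\<forall>u\<in>{u \<in> V. W u \<noteq> V}. h u = g u" for h
    proof (rule PiE_I)
      fix u assume u: "u \<in> V"
      show "h u \<in> W u"
      proof (cases "W u = V")
        case True
        then show ?thesis using PiE_mem[OF h(1) u] by simp
      next
        case False
        then have "h u = g u" using h(2) u by simp
        then show ?thesis using PiE_mem[OF W(2) u] by simp
      qed
    next
      fix u assume "u \<notin> V"
      then show "h u = undefined" by (rule PiE_arb[OF h(1)])
    qed
    show "\<exists>F. finite F \<and> F \<subseteq> V \<and> {h \<in> \<Pi>\<^sub>E u\<in>V. V. \<forall>u\<in>F. h u = g u} \<subseteq> A"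
    proof (intro exI[of _ "{u \<in> V. W u \<noteq> V}"] conjI W(1) subsetI)
      fix h assume "h \<in> {h \<in> \<Pi>\<^sub>E u\<in>V. V. \<forall>u\<in>{u \<in> V. W u \<noteq> V}. h u = g u}"
      then have "h \<in> Pi\<^sub>E V W" by (intro PW) simp_all
      then show "h \<in> A" using W(3) by (rule subsetD[rotated])
    qed simp
  qed
next
  assume R: ?R
  show ?L
    unfolding openin_product_topology_alt
  proof (intro ballI)
    fix g assume g: "g \<in> A"
    then obtain F where F: "finite F" "F \<subseteq> V" "{h \<in> \<Pi>\<^sub>E u\<in>V. V. \<forall>u\<in>F. h u = g u} \<subseteq> A" using R by blast
    let ?W = "\<lambda>u. if u \<in> F then {g u} else V"
    have gV: "g \<in> (\<Pi>\<^sub>E u\<in>V. V)" using R g by blast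
    show "\<exists>W. finite {u \<in> V. W u \<noteq> topspace (discrete_topology V)} \<and>
        (\<forall>u\<in>V. openin (discrete_topology V) (W u)) \<and> g \<in> Pi\<^sub>E V W \<and> Pi\<^sub>E V W \<subseteq> A"
    proof (intro exI[of _ ?W] conjI)
      show "finite {u \<in> V. ?W u \<noteq> topspace (discrete_topology V)}"
        by (rule finite_subset[OF _ F(1)]) auto
      show "\<forall>u\<in>V. openin (discrete_topology V) (?W u)" using PiE_mem[OF gV] by auto
      show "g \<in> Pi\<^sub>E V ?W" using gV by (auto simp: PiE_iff)
      have "Pi\<^sub>E V ?W \<subseteq> {h \<in> \<Pi>\<^sub>E u\<in>V. V. \<forall>u\<in>F. h u = g u}"
      proof
        fix h assume h: "h \<in> Pi\<^sub>E V ?W"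
        have hu: "h u \<in> ?W u" if "u \<in> V" for u using h that by (rule PiE_mem)
        have "h u = g u" if "u \<in> F" for u using hu[of u] that F(2) by auto
        moreover have "h u \<in> V" if "u \<in> V" for u
          using hu[OF that] PiE_mem[OF gV that] by (auto split: if_splits)
        moreover have "h u = undefined" if "u \<notin> V" for u using h that by (rule PiE_arb)
        ultimately show "h \<in> {h \<in> \<Pi>\<^sub>E u\<in>V. V. \<forall>u\<in>F. h u = g u}" by (auto simp: PiE_iff extensional_def)
      qed
      then show "Pi\<^sub>E V ?W \<subseteq> A" using F(3) by (rule subset_trans)
    qed
  qed
qed

section \<open>Basic neighbourhoods in automorphism groups and in their products\<close>

lemma graph_auts_PiE: "f \<in> graph_auts T \<Longrightarrow> f \<in> (\<Pi>\<^sub>E u\<in>pverts T. pverts T)"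
  by (auto simp: graph_auts_def Bij_def bij_betw_def PiE_iff)

lemma openin_aut_topology:
  "openin (aut_topology T) A \<longleftrightarrow>
     A \<subseteq> graph_auts T \<and>
     (\<forall>g\<in>A. \<exists>F. finite F \<and> F \<subseteq> pverts T \<and> {h \<in> graph_auts T. \<forall>u\<in>F. h u = g u} \<subseteq> A)"
  (is "?L \<longleftrightarrow> ?R")
proof
  assume ?L
  then obtain W where W: "openin (product_topology (\<lambda>_. discrete_topology (pverts T)) (pverts T)) W"
    "A = W \<inter> graph_auts T"
    unfolding aut_topology_def openin_subtopology by blast
  show ?R
  proof (intro conjI ballI)
    fix g assume "g \<in> A"
    then obtain F where F: "finite F" "F \<subseteq> pverts T"
      "{h \<in> \<Pi>\<^sub>E u\<in>pverts T. pverts T. \<forall>u\<in>F. h u = g u} \<subseteq> W"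
      using W unfolding openin_pointwise_discrete by blast
    show "\<exists>F. finite F \<and> F \<subseteq> pverts T \<and> {h \<in> graph_auts T. \<forall>u\<in>F. h u = g u} \<subseteq> A"
    proof (intro exI[of _ F] conjI F(1,2) subsetI)
      fix h assume h: "h \<in> {h \<in> graph_auts T. \<forall>u\<in>F. h u = g u}"
      then have "h \<in> (\<Pi>\<^sub>E u\<in>pverts T. pverts T)" by (intro graph_auts_PiE) simp
      then have "h \<in> W" using h by (intro subsetD[OF F(3)]) simp
      then show "h \<in> A" using h W(2) by simp
    qed
  qed (use W in blast)
next
  assume R: ?R
  then have "\<forall>g\<in>A. \<exists>F. finite F \<and> F \<subseteq> pverts T \<and> {h \<in> graph_auts T. \<forall>u\<in>F. h u = g u} \<subseteq> A" by blast
  from bchoice[OF this] obtain F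
    where F: "\<forall>g\<in>A. finite (F g) \<and> F g \<subseteq> pverts T \<and> {h \<in> graph_auts T. \<forall>u\<in>F g. h u = g u} \<subseteq> A"
    by blast
  define W where "W = (\<Union>g\<in>A. {h \<in> \<Pi>\<^sub>E u\<in>pverts T. pverts T. \<forall>u\<in>F g. h u = g u})"
  have "openin (product_topology (\<lambda>_. discrete_topology (pverts T)) (pverts T)) W"
    unfolding openin_pointwise_discrete
  proof (intro conjI ballI)
    fix h assume "h \<in> W"
    then obtain g where g: "g \<in> A" "\<forall>u\<in>F g. h u = g u" unfolding W_def by blast
    have "{k \<in> \<Pi>\<^sub>E u\<in>pverts T. pverts T. \<forall>u\<in>F g. k u = h u} \<subseteq> W"
      using g unfolding W_def by auto
    then show "\<exists>D. finite D \<and> D \<subseteq> pverts T \<and> {k \<in> \<Pi>\<^sub>E u\<in>pverts T. pverts T. \<forall>u\<in>D. k u = h u} \<subseteq> W"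
      using F g(1) by blast
  qed (auto simp: W_def)
  moreover have "A = W \<inter> graph_auts T"
  proof (intro equalityI subsetI)
    fix g assume g: "g \<in> A"
    then have "g \<in> graph_auts T" using R by blast
    then show "g \<in> W \<inter> graph_auts T"
      using g graph_auts_PiE[of g T] unfolding W_def by blast
  next
    fix h assume h: "h \<in> W \<inter> graph_auts T"
    then obtain g where g: "g \<in> A" "\<forall>u\<in>F g. h u = g u" unfolding W_def by blast
    have "{h \<in> graph_auts T. \<forall>u\<in>F g. h u = g u} \<subseteq> A" using F g(1) by blast
    then show "h \<in> A" by (rule subsetD) (use h g(2) in simp)
  qed
  ultimately show ?L unfolding aut_topology_def openin_subtopology by blast
qed

lemma carrier_prod_aut_group: "carrier (prod_aut_group I T) = (\<Pi>\<^sub>E i\<in>I. graph_auts (T i))"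
  by (simp add: prod_aut_group_def)

lemma openin_prod_aut_topology:
  assumes "finite I"
  shows "openin (prod_aut_topology I T) A \<longleftrightarrow>
     A \<subseteq> carrier (prod_aut_group I T) \<and>
     (\<forall>g\<in>A. \<exists>F. (\<forall>i\<in>I. finite (F i) \<and> F i \<subseteq> pverts (T i)) \<and>
        {h \<in> carrier (prod_aut_group I T). \<forall>i\<in>I. \<forall>u\<in>F i. h i u = g i u} \<subseteq> A)"
  (is "?L \<longleftrightarrow> ?R")
proof
  assume L: ?L
  show ?R
  proof (intro conjI ballI)
    show "A \<subseteq> carrier (prod_aut_group I T)"
      using openin_subset[OF L] by (simp add: topspace_prod_aut_topology)
    fix g assume g: "g \<in> A"
    from bspec[OF L[unfolded prod_aut_topology_def openin_product_topology_alt] g]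
    obtain W where W: "\<forall>i\<in>I. openin (aut_topology (T i)) (W i)" "g \<in> Pi\<^sub>E I W" "Pi\<^sub>E I W \<subseteq> A"
      by (elim exE conjE) (rule that)
    have "\<forall>i\<in>I. \<exists>F. finite F \<and> F \<subseteq> pverts (T i) \<and> {h \<in> graph_auts (T i). \<forall>u\<in>F. h u = g i u} \<subseteq> W i"
    proof
      fix i assume i: "i \<in> I"
      have "openin (aut_topology (T i)) (W i)" using W(1) i by blast
      then have "\<forall>g\<in>W i. \<exists>F. finite F \<and> F \<subseteq> pverts (T i) \<and> {h \<in> graph_auts (T i). \<forall>u\<in>F. h u = g u} \<subseteq> W i"
        unfolding openin_aut_topology by (rule conjunct2)
      then show "\<exists>F. finite F \<and> F \<subseteq> pverts (T i) \<and> {h \<in> graph_auts (T i). \<forall>u\<in>F. h u = g i u} \<subseteq> W i"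
        using PiE_mem[OF W(2) i] by (rule bspec)
    qed
    from bchoice[OF this] obtain F where F: "\<forall>i\<in>I. finite (F i) \<and> F i \<subseteq> pverts (T i) \<and>
        {h \<in> graph_auts (T i). \<forall>u\<in>F i. h u = g i u} \<subseteq> W i"
      by blast
    show "\<exists>F. (\<forall>i\<in>I. finite (F i) \<and> F i \<subseteq> pverts (T i)) \<and>
        {h \<in> carrier (prod_aut_group I T). \<forall>i\<in>I. \<forall>u\<in>F i. h i u = g i u} \<subseteq> A"
    proof (intro exI[of _ F] conjI subsetI)
      show "\<forall>i\<in>I. finite (F i) \<and> F i \<subseteq> pverts (T i)" using F by blast
      fix h assume h: "h \<in> {h \<in> carrier (prod_aut_group I T). \<forall>i\<in>I. \<forall>u\<in>F i. h i u = g i u}"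
      have hc: "h \<in> (\<Pi>\<^sub>E i\<in>I. graph_auts (T i))" using h by (simp add: carrier_prod_aut_group)
      have "h i \<in> W i" if i: "i \<in> I" for i
      proof -
        have "{h \<in> graph_auts (T i). \<forall>u\<in>F i. h u = g i u} \<subseteq> W i" using F i by blast
        then show ?thesis by (rule subsetD) (use h i PiE_mem[OF hc i] in simp)
      qed
      then have "h \<in> Pi\<^sub>E I W" using hc by (simp add: PiE_iff)
      then show "h \<in> A" using W(3) by blast
    qed
  qed
next
  assume R: ?R
  show ?L
    unfolding prod_aut_topology_def openin_product_topology_alt
  proof (intro ballI)
    fix g assume g: "g \<in> A"
    then obtain F where F: "\<forall>i\<in>I. finite (F i) \<and> F i \<subseteq> pverts (T i)"
      "{h \<in> carrier (prod_aut_group I T). \<forall>i\<in>I. \<forall>u\<in>F i. h i u = g i u} \<subseteq> A" using R by blast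
    let ?W = "\<lambda>i. {h \<in> graph_auts (T i). \<forall>u\<in>F i. h u = g i u}"
    have gc: "g \<in> (\<Pi>\<^sub>E i\<in>I. graph_auts (T i))" using R g carrier_prod_aut_group[of I T] by blast
    show "\<exists>W. finite {i \<in> I. W i \<noteq> topspace (aut_topology (T i))} \<and>
        (\<forall>i\<in>I. openin (aut_topology (T i)) (W i)) \<and> g \<in> Pi\<^sub>E I W \<and> Pi\<^sub>E I W \<subseteq> A"
    proof (intro exI[of _ ?W] conjI ballI)
      show "finite {i \<in> I. ?W i \<noteq> topspace (aut_topology (T i))}" using assms by simp
      show "openin (aut_topology (T i)) (?W i)" if i: "i \<in> I" for i
        unfolding openin_aut_topology using F(1) i by (intro conjI ballI exI[of _ "F i"]) auto
      show "g \<in> Pi\<^sub>E I ?W" using gc by (auto simp: PiE_iff)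
      show "Pi\<^sub>E I ?W \<subseteq> A"
      proof
        fix h assume "h \<in> Pi\<^sub>E I ?W"
        then have "h \<in> {h \<in> carrier (prod_aut_group I T). \<forall>i\<in>I. \<forall>u\<in>F i. h i u = g i u}"
          unfolding carrier_prod_aut_group by (simp add: PiE_iff)
        then show "h \<in> A" by (rule subsetD[OF F(2)])
      qed
    qed
  qed
qed

lemma not_discrete_prod_aut:
  assumes "finite J" and S: "S \<subseteq> carrier (prod_aut_group J T)" "g \<in> S"
    and near: "\<And>F. \<forall>i\<in>J. finite (F i) \<and> F i \<subseteq> pverts (T i) \<Longrightarrow>
      \<exists>h\<in>S. h \<noteq> g \<and> (\<forall>i\<in>J. \<forall>u\<in>F i. h i u = g i u)"
  shows "\<not> discrete_in (prod_aut_topology J T) S"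
proof
  assume "discrete_in (prod_aut_topology J T) S"
  then have "openin (subtopology (prod_aut_topology J T) S) {g}"
    using S unfolding discrete_in_def by simp
  then obtain W where W: "openin (prod_aut_topology J T) W" "{g} = W \<inter> S"
    unfolding openin_subtopology by (elim exE conjE) (rule that)
  have "g \<in> W" using W(2) by blast
  from bspec[OF conjunct2[OF W(1)[unfolded openin_prod_aut_topology[OF assms(1)]]] this]
  obtain F where F: "\<forall>i\<in>J. finite (F i) \<and> F i \<subseteq> pverts (T i)"
    "{h \<in> carrier (prod_aut_group J T). \<forall>i\<in>J. \<forall>u\<in>F i. h i u = g i u} \<subseteq> W"
    by (elim exE conjE) (rule that)
  obtain h where h: "h \<in> S" "h \<noteq> g" "\<forall>i\<in>J. \<forall>u\<in>F i. h i u = g i u" using near[OF F(1)] by blast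
  then have "h \<in> W" using S(1) by (intro subsetD[OF F(2)]) auto
  then have "h \<in> {g}" using W(2) h(1) by simp
  then show False using h(2) by simp
qed

lemma not_discrete_aut:
  assumes S: "S \<subseteq> graph_auts T" "g \<in> S"
    and near: "\<And>F. finite F \<Longrightarrow> F \<subseteq> pverts T \<Longrightarrow> \<exists>h\<in>S. h \<noteq> g \<and> (\<forall>u\<in>F. h u = g u)"
  shows "\<not> discrete_in (aut_topology T) S"
proof
  assume "discrete_in (aut_topology T) S"
  then have "openin (subtopology (aut_topology T) S) {g}"
    using S unfolding discrete_in_def by simp
  then obtain W where W: "openin (aut_topology T) W" "{g} = W \<inter> S"
    unfolding openin_subtopology by (elim exE conjE) (rule that)
  have "g \<in> W" using W(2) by blast
  from bspec[OF conjunct2[OF W(1)[unfolded openin_aut_topology]] this]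
  obtain F where F: "finite F" "F \<subseteq> pverts T" "{h \<in> graph_auts T. \<forall>u\<in>F. h u = g u} \<subseteq> W"
    by (elim exE conjE) (rule that)
  obtain h where h: "h \<in> S" "h \<noteq> g" "\<forall>u\<in>F. h u = g u" using near[OF F(1,2)] by blast
  then have "h \<in> W" using S(1) by (intro subsetD[OF F(3)]) auto
  then have "h \<in> {g}" using W(2) h(1) by simp
  then show False using h(2) by simp
qed

lemma graph_auts_iff:
  "f \<in> graph_auts T \<longleftrightarrow> f \<in> extensional (pverts T) \<and> bij_betw f (pverts T) (pverts T) \<and>
     (\<forall>u\<in>pverts T. \<forall>v\<in>pverts T. (f u, f v) \<in> parcs T \<longleftrightarrow> (u, v) \<in> parcs T)"
  by (auto simp: graph_auts_def Bij_def)

lemma graph_auts_verts: "f \<in> graph_auts T \<Longrightarrow> u \<in> pverts T \<Longrightarrow> f u \<in> pverts T"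
  by (auto simp: graph_auts_iff bij_betw_def)

lemma graph_auts_nbrs:
  assumes "f \<in> graph_auts T" "u \<in> pverts T" "w \<in> pverts T"
  shows "f w \<in> nbrs T (f u) \<longleftrightarrow> w \<in> nbrs T u"
  using assms by (auto simp: graph_auts_iff nbrs_def)

section \<open>Vertex stabilisers in locally finite trees\<close>

context tree_graph
begin

lemma tdist_graph_aut_le:
  assumes "f \<in> graph_auts T" "v \<in> V" "f v = v" "u \<in> V"
  shows "tdist T v (f u) \<le> tdist T v u"
proof -
  have "(v, f u) \<in> parcs T ^^ k" if "(v, u) \<in> parcs T ^^ k" "u \<in> V" for k u
    using that
  proof (induction k arbitrary: u)
    case 0
    then show ?case using assms by simp
  next
    case (Suc k)
    then obtain w where w: "(v, w) \<in> parcs T ^^ k" "(w, u) \<in> parcs T" by (auto elim: relpow_Suc_E)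
    then have "w \<in> V" using nbrs_verts[of u w] by (auto simp: nbrs_def)
    then have "(f w, f u) \<in> parcs T" using assms(1) w Suc.prems by (auto simp: graph_auts_iff)
    then show ?case using Suc.IH[OF w(1) \<open>w \<in> V\<close>] by auto
  qed
  then show ?thesis using tdist_relpow[OF assms(4,2)] assms(4) by (intro tdist_le)
qed

end

definition tball :: "'v pair_pre_digraph \<Rightarrow> 'v \<Rightarrow> nat \<Rightarrow> 'v set" where
  "tball T v r = {u \<in> pverts T. tdist T v u \<le> r}"

locale locally_finite_tree = tree_graph +
  assumes locally_finite: "\<And>u. u \<in> V \<Longrightarrow> finite (N u)"
begin

lemma finite_tball:
  assumes v: "v \<in> V"
  shows "finite (tball T v r)"
proof (induction r)
  case 0
  have "tball T v 0 \<subseteq> {v}" using tdist_eq_0[OF _ v] by (auto simp: tball_def)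
  then show ?case using finite_subset by blast
next
  case (Suc r)
  have "tball T v (Suc r) \<subseteq> tball T v r \<union> (\<Union>u\<in>tball T v r. N u)"
  proof
    fix u assume u: "u \<in> tball T v (Suc r)"
    show "u \<in> tball T v r \<union> (\<Union>u\<in>tball T v r. N u)"
    proof (cases "tdist T v u \<le> r")
      case False
      then have d: "tdist T v u = Suc r" "u \<in> V" using u by (auto simp: tball_def)
      then obtain w where w: "w \<in> N u" "tdist T v w = r" using tdist_pred[OF v] by metis
      then have "w \<in> tball T v r" "u \<in> N w" using nbrs_verts[OF w(1)] nbrs_sym[of w u] by (auto simp: tball_def)
      then show ?thesis by blast
    qed (use u in \<open>auto simp: tball_def\<close>)
  qed
  moreover have "finite (N u)" if "u \<in> tball T v r" for u
    using that locally_finite by (simp add: tball_def)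
  ultimately show ?case using Suc finite_subset by (metis (no_types, lifting) finite_UN finite_UnI)
qed

lemma graph_aut_tball:
  "f \<in> graph_auts T \<Longrightarrow> v \<in> V \<Longrightarrow> f v = v \<Longrightarrow> u \<in> tball T v r \<Longrightarrow> f u \<in> tball T v r"
  using tdist_graph_aut_le[of f v u] graph_auts_verts[of f T u] by (auto simp: tball_def)

text \<open>
  A limit of automorphisms fixing \<open>v\<close> is injective and maps each finite ball around \<open>v\<close> into
  itself, hence it is surjective.
\<close>

lemma stabiliser_limit:
  assumes v: "v \<in> V" and gP: "g \<in> (\<Pi>\<^sub>E u\<in>V. V)"
    and near: "\<And>F. finite F \<Longrightarrow> F \<subseteq> V \<Longrightarrow> \<exists>h\<in>{f \<in> graph_auts T. f v = v}. \<forall>u\<in>F. h u = g u"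
  shows "g \<in> graph_auts T" "g v = v"
proof -
  have near2: "\<exists>h. h \<in> graph_auts T \<and> h v = v \<and> h u = g u \<and> h w = g w" if "u \<in> V" "w \<in> V" for u w
    using near[of "{u, w}"] that by auto
  obtain h where "h v = v" "h v = g v" using near2[OF v v] by auto
  then show gv: "g v = v" by simp
  have adj: "(g u, g w) \<in> parcs T \<longleftrightarrow> (u, w) \<in> parcs T" if uw: "u \<in> V" "w \<in> V" for u w
  proof -
    obtain h where h: "h \<in> graph_auts T" "h u = g u" "h w = g w" using near2[OF uw] by auto
    have "\<forall>u\<in>V. \<forall>w\<in>V. (h u, h w) \<in> parcs T \<longleftrightarrow> (u, w) \<in> parcs T"
      using h(1) by (simp add: graph_auts_def)
    then have "(h u, h w) \<in> parcs T \<longleftrightarrow> (u, w) \<in> parcs T" using uw by (metis (lifting))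
    then show ?thesis using h(2,3) by simp
  qed
  have inj: "inj_on g V"
  proof (rule inj_onI)
    fix u w assume uw: "u \<in> V" "w \<in> V" "g u = g w"
    obtain h where h: "h \<in> graph_auts T" "h u = g u" "h w = g w" using near2[OF uw(1,2)] by auto
    have "inj_on h V" using h(1) by (simp add: graph_auts_def Bij_def bij_betw_def)
    then show "u = w" using uw h by (simp add: inj_on_def)
  qed
  have ball: "g ` tball T v r \<subseteq> tball T v r" for r
  proof
    fix w assume "w \<in> g ` tball T v r"
    then obtain u where u: "u \<in> tball T v r" "w = g u" by auto
    then have uV: "u \<in> V" by (simp add: tball_def)
    obtain h where h: "h \<in> graph_auts T" "h v = v" "h u = g u" using near2[OF uV uV] by auto
    show "w \<in> tball T v r" using graph_aut_tball[OF h(1) v h(2) u(1)] u(2) h(3) by simp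
  qed
  have surj: "u \<in> g ` V" if u: "u \<in> V" for u
  proof -
    let ?r = "tdist T v u"
    have sub: "tball T v ?r \<subseteq> V" by (simp add: tball_def)
    have "inj_on g (tball T v ?r)" using inj sub by (rule inj_on_subset)
    then have "g ` tball T v ?r = tball T v ?r"
      using ball finite_tball[OF v] by (simp add: card_image card_subset_eq)
    moreover have "u \<in> tball T v ?r" using u by (simp add: tball_def)
    ultimately have "u \<in> g ` tball T v ?r" by simp
    then show ?thesis using sub by (rule subsetD[OF image_mono, rotated])
  qed
  have gV: "g u \<in> V" if "u \<in> V" for u using gP that by (rule PiE_mem)
  have "g ` V = V" using gV surj by (intro equalityI subsetI) (elim imageE, simp, rule surj)
  then have "bij_betw g V V" using inj by (simp add: bij_betw_def)
  moreover have "g \<in> extensional V" using gP by (simp add: PiE_def)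
  ultimately show "g \<in> graph_auts T" using adj by (simp add: graph_auts_def Bij_def)
qed

text \<open>An automorphism fixing \<open>v\<close> keeps each vertex in a finite ball, so the
  stabiliser lies in a product of finite sets. By \<open>stabiliser_limit\<close> it is closed
  there; this guards against pointwise limits that are not surjective.\<close>

lemma compactin_stabiliser:
  assumes v: "v \<in> V"
  shows "compactin (aut_topology T) {f \<in> graph_auts T. f v = v}"
proof -
  let ?S = "{f \<in> graph_auts T. f v = v}"
  let ?P = "product_topology (\<lambda>_. discrete_topology V) V"
  let ?B = "\<Pi>\<^sub>E u\<in>V. tball T v (tdist T v u)"
  have "compactin (discrete_topology V) (tball T v r)" for r
    by (rule finite_imp_compactin[OF _ finite_tball[OF v]]) (auto simp: tball_def)
  then have "compactin ?P ?B" by (simp add: compactin_PiE)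
  moreover have "?S \<subseteq> ?B"
  proof
    fix f assume "f \<in> ?S"
    then have f: "f \<in> graph_auts T" "f v = v" by simp_all
    show "f \<in> ?B"
    proof (rule PiE_I)
      show "f u \<in> tball T v (tdist T v u)" if "u \<in> V" for u
      proof (rule graph_aut_tball[where f = f, OF f(1) v f(2)])
        show "u \<in> tball T v (tdist T v u)" using that by (simp add: tball_def)
      qed
      show "f u = undefined" if "u \<notin> V" for u using graph_auts_PiE[OF f(1)] that by (rule PiE_arb)
    qed
  qed
  moreover have "closedin ?P ?S"
    unfolding closedin_def
  proof (intro conjI)
    show "?S \<subseteq> topspace ?P" using graph_auts_PiE[of _ T] by (simp add: subset_iff)
    show "openin ?P (topspace ?P - ?S)"
      unfolding openin_pointwise_discrete
    proof (intro conjI ballI)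
      fix g assume g: "g \<in> topspace ?P - ?S"
      then have gP: "g \<in> (\<Pi>\<^sub>E u\<in>V. V)" unfolding topspace_product_topology topspace_discrete_topology by (rule DiffD1)
      have near: "\<exists>h\<in>?S. \<forall>u\<in>F. h u = g u"
        if no: "\<not> (\<exists>F. finite F \<and> F \<subseteq> V \<and> (\<forall>h\<in>?S. \<exists>u\<in>F. h u \<noteq> g u))"
          and F: "finite F" "F \<subseteq> V" for F
      proof (rule ccontr)
        assume far: "\<not> ?thesis"
        have "\<forall>h\<in>?S. \<exists>u\<in>F. h u \<noteq> g u"
        proof
          fix h assume h: "h \<in> ?S"
          show "\<exists>u\<in>F. h u \<noteq> g u"
          proof (rule ccontr)
            assume "\<not> (\<exists>u\<in>F. h u \<noteq> g u)"
            then have "\<forall>u\<in>F. h u = g u" by simp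
            then have "\<exists>h\<in>?S. \<forall>u\<in>F. h u = g u" using h by (rule bexI)
            with far show False by (rule notE)
          qed
        qed
        then have "\<exists>F. finite F \<and> F \<subseteq> V \<and> (\<forall>h\<in>?S. \<exists>u\<in>F. h u \<noteq> g u)"
          using F by (intro exI[of _ F] conjI)
        with no show False by (rule notE)
      qed
      have "\<exists>F. finite F \<and> F \<subseteq> V \<and> (\<forall>h\<in>?S. \<exists>u\<in>F. h u \<noteq> g u)"
      proof (rule ccontr)
        assume no: "\<not> ?thesis"
        have near': "\<exists>h\<in>?S. \<forall>u\<in>F. h u = g u" if "finite F" "F \<subseteq> V" for F
          using no that by (rule near)
        have "g \<in> ?S"
        proof (intro CollectI conjI)
          show "g \<in> graph_auts T" by (rule stabiliser_limit(1)[OF v gP near'])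
          show "g v = v" by (rule stabiliser_limit(2)[OF v gP near'])
        qed
        then show False by (rule DiffD2[OF g])
      qed
      then obtain F where F: "finite F" "F \<subseteq> V" "\<forall>h\<in>?S. \<exists>u\<in>F. h u \<noteq> g u"
        by (elim exE conjE) (rule that)
      have "{h \<in> \<Pi>\<^sub>E u\<in>V. V. \<forall>u\<in>F. h u = g u} \<subseteq> topspace ?P - ?S"
      proof
        fix h assume h: "h \<in> {h \<in> \<Pi>\<^sub>E u\<in>V. V. \<forall>u\<in>F. h u = g u}"
        have "h \<notin> ?S"
        proof
          assume "h \<in> ?S"
          from bspec[OF F(3) this] show False using h by simp
        qed
        then show "h \<in> topspace ?P - ?S" using h by (intro DiffI) simp_all
      qed
      then show "\<exists>F. finite F \<and> F \<subseteq> V \<and> {h \<in> \<Pi>\<^sub>E u\<in>V. V. \<forall>u\<in>F. h u = g u} \<subseteq> topspace ?P - ?S"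
        using F(1,2) by (intro exI[of _ F] conjI)
    qed simp
  qed
  ultimately have "compactin ?P ?S" by (rule closed_compactin)
  then show ?thesis unfolding aut_topology_def compactin_subtopology by auto
qed

end

section \<open>Computing in a product of automorphism groups\<close>

lemma graph_auts_Bij: "f \<in> graph_auts T \<Longrightarrow> f \<in> Bij (pverts T)"
  by (simp add: graph_auts_def)

lemma prod_aut_mem: "f \<in> carrier (prod_aut_group I T) \<Longrightarrow> i \<in> I \<Longrightarrow> f i \<in> graph_auts (T i)"
  by (auto simp: carrier_prod_aut_group)

lemma prod_aut_verts:
  "f \<in> carrier (prod_aut_group I T) \<Longrightarrow> i \<in> I \<Longrightarrow> u \<in> pverts (T i) \<Longrightarrow> f i u \<in> pverts (T i)"
  by (rule graph_auts_verts[OF prod_aut_mem])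

lemma prod_aut_mult:
  assumes "f \<in> carrier (prod_aut_group I T)" "g \<in> carrier (prod_aut_group I T)" "i \<in> I" "u \<in> pverts (T i)"
  shows "(f \<otimes>\<^bsub>prod_aut_group I T\<^esub> g) i u = f i (g i u)"
proof -
  have "f i \<in> Bij (pverts (T i))" "g i \<in> Bij (pverts (T i))"
    using assms(1-3) by (auto intro: graph_auts_Bij prod_aut_mem)
  then show ?thesis
    using assms(3,4) by (simp add: prod_aut_group_def product_group_def aut_group_def BijGroup_def compose_def)
qed

lemma prod_aut_one: "i \<in> I \<Longrightarrow> u \<in> pverts (T i) \<Longrightarrow> \<one>\<^bsub>prod_aut_group I T\<^esub> i u = u"
  by (simp add: prod_aut_group_def product_group_def aut_group_def BijGroup_def)

lemma prod_aut_inv: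
  assumes "f \<in> carrier (prod_aut_group I T)" "i \<in> I" "u \<in> pverts (T i)"
  shows "(inv\<^bsub>prod_aut_group I T\<^esub> f) i (f i u) = u" "f i ((inv\<^bsub>prod_aut_group I T\<^esub> f) i u) = u"
proof -
  interpret group "prod_aut_group I T" by (rule group_prod_aut_group)
  let ?g = "inv\<^bsub>prod_aut_group I T\<^esub> f"
  have g: "?g \<in> carrier (prod_aut_group I T)" using assms by simp
  show "?g i (f i u) = u"
    using prod_aut_mult[OF g assms(1) assms(2,3)] prod_aut_one[of i I u T] assms by simp
  show "f i (?g i u) = u"
    using prod_aut_mult[OF assms(1) g assms(2,3)] prod_aut_one[of i I u T] assms by simp
qed

lemma prod_aut_ext:
  assumes "f \<in> carrier (prod_aut_group I T)" "g \<in> carrier (prod_aut_group I T)"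
    and "\<And>i u. i \<in> I \<Longrightarrow> u \<in> pverts (T i) \<Longrightarrow> f i u = g i u"
  shows "f = g"
proof (rule PiE_ext)
  show "f \<in> (\<Pi>\<^sub>E i\<in>I. graph_auts (T i))" "g \<in> (\<Pi>\<^sub>E i\<in>I. graph_auts (T i))"
    using assms(1,2) by (simp_all add: carrier_prod_aut_group)
  show "f i = g i" if i: "i \<in> I" for i
  proof (rule PiE_ext)
    show "f i \<in> (\<Pi>\<^sub>E u\<in>pverts (T i). pverts (T i))" "g i \<in> (\<Pi>\<^sub>E u\<in>pverts (T i). pverts (T i))"
      by (rule graph_auts_PiE[OF prod_aut_mem[OF assms(1) i]], rule graph_auts_PiE[OF prod_aut_mem[OF assms(2) i]])
  qed (use assms(3) i in blast)
qed

section \<open>A lattice criterion for products of trees\<close>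

locale tree_product =
  fixes I :: "'i set" and T :: "'i \<Rightarrow> 'v pair_pre_digraph" and v0 :: "'i \<Rightarrow> 'v"
  assumes fin_I: "finite I"
    and trees: "\<And>i. i \<in> I \<Longrightarrow> locally_finite_tree (T i)"
    and v0: "\<And>i. i \<in> I \<Longrightarrow> v0 i \<in> pverts (T i)"
begin

abbreviation "G \<equiv> prod_aut_group I T"

sublocale G: group G by (rule group_prod_aut_group)

definition fixer :: "('i \<Rightarrow> 'v set) \<Rightarrow> ('i \<Rightarrow> 'v \<Rightarrow> 'v) set" where
  "fixer F = {f \<in> carrier G. \<forall>i\<in>I. \<forall>u\<in>F i. f i u = u}"

lemma subgroup_fixer:
  assumes "\<And>i. i \<in> I \<Longrightarrow> F i \<subseteq> pverts (T i)"
  shows "subgroup (fixer F) G"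
proof (rule G.subgroupI)
  show "fixer F \<subseteq> carrier G" by (auto simp: fixer_def)
  have "\<one>\<^bsub>G\<^esub> \<in> fixer F" using assms prod_aut_one by (fastforce simp: fixer_def)
  then show "fixer F \<noteq> {}" by blast
next
  fix f assume f: "f \<in> fixer F"
  have "(inv\<^bsub>G\<^esub> f) i u = u" if "i \<in> I" "u \<in> F i" for i u
    using prod_aut_inv(1)[of f I T i u] f that assms by (auto simp: fixer_def)
  then show "inv\<^bsub>G\<^esub> f \<in> fixer F" using f by (simp add: fixer_def)
next
  fix f g assume fg: "f \<in> fixer F" "g \<in> fixer F"
  have "(f \<otimes>\<^bsub>G\<^esub> g) i u = u" if "i \<in> I" "u \<in> F i" for i u
    using prod_aut_mult[of f I T g i u] fg that assms by (auto simp: fixer_def)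
  then show "f \<otimes>\<^bsub>G\<^esub> g \<in> fixer F" using fg by (simp add: fixer_def)
qed

definition ball_fixer :: "nat \<Rightarrow> ('i \<Rightarrow> 'v \<Rightarrow> 'v) set" where
  "ball_fixer r = fixer (\<lambda>i. tball (T i) (v0 i) r)"

definition stab :: "('i \<Rightarrow> 'v \<Rightarrow> 'v) set" where
  "stab = fixer (\<lambda>i. {v0 i})"

lemma v0_tball: "i \<in> I \<Longrightarrow> v0 i \<in> tball (T i) (v0 i) r"
proof -
  assume i: "i \<in> I"
  interpret locally_finite_tree "T i" by (rule trees[OF i])
  show ?thesis using v0[OF i] by (simp add: tball_def)
qed

lemma finite_tballs: "i \<in> I \<Longrightarrow> finite (tball (T i) (v0 i) r)"
  using locally_finite_tree.finite_tball[OF trees v0] by blast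

lemma bounded_family:
  assumes "\<And>i. i \<in> I \<Longrightarrow> finite (F i) \<and> F i \<subseteq> pverts (T i)"
  obtains r where "\<forall>i\<in>I. F i \<subseteq> tball (T i) (v0 i) r"
proof -
  have "finite (\<Union>i\<in>I. tdist (T i) (v0 i) ` F i)" using fin_I assms by blast
  then obtain r where r: "\<forall>d\<in>(\<Union>i\<in>I. tdist (T i) (v0 i) ` F i). d \<le> r"
    using finite_nat_set_iff_bounded_le by blast
  show ?thesis
  proof (rule that[of r], rule ballI)
    fix i assume "i \<in> I"
    then show "F i \<subseteq> tball (T i) (v0 i) r" using r assms by (auto simp: tball_def)
  qed
qed

lemma compactin_stab: "compactin (prod_aut_topology I T) stab"
proof -
  have "stab = (\<Pi>\<^sub>E i\<in>I. {f \<in> graph_auts (T i). f (v0 i) = v0 i})"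
    unfolding stab_def fixer_def carrier_prod_aut_group by (auto simp: PiE_iff extensional_def)
  then show ?thesis
    unfolding prod_aut_topology_def
    using locally_finite_tree.compactin_stabiliser[OF trees v0] by (simp add: compactin_PiE)
qed

text \<open>Agreement with \<open>g\<close> on a finite set means that the quotient by
  \<open>g\<close> fixes the image of this set under \<open>g\<close>. Finite sets lie in balls, and
  balls are finite, so one countable basis of subgroups gives the whole topology.\<close>

lemma openin_iff_ball_fixer:
  "openin (prod_aut_topology I T) A \<longleftrightarrow>
     A \<subseteq> carrier G \<and> (\<forall>g\<in>A. \<exists>r. ball_fixer r #>\<^bsub>G\<^esub> g \<subseteq> A)"
  (is "?L \<longleftrightarrow> ?R")
proof
  assume L: ?L
  then have A: "A \<subseteq> carrier G" unfolding openin_prod_aut_topology[OF fin_I] by (rule conjunct1)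
  show ?R
  proof (intro conjI A ballI)
    fix g assume g: "g \<in> A"
    then have gc: "g \<in> carrier G" using A by blast
    from bspec[OF conjunct2[OF L[unfolded openin_prod_aut_topology[OF fin_I]]] g]
    obtain F where F: "\<forall>i\<in>I. finite (F i) \<and> F i \<subseteq> pverts (T i)"
      "{h \<in> carrier G. \<forall>i\<in>I. \<forall>u\<in>F i. h i u = g i u} \<subseteq> A"
      by (elim exE conjE) (rule that)
    have "finite (g i ` F i) \<and> g i ` F i \<subseteq> pverts (T i)" if "i \<in> I" for i
    proof
      have Fi: "finite (F i)" "F i \<subseteq> pverts (T i)" using bspec[OF F(1) that] by simp_all
      show "finite (g i ` F i)" using Fi(1) by (rule finite_imageI)
      show "g i ` F i \<subseteq> pverts (T i)"
        using prod_aut_verts[OF gc that subsetD[OF Fi(2)]] by (rule image_subsetI)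
    qed
    then obtain r where "\<forall>i\<in>I. g i ` F i \<subseteq> tball (T i) (v0 i) r"
      by (rule bounded_family)
    note r = bspec[OF this]
    have "h \<in> A" if h: "h \<in> ball_fixer r #>\<^bsub>G\<^esub> g" for h
    proof -
      obtain u where u: "u \<in> ball_fixer r" "h = u \<otimes>\<^bsub>G\<^esub> g" using h by (auto simp: r_coset_def)
      have uc: "u \<in> carrier G" using u(1) by (simp add: ball_fixer_def fixer_def)
      have "h i w = g i w" if iw: "i \<in> I" "w \<in> F i" for i w
      proof -
        have w: "w \<in> pverts (T i)" using bspec[OF F(1) iw(1)] iw(2) by (simp add: subset_iff)
        have "h i w = u i (g i w)" using prod_aut_mult[OF uc gc iw(1) w] u(2) by simp
        moreover have "g i w \<in> tball (T i) (v0 i) r" using subsetD[OF r[OF iw(1)]] iw(2) by simp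
        then have "u i (g i w) = g i w" using u(1) iw(1) by (simp add: ball_fixer_def fixer_def)
        ultimately show ?thesis by simp
      qed
      moreover have "h \<in> carrier G" using u(2) uc gc by simp
      ultimately show ?thesis by (intro subsetD[OF F(2)]) simp
    qed
    then have "ball_fixer r #>\<^bsub>G\<^esub> g \<subseteq> A" by (rule subsetI)
    then show "\<exists>r. ball_fixer r #>\<^bsub>G\<^esub> g \<subseteq> A" by (rule exI)
  qed
next
  assume R: ?R
  show ?L
    unfolding openin_prod_aut_topology[OF fin_I]
  proof (intro conjI ballI)
    show A: "A \<subseteq> carrier G" using R by (rule conjunct1)
    fix g assume g: "g \<in> A"
    then have gc: "g \<in> carrier G" by (rule subsetD[OF A])
    from bspec[OF conjunct2[OF R] g] obtain r where r: "ball_fixer r #>\<^bsub>G\<^esub> g \<subseteq> A"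
      by (elim exE) (rule that)
    let ?g = "inv\<^bsub>G\<^esub> g"
    have ginv: "?g \<in> carrier G" using gc by simp
    let ?F = "\<lambda>i. ?g i ` tball (T i) (v0 i) r"
    show "\<exists>F. (\<forall>i\<in>I. finite (F i) \<and> F i \<subseteq> pverts (T i)) \<and>
        {h \<in> carrier G. \<forall>i\<in>I. \<forall>u\<in>F i. h i u = g i u} \<subseteq> A"
    proof (intro exI[of _ ?F] conjI ballI subsetI)
      show "finite (?F i)" if "i \<in> I" for i using finite_tballs[OF that] by simp
      show "w \<in> pverts (T i)" if "i \<in> I" "w \<in> ?F i" for i w
        using that prod_aut_verts[OF ginv] by (auto simp: tball_def)
      fix h assume "h \<in> {h \<in> carrier G. \<forall>i\<in>I. \<forall>u\<in>?F i. h i u = g i u}"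
      then have h: "h \<in> carrier G" "\<And>i u. i \<in> I \<Longrightarrow> u \<in> tball (T i) (v0 i) r \<Longrightarrow> h i (?g i u) = g i (?g i u)"
        by auto
      have "(h \<otimes>\<^bsub>G\<^esub> ?g) i u = u" if iu: "i \<in> I" "u \<in> tball (T i) (v0 i) r" for i u
      proof -
        have u: "u \<in> pverts (T i)" using iu by (simp add: tball_def)
        show ?thesis using prod_aut_mult[OF h(1) ginv iu(1) u] h(2)[OF iu] prod_aut_inv(2)[OF gc iu(1) u] by simp
      qed
      then have "h \<otimes>\<^bsub>G\<^esub> ?g \<in> ball_fixer r" using h(1) ginv by (simp add: ball_fixer_def fixer_def)
      moreover have "h = (h \<otimes>\<^bsub>G\<^esub> ?g) \<otimes>\<^bsub>G\<^esub> g" using h(1) gc by (simp add: G.m_assoc)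
      ultimately have "h \<in> ball_fixer r #>\<^bsub>G\<^esub> g" by (auto simp: r_coset_def)
      then show "h \<in> A" by (rule subsetD[OF r])
    qed
  qed
qed

text \<open>Transitivity on vertices makes the compact open stabiliser of the base vertices meet
  every coset; finiteness of its intersection with \<open>\<Gamma>\<close> then gives
  discreteness.\<close>

theorem cocompact_lattice_criterion:
  assumes \<Gamma>: "subgroup \<Gamma> G" "vertex_transitive I T \<Gamma>" and fin: "finite (stab \<inter> \<Gamma>)"
  shows "cocompact_lattice_in G (prod_aut_topology I T) \<Gamma>"
proof (rule cocompact_setting.cocompact_lattice[of G "prod_aut_topology I T" stab ball_fixer])
  show "cocompact_setting G (prod_aut_topology I T) stab ball_fixer \<Gamma>"
  proof (intro cocompact_setting.intro cocompact_setting_axioms.intro)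
    show "group G" by (rule group_prod_aut_group)
    show "topspace (prod_aut_topology I T) = carrier G" by (rule topspace_prod_aut_topology)
    show "subgroup stab G" unfolding stab_def using v0 by (intro subgroup_fixer) auto
    show "subgroup (ball_fixer r) G" for r
      unfolding ball_fixer_def by (intro subgroup_fixer) (auto simp: tball_def)
    show "ball_fixer r \<subseteq> stab" for r
      using v0_tball by (auto simp: ball_fixer_def stab_def fixer_def)
    show "ball_fixer (Suc r) \<subseteq> ball_fixer r" for r
      by (auto simp: ball_fixer_def fixer_def tball_def)
    show "openin (prod_aut_topology I T) A \<longleftrightarrow>
        A \<subseteq> carrier G \<and> (\<forall>g\<in>A. \<exists>r. ball_fixer r #>\<^bsub>G\<^esub> g \<subseteq> A)" for A
      by (rule openin_iff_ball_fixer)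
    show "compactin (prod_aut_topology I T) stab" by (rule compactin_stab)
    show "finite (stab \<inter> \<Gamma>)" by (rule fin)
    show "subgroup \<Gamma> G" by (rule \<Gamma>(1))
    show "\<exists>k\<in>stab. \<exists>\<gamma>\<in>\<Gamma>. g = k \<otimes>\<^bsub>G\<^esub> \<gamma>" if g: "g \<in> carrier G" for g
    proof -
      let ?g = "inv\<^bsub>G\<^esub> g"
      have ginv: "?g \<in> carrier G" using g by simp
      have "(\<lambda>i\<in>I. ?g i (v0 i)) \<in> (\<Pi>\<^sub>E i\<in>I. pverts (T i))" "restrict v0 I \<in> (\<Pi>\<^sub>E i\<in>I. pverts (T i))"
        using prod_aut_verts[OF ginv] v0 by auto
      \<comment> \<open>The element returns the preimage of the base vertices under \<open>g\<close>
        to the base, so \<open>g\<close> times its inverse fixes them.\<close>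
      then obtain \<gamma> where \<gamma>: "\<gamma> \<in> \<Gamma>" "\<forall>i\<in>I. \<gamma> i ((\<lambda>i\<in>I. ?g i (v0 i)) i) = restrict v0 I i"
        using \<Gamma>(2) unfolding vertex_transitive_def by blast
      have \<gamma>c: "\<gamma> \<in> carrier G" using \<gamma>(1) subgroup.subset[OF \<Gamma>(1)] by blast
      have "(g \<otimes>\<^bsub>G\<^esub> inv\<^bsub>G\<^esub> \<gamma>) i (v0 i) = v0 i" if i: "i \<in> I" for i
      proof -
        have w: "?g i (v0 i) \<in> pverts (T i)" using prod_aut_verts[OF ginv i v0[OF i]] .
        have "(inv\<^bsub>G\<^esub> \<gamma>) i (v0 i) = (inv\<^bsub>G\<^esub> \<gamma>) i (\<gamma> i (?g i (v0 i)))" using \<gamma>(2) i by simp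
        also have "\<dots> = ?g i (v0 i)" by (rule prod_aut_inv(1)[OF \<gamma>c i w])
        finally show ?thesis
          using prod_aut_mult[OF g G.inv_closed[OF \<gamma>c] i v0[OF i]] prod_aut_inv(2)[OF g i v0[OF i]] by simp
      qed
      then have "g \<otimes>\<^bsub>G\<^esub> inv\<^bsub>G\<^esub> \<gamma> \<in> stab" using g \<gamma>c by (simp add: stab_def fixer_def)
      moreover have "g = (g \<otimes>\<^bsub>G\<^esub> inv\<^bsub>G\<^esub> \<gamma>) \<otimes>\<^bsub>G\<^esub> \<gamma>" using g \<gamma>c by (simp add: G.m_assoc)
      ultimately show ?thesis using \<gamma>(1) by blast
    qed
    show "\<exists>r'. \<forall>u\<in>ball_fixer r'. inv\<^bsub>G\<^esub> g \<otimes>\<^bsub>G\<^esub> u \<otimes>\<^bsub>G\<^esub> g \<in> ball_fixer r" if g: "g \<in> carrier G" for g r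
    proof -
      let ?F = "\<lambda>i. g i ` tball (T i) (v0 i) r"
      have "finite (?F i) \<and> ?F i \<subseteq> pverts (T i)" if "i \<in> I" for i
        using finite_tballs[OF that] prod_aut_verts[OF g that] by (auto simp: tball_def)
      then obtain r' where "\<forall>i\<in>I. ?F i \<subseteq> tball (T i) (v0 i) r'" by (rule bounded_family)
      note r' = bspec[OF this]
      have "inv\<^bsub>G\<^esub> g \<otimes>\<^bsub>G\<^esub> u \<otimes>\<^bsub>G\<^esub> g \<in> ball_fixer r" if u: "u \<in> ball_fixer r'" for u
      proof -
        have uc: "u \<in> carrier G" using u by (simp add: ball_fixer_def fixer_def)
        have "(inv\<^bsub>G\<^esub> g \<otimes>\<^bsub>G\<^esub> u \<otimes>\<^bsub>G\<^esub> g) i w = w" if iw: "i \<in> I" "w \<in> tball (T i) (v0 i) r" for i w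
        proof -
          have w: "w \<in> pverts (T i)" "g i w \<in> pverts (T i)"
            using iw prod_aut_verts[OF g] by (auto simp: tball_def)
          have "u i (g i w) = g i w" using u r'[OF iw(1)] iw by (auto simp: ball_fixer_def fixer_def)
          then show ?thesis
            using prod_aut_mult[of "inv\<^bsub>G\<^esub> g \<otimes>\<^bsub>G\<^esub> u" I T g i w] prod_aut_mult[of "inv\<^bsub>G\<^esub> g" I T u i "g i w"]
              g uc iw w prod_aut_inv(1)[OF g iw(1) w(1)] by simp
        qed
        then show ?thesis using g uc by (simp add: ball_fixer_def fixer_def)
      qed
      then show ?thesis by blast
    qed
    show "(\<Inter>r. ball_fixer r) = {\<one>\<^bsub>G\<^esub>}"
    proof (intro equalityI subsetI)
      fix f assume f: "f \<in> (\<Inter>r. ball_fixer r)"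
      then have fc: "f \<in> carrier G" by (auto simp: ball_fixer_def fixer_def)
      have "f = \<one>\<^bsub>G\<^esub>"
      proof (rule prod_aut_ext[OF fc])
        fix i u assume iu: "i \<in> I" "u \<in> pverts (T i)"
        have "f \<in> ball_fixer (tdist (T i) (v0 i) u)" using f by blast
        then have "f i u = u" using iu by (auto simp: ball_fixer_def fixer_def tball_def)
        then show "f i u = \<one>\<^bsub>G\<^esub> i u" using prod_aut_one[of i I u T] iu by simp
      qed simp
      then show "f \<in> {\<one>\<^bsub>G\<^esub>}" by simp
    next
      fix f assume "f \<in> {\<one>\<^bsub>G\<^esub>}"
      then show "f \<in> (\<Inter>r. ball_fixer r)"
        using prod_aut_one by (fastforce simp: ball_fixer_def fixer_def tball_def)
    qed
  qed
qed

end

section \<open>Lifting actions to products of trees\<close>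

context tree_graph
begin

lemma covering_compose:
  assumes "covering E \<pi>" "\<And>u. u \<in> V \<Longrightarrow> bij_betw g (E (\<pi> u)) (E (g (\<pi> u)))"
  shows "covering E (\<lambda>u. g (\<pi> u))"
  unfolding covering_def
proof
  fix u assume u: "u \<in> V"
  have "bij_betw \<pi> (N u) (E (\<pi> u))" using assms(1) u by (simp add: covering_def)
  from bij_betw_trans[OF this assms(2)[OF u]] show "bij_betw (\<lambda>u. g (\<pi> u)) (N u) (E (g (\<pi> u)))"
    by (simp add: comp_def)
qed

text \<open>Both \<open>g\<close> and its inverse are lifted. Each composite of the lifts covers the
  identity and fixes a vertex, so uniqueness of lifts makes it the identity.\<close>

lemma lift_automorphism:
  assumes \<pi>: "covering E \<pi>" "\<And>u. u \<in> V \<Longrightarrow> \<pi> u \<in> X"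
    and g: "\<And>x. x \<in> X \<Longrightarrow> bij_betw g (E x) (E (g x))"
    and h: "\<And>x. x \<in> X \<Longrightarrow> bij_betw h (E x) (E (h x))"
    and inv: "\<And>x. x \<in> X \<Longrightarrow> h (g x) = x" "\<And>x. x \<in> X \<Longrightarrow> g (h x) = x"
    and xy: "x \<in> V" "y \<in> V" "\<pi> y = g (\<pi> x)"
  obtains f where "f \<in> graph_auts T" "f x = y" "\<forall>u\<in>V. \<pi> (f u) = g (\<pi> u)"
proof -
  have cg: "covering E (\<lambda>u. g (\<pi> u))" and ch: "covering E (\<lambda>u. h (\<pi> u))"
    using g h \<pi>(2) by (intro covering_compose[OF \<pi>(1)]; blast)+
  obtain f where f: "f x = y" "f \<in> V \<rightarrow> V" "\<And>u. u \<in> V \<Longrightarrow> \<pi> (f u) = g (\<pi> u)"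
    "\<And>u w. w \<in> N u \<Longrightarrow> f w \<in> N (f u)"
    using covering_lift[OF cg \<pi>(1) xy] by blast
  have yx: "\<pi> x = h (\<pi> y)" using xy inv(1)[OF \<pi>(2)[OF xy(1)]] by simp
  obtain f' where f': "f' y = x" "f' \<in> V \<rightarrow> V" "\<And>u. u \<in> V \<Longrightarrow> \<pi> (f' u) = h (\<pi> u)"
    "\<And>u w. w \<in> N u \<Longrightarrow> f' w \<in> N (f' u)"
    using covering_lift[OF ch \<pi>(1) xy(2,1) yx] by blast
  have fV: "f u \<in> V" "f' u \<in> V" if "u \<in> V" for u using f(2) f'(2) that by auto
  have l: "f' (f u) = u" if u: "u \<in> V" for u
  proof (rule lift_unique[OF \<pi>(1) xy(1) _ _ _ _ u])
    show "\<pi> (f' (f u)) = \<pi> u" if "u \<in> V" for u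
      using that f(3) f'(3) fV inv(1) \<pi>(2) by simp
  qed (use f f' in auto)
  have r: "f (f' u) = u" if u: "u \<in> V" for u
  proof (rule lift_unique[OF \<pi>(1) xy(2) _ _ _ _ u])
    show "\<pi> (f (f' u)) = \<pi> u" if "u \<in> V" for u
      using that f(3) f'(3) fV inv(2) \<pi>(2) by simp
  qed (use f f' in auto)
  have bij: "bij_betw f V V"
    by (rule bij_betw_byWitness[where f' = f']) (use l r fV in auto)
  have adj: "w \<in> N u" if "f w \<in> N (f u)" "u \<in> V" "w \<in> V" for u w
    using f'(4)[OF that(1)] l that by simp
  have "restrict f V \<in> graph_auts T"
    unfolding graph_auts_iff
  proof (intro conjI ballI)
    show "bij_betw (restrict f V) V V" using bij bij_betw_cong[of V "restrict f V" f] by auto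
    show "(restrict f V u, restrict f V w) \<in> parcs T \<longleftrightarrow> (u, w) \<in> parcs T" if "u \<in> V" "w \<in> V" for u w
      using that f(4)[of w u] adj[of w u] by (auto simp: nbrs_def)
  qed simp
  then show ?thesis
    by (rule that) (use f xy in auto)
qed

end

section \<open>Lifting an action on a product of graphs\<close>

locale covering_action = tree_product I T v0
  for I :: "'i set" and T :: "'i \<Rightarrow> 'v pair_pre_digraph" and v0 :: "'i \<Rightarrow> 'v" +
  fixes X :: "'i \<Rightarrow> 'x set" and E :: "'i \<Rightarrow> 'x \<Rightarrow> 'x set" and \<pi> :: "'i \<Rightarrow> 'v \<Rightarrow> 'x"
  assumes cov: "\<And>i. i \<in> I \<Longrightarrow> tree_graph.covering (T i) (E i) (\<pi> i)"
    and \<pi>_X: "\<And>i u. i \<in> I \<Longrightarrow> u \<in> pverts (T i) \<Longrightarrow> \<pi> i u \<in> X i"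
begin

lemma tree_graph_T: "i \<in> I \<Longrightarrow> tree_graph (T i)"
  using trees locally_finite_tree.axioms(1) by blast

text \<open>Elements matter only through their restrictions to the sets \<open>X i\<close>, so the
  group laws are stated pointwise there instead of as equations between functions.\<close>

definition transitive_action :: "('i \<Rightarrow> 'x \<Rightarrow> 'x) set \<Rightarrow> bool" where
  "transitive_action \<Lambda> \<longleftrightarrow>
     (\<forall>g\<in>\<Lambda>. \<forall>i\<in>I. \<forall>x\<in>X i. g i x \<in> X i \<and> bij_betw (g i) (E i x) (E i (g i x))) \<and>
     (\<forall>g\<in>\<Lambda>. \<forall>h\<in>\<Lambda>. \<exists>k\<in>\<Lambda>. \<forall>i\<in>I. \<forall>x\<in>X i. k i x = g i (h i x)) \<and>
     (\<forall>g\<in>\<Lambda>. \<exists>h\<in>\<Lambda>. \<forall>i\<in>I. \<forall>x\<in>X i. h i (g i x) = x \<and> g i (h i x) = x) \<and>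
     (\<forall>x y. (\<forall>i\<in>I. x i \<in> X i \<and> y i \<in> X i) \<longrightarrow> (\<exists>g\<in>\<Lambda>. \<forall>i\<in>I. g i (x i) = y i))"

definition covers :: "('i \<Rightarrow> 'v \<Rightarrow> 'v) \<Rightarrow> ('i \<Rightarrow> 'x \<Rightarrow> 'x) \<Rightarrow> bool" where
  "covers f g \<longleftrightarrow> (\<forall>i\<in>I. \<forall>u\<in>pverts (T i). \<pi> i (f i u) = g i (\<pi> i u))"

text \<open>All lifts are taken, hence also the covering transformations. They supply transitivity
  within the fibres of the coverings.\<close>

definition lifts :: "('i \<Rightarrow> 'x \<Rightarrow> 'x) set \<Rightarrow> ('i \<Rightarrow> 'v \<Rightarrow> 'v) set" where
  "lifts \<Lambda> = {f \<in> carrier G. \<exists>g\<in>\<Lambda>. covers f g}"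

text \<open>The covering reaches this part of \<open>X i\<close>, so two maps count as different for
  the lifts when they differ here.\<close>

definition component :: "'i \<Rightarrow> 'x set" where
  "component i = {x. (\<pi> i (v0 i), x) \<in> {(a, b). b \<in> E i a}\<^sup>*}"

lemma component_image:
  assumes "i \<in> I" "x \<in> component i"
  obtains u where "u \<in> pverts (T i)" "\<pi> i u = x"
  using tree_graph.covering_lift_rtrancl[OF tree_graph_T[OF assms(1)] cov[OF assms(1)] v0[OF assms(1)]]
    assms(2) unfolding component_def by blast

lemma actD:
  assumes "transitive_action \<Lambda>" "g \<in> \<Lambda>" "i \<in> I" "x \<in> X i"
  shows "g i x \<in> X i" "bij_betw (g i) (E i x) (E i (g i x))"
  using assms unfolding transitive_action_def by blast+

lemma act_inverse:
  assumes "transitive_action \<Lambda>" "g \<in> \<Lambda>"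
  obtains h where "h \<in> \<Lambda>" "\<forall>i\<in>I. \<forall>x\<in>X i. h i (g i x) = x \<and> g i (h i x) = x"
proof -
  have "\<exists>h\<in>\<Lambda>. \<forall>i\<in>I. \<forall>x\<in>X i. h i (g i x) = x \<and> g i (h i x) = x"
    using assms unfolding transitive_action_def by blast
  then show ?thesis by (elim bexE) (rule that)
qed

lemma act_mult:
  assumes "transitive_action \<Lambda>" "g \<in> \<Lambda>" "h \<in> \<Lambda>"
  obtains k where "k \<in> \<Lambda>" "\<forall>i\<in>I. \<forall>x\<in>X i. k i x = g i (h i x)"
proof -
  have "\<exists>k\<in>\<Lambda>. \<forall>i\<in>I. \<forall>x\<in>X i. k i x = g i (h i x)"
    using assms unfolding transitive_action_def by blast
  then show ?thesis by (elim bexE) (rule that)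
qed

lemma act_transitive:
  assumes "transitive_action \<Lambda>" "\<And>i. i \<in> I \<Longrightarrow> x i \<in> X i" "\<And>i. i \<in> I \<Longrightarrow> y i \<in> X i"
  obtains g where "g \<in> \<Lambda>" "\<forall>i\<in>I. g i (x i) = y i"
proof -
  have "\<exists>g\<in>\<Lambda>. \<forall>i\<in>I. g i (x i) = y i"
    using assms(1) unfolding transitive_action_def using assms(2,3) by simp
  then show ?thesis by (elim bexE) (rule that)
qed

lemma lift_exists:
  assumes \<Lambda>: "transitive_action \<Lambda>" "g \<in> \<Lambda>"
    and xy: "\<And>i. i \<in> I \<Longrightarrow> x i \<in> pverts (T i)" "\<And>i. i \<in> I \<Longrightarrow> y i \<in> pverts (T i)"
      "\<And>i. i \<in> I \<Longrightarrow> \<pi> i (y i) = g i (\<pi> i (x i))"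
  obtains f where "f \<in> carrier G" "covers f g" "\<forall>i\<in>I. f i (x i) = y i"
proof -
  obtain h where h': "h \<in> \<Lambda>" "\<forall>i\<in>I. \<forall>x\<in>X i. h i (g i x) = x \<and> g i (h i x) = x"
    by (rule act_inverse[OF \<Lambda>])
  have h: "h \<in> \<Lambda>" "\<And>i x. i \<in> I \<Longrightarrow> x \<in> X i \<Longrightarrow> h i (g i x) = x"
    "\<And>i x. i \<in> I \<Longrightarrow> x \<in> X i \<Longrightarrow> g i (h i x) = x" using h' by simp_all
  have "\<forall>i\<in>I. \<exists>f. f \<in> graph_auts (T i) \<and> f (x i) = y i \<and> (\<forall>u\<in>pverts (T i). \<pi> i (f u) = g i (\<pi> i u))"
  proof
    fix i assume i: "i \<in> I"
    interpret tree_graph "T i" by (rule tree_graph_T[OF i])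
    obtain f where f: "f \<in> graph_auts (T i)" "f (x i) = y i" "\<forall>u\<in>pverts (T i). \<pi> i (f u) = g i (\<pi> i u)"
      by (rule lift_automorphism[OF cov[OF i] \<pi>_X[OF i] actD(2)[OF \<Lambda> i] actD(2)[OF \<Lambda>(1) h(1) i]
            h(2)[OF i] h(3)[OF i] xy(1)[OF i] xy(2)[OF i] xy(3)[OF i]])
    then show "\<exists>f. f \<in> graph_auts (T i) \<and> f (x i) = y i \<and> (\<forall>u\<in>pverts (T i). \<pi> i (f u) = g i (\<pi> i u))"
      by (intro exI[of _ f] conjI)
  qed
  from bchoice[OF this] obtain f where f: "\<forall>i\<in>I. f i \<in> graph_auts (T i) \<and> f i (x i) = y i \<and>
      (\<forall>u\<in>pverts (T i). \<pi> i (f i u) = g i (\<pi> i u))" ..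
  show ?thesis
    by (rule that[of "restrict f I"]) (use f in \<open>auto simp: carrier_prod_aut_group covers_def\<close>)
qed

lemma lift_eqI:
  assumes f: "f \<in> carrier G" "covers f g" and h: "h \<in> carrier G" "covers h k" and i: "i \<in> I"
    and "f i (v0 i) = h i (v0 i)" and "\<And>u. u \<in> pverts (T i) \<Longrightarrow> g i (\<pi> i u) = k i (\<pi> i u)"
    and u: "u \<in> pverts (T i)"
  shows "f i u = h i u"
proof -
  interpret tree_graph "T i" by (rule tree_graph_T[OF i])
  have nbr: "f i w \<in> nbrs (T i) (f i u)" if "f \<in> carrier G" "w \<in> nbrs (T i) u" for f u w
    using graph_auts_nbrs[OF prod_aut_mem[OF that(1) i] nbrs_verts(2,1)[OF that(2)]] that(2) by simp
  show ?thesis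
  proof (rule lift_unique[where f = "f i" and g = "h i", OF cov[OF i] v0[OF i] assms(6) _ nbr[OF f(1)] nbr[OF h(1)] u])
    show "\<pi> i (f i u) = \<pi> i (h i u)" if "u \<in> pverts (T i)" for u
      using f(2) h(2) i that assms(7) by (simp add: covers_def)
  qed
qed

lemma covers_mult:
  assumes "f \<in> carrier G" "covers f g" "f' \<in> carrier G" "covers f' g'"
    and "\<And>i x. i \<in> I \<Longrightarrow> x \<in> X i \<Longrightarrow> k i x = g i (g' i x)"
  shows "covers (f \<otimes>\<^bsub>G\<^esub> f') k"
  using assms prod_aut_mult[OF assms(1,3)] prod_aut_verts[OF assms(3)] \<pi>_X unfolding covers_def by simp

lemma covers_inv:
  assumes f: "f \<in> carrier G" "covers f g" and h: "\<And>i x. i \<in> I \<Longrightarrow> x \<in> X i \<Longrightarrow> h i (g i x) = x"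
  shows "covers (inv\<^bsub>G\<^esub> f) h"
  unfolding covers_def
proof (intro ballI)
  fix i u assume iu: "i \<in> I" "u \<in> pverts (T i)"
  let ?w = "(inv\<^bsub>G\<^esub> f) i u"
  have w: "?w \<in> pverts (T i)" using prod_aut_verts[OF G.inv_closed[OF f(1)] iu] .
  have "\<pi> i u = g i (\<pi> i ?w)" using f(2) prod_aut_inv(2)[OF f(1) iu] iu w by (metis covers_def)
  then show "\<pi> i ?w = h i (\<pi> i u)" using h[OF iu(1) \<pi>_X[OF iu(1) w]] by simp
qed

lemma lifts_subset: "lifts \<Lambda> \<subseteq> carrier G"
  by (auto simp: lifts_def)

lemma lifts_transitive:
  assumes \<Lambda>: "transitive_action \<Lambda>"
    and xy: "\<And>i. i \<in> I \<Longrightarrow> x i \<in> pverts (T i)" "\<And>i. i \<in> I \<Longrightarrow> y i \<in> pverts (T i)"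
  obtains f where "f \<in> lifts \<Lambda>" "\<forall>i\<in>I. f i (x i) = y i"
proof -
  obtain g where g: "g \<in> \<Lambda>" "\<forall>i\<in>I. g i (\<pi> i (x i)) = \<pi> i (y i)"
    using \<pi>_X[OF _ xy(1)] \<pi>_X[OF _ xy(2)] by (rule act_transitive[OF \<Lambda>])
  have g': "\<pi> i (y i) = g i (\<pi> i (x i))" if "i \<in> I" for i using bspec[OF g(2) that] by simp
  obtain f where f: "f \<in> carrier G" "covers f g" "\<forall>i\<in>I. f i (x i) = y i"
    by (rule lift_exists[OF \<Lambda> g(1) xy g'])
  show ?thesis
  proof (rule that)
    show "f \<in> lifts \<Lambda>" using f(1,2) g(1) by (auto simp: lifts_def)
  qed (rule f(3))
qed

lemma subgroup_lifts:
  assumes \<Lambda>: "transitive_action \<Lambda>"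
  shows "subgroup (lifts \<Lambda>) G"
proof (rule G.subgroupI[OF lifts_subset])
  show "lifts \<Lambda> \<noteq> {}" by (rule lifts_transitive[OF \<Lambda> v0 v0]) auto
  show "inv\<^bsub>G\<^esub> f \<in> lifts \<Lambda>" if f: "f \<in> lifts \<Lambda>" for f
  proof -
    obtain g where g: "f \<in> carrier G" "g \<in> \<Lambda>" "covers f g" using f by (auto simp: lifts_def)
    obtain h where h: "h \<in> \<Lambda>" "\<forall>i\<in>I. \<forall>x\<in>X i. h i (g i x) = x \<and> g i (h i x) = x"
      by (rule act_inverse[OF \<Lambda> g(2)])
    have "covers (inv\<^bsub>G\<^esub> f) h" by (rule covers_inv[OF g(1,3)]) (simp add: h(2))
    moreover have "inv\<^bsub>G\<^esub> f \<in> carrier G" using g(1) by simp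
    ultimately show ?thesis using h(1) by (auto simp: lifts_def)
  qed
  show "f \<otimes>\<^bsub>G\<^esub> f' \<in> lifts \<Lambda>" if f: "f \<in> lifts \<Lambda>" "f' \<in> lifts \<Lambda>" for f f'
  proof -
    obtain g where g: "f \<in> carrier G" "g \<in> \<Lambda>" "covers f g" using f by (auto simp: lifts_def)
    obtain g' where g': "f' \<in> carrier G" "g' \<in> \<Lambda>" "covers f' g'" using f by (auto simp: lifts_def)
    obtain k where k: "k \<in> \<Lambda>" "\<forall>i\<in>I. \<forall>x\<in>X i. k i x = g i (g' i x)"
      by (rule act_mult[OF \<Lambda> g(2) g'(2)])
    have "covers (f \<otimes>\<^bsub>G\<^esub> f') k" by (rule covers_mult[OF g(1,3) g'(1,3)]) (simp add: k(2))
    moreover have "f \<otimes>\<^bsub>G\<^esub> f' \<in> carrier G" using g(1) g'(1) by simp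
    ultimately show ?thesis using k(1) by (auto simp: lifts_def)
  qed
qed

lemma vertex_transitive_lifts:
  assumes \<Lambda>: "transitive_action \<Lambda>"
  shows "vertex_transitive I T (lifts \<Lambda>)"
  unfolding vertex_transitive_def
proof (intro ballI)
  fix x y assume "x \<in> (\<Pi>\<^sub>E i\<in>I. pverts (T i))" "y \<in> (\<Pi>\<^sub>E i\<in>I. pverts (T i))"
  then have "\<And>i. i \<in> I \<Longrightarrow> x i \<in> pverts (T i)" "\<And>i. i \<in> I \<Longrightarrow> y i \<in> pverts (T i)" by auto
  then obtain h where "h \<in> lifts \<Lambda>" "\<forall>i\<in>I. h i (x i) = y i" by (rule lifts_transitive[OF \<Lambda>])
  then show "\<exists>h\<in>lifts \<Lambda>. \<forall>i\<in>I. h i (x i) = y i" by (intro bexI[of _ h])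
qed

text \<open>A lift fixing the base vertices is determined by the map it covers, so the stabiliser
  injects into the finite set of restricted maps.\<close>

lemma finite_stab_lifts:
  assumes fin: "finite ((\<lambda>g. \<lambda>i\<in>I. restrict (g i) (X i)) ` {g \<in> \<Lambda>. \<forall>i\<in>I. g i (\<pi> i (v0 i)) = \<pi> i (v0 i)})"
  shows "finite (stab \<inter> lifts \<Lambda>)"
proof -
  let ?R = "\<lambda>g. \<lambda>i\<in>I. restrict (g i) (X i)"
  have "\<forall>f\<in>stab \<inter> lifts \<Lambda>. \<exists>g. g \<in> \<Lambda> \<and> covers f g" by (auto simp: lifts_def)
  from bchoice[OF this] obtain \<phi> where \<phi>: "\<forall>f\<in>stab \<inter> lifts \<Lambda>. \<phi> f \<in> \<Lambda> \<and> covers f (\<phi> f)" by blast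
  have fix0: "f i (v0 i) = v0 i" if "f \<in> stab" "i \<in> I" for f i
    using that by (auto simp: stab_def fixer_def)
  have "(\<lambda>f. ?R (\<phi> f)) ` (stab \<inter> lifts \<Lambda>) \<subseteq> ?R ` {g \<in> \<Lambda>. \<forall>i\<in>I. g i (\<pi> i (v0 i)) = \<pi> i (v0 i)}"
  proof
    fix y assume "y \<in> (\<lambda>f. ?R (\<phi> f)) ` (stab \<inter> lifts \<Lambda>)"
    then obtain f where f: "f \<in> stab \<inter> lifts \<Lambda>" "y = ?R (\<phi> f)" by blast
    have "\<phi> f i (\<pi> i (v0 i)) = \<pi> i (v0 i)" if i: "i \<in> I" for i
    proof -
      have "\<pi> i (f i (v0 i)) = \<phi> f i (\<pi> i (v0 i))" using \<phi> f(1) v0[OF i] i unfolding covers_def by blast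
      then show ?thesis using fix0[of f i] f(1) i by simp
    qed
    then show "y \<in> ?R ` {g \<in> \<Lambda>. \<forall>i\<in>I. g i (\<pi> i (v0 i)) = \<pi> i (v0 i)}" using \<phi> f by blast
  qed
  then have "finite ((\<lambda>f. ?R (\<phi> f)) ` (stab \<inter> lifts \<Lambda>))" using fin finite_subset by blast
  moreover have "inj_on (\<lambda>f. ?R (\<phi> f)) (stab \<inter> lifts \<Lambda>)"
  proof (rule inj_onI)
    fix f h assume f: "f \<in> stab \<inter> lifts \<Lambda>" and h: "h \<in> stab \<inter> lifts \<Lambda>" and eq: "?R (\<phi> f) = ?R (\<phi> h)"
    have fc: "f \<in> carrier G" "h \<in> carrier G" using f h lifts_subset by blast+
    show "f = h"
    proof (rule prod_aut_ext[OF fc])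
      fix i u assume iu: "i \<in> I" "u \<in> pverts (T i)"
      show "f i u = h i u"
      proof (rule lift_eqI[OF fc(1) _ fc(2) _ iu(1) _ _ iu(2)])
        show "covers f (\<phi> f)" "covers h (\<phi> h)" using \<phi> f h by blast+
        show "f i (v0 i) = h i (v0 i)" using fix0[of f i] fix0[of h i] f h iu(1) by simp
        fix w assume "w \<in> pverts (T i)"
        then have "\<pi> i w \<in> X i" by (rule \<pi>_X[OF iu(1)])
        then show "\<phi> f i (\<pi> i w) = \<phi> h i (\<pi> i w)" using fun_cong[OF fun_cong[OF eq, of i], of "\<pi> i w"] iu by simp
      qed
    qed
  qed
  ultimately show ?thesis by (rule finite_imageD)
qed

text \<open>A lift of \<open>a\<close> that also covered some \<open>g\<close> in the smaller set
  would force \<open>a\<close> and \<open>g\<close> to agree on all images of tree vertices.\<close>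

lemma lifts_psubset:
  assumes sub: "\<Lambda> \<subseteq> \<Lambda>'" and \<Lambda>': "transitive_action \<Lambda>'" and a: "a \<in> \<Lambda>'" "\<And>i. i \<in> I \<Longrightarrow> a i (\<pi> i (v0 i)) = \<pi> i (v0 i)"
    and ne: "\<And>g. g \<in> \<Lambda> \<Longrightarrow> \<exists>i\<in>I. \<exists>x\<in>component i. a i x \<noteq> g i x"
  shows "lifts \<Lambda> \<subset> lifts \<Lambda>'"
proof -
  obtain f where f: "f \<in> carrier G" "covers f a"
    by (rule lift_exists[OF \<Lambda>' a(1) v0 v0]) (simp_all add: a(2))
  have "f \<notin> lifts \<Lambda>"
  proof
    assume "f \<in> lifts \<Lambda>"
    then obtain g where g: "g \<in> \<Lambda>" "covers f g" by (auto simp: lifts_def)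
    obtain i x where ix: "i \<in> I" "x \<in> component i" "a i x \<noteq> g i x"
      using ne[OF g(1)] by (elim bexE) (rule that)
    obtain u where "u \<in> pverts (T i)" "\<pi> i u = x" by (rule component_image[OF ix(1,2)])
    then have "a i x = g i x" using f(2) g(2) ix(1) by (auto simp: covers_def)
    then show False using ix(3) by simp
  qed
  moreover have "f \<in> lifts \<Lambda>'" using f a(1) by (auto simp: lifts_def)
  moreover have "lifts \<Lambda> \<subseteq> lifts \<Lambda>'" using sub by (auto simp: lifts_def)
  ultimately show ?thesis by blast
qed

text \<open>
  Infinitely many elements of the stabiliser of the base vertices with index different from \<open>j\<close>
  agree, by the pigeonhole principle, on given finite sets.
\<close>

lemma near_identity:
  fixes h :: "nat \<Rightarrow> 'i \<Rightarrow> 'x \<Rightarrow> 'x"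
  assumes \<Lambda>: "transitive_action \<Lambda>" and J: "j \<in> I"
    and h: "\<And>l. h l \<in> \<Lambda>" "\<And>l. h l j (\<pi> j (v0 j)) \<in> component j"
      "\<And>l i. i \<in> I \<Longrightarrow> i \<noteq> j \<Longrightarrow> h l i (\<pi> i (v0 i)) = \<pi> i (v0 i)"
      "\<And>l l' i. i \<in> I \<Longrightarrow> i \<noteq> j \<Longrightarrow> l \<noteq> l' \<Longrightarrow> \<exists>x\<in>component i. h l i x \<noteq> h l' i x"
    and F: "\<And>i. i \<in> I \<Longrightarrow> i \<noteq> j \<Longrightarrow> finite (F i) \<and> F i \<subseteq> pverts (T i)"
  obtains \<gamma> where "\<gamma> \<in> lifts \<Lambda>" "\<And>i u. i \<in> I \<Longrightarrow> i \<noteq> j \<Longrightarrow> u \<in> F i \<Longrightarrow> \<gamma> i u = u"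
    "\<And>i. i \<in> I \<Longrightarrow> i \<noteq> j \<Longrightarrow> \<exists>u\<in>pverts (T i). \<gamma> i u \<noteq> u"
proof -
  \<comment> \<open>Nothing is prescribed in coordinate \<open>j\<close>, where the base vertex is
    moved.\<close>
  define F' where "F' i = (if i = j then {} else F i)" for i
  have "finite (F' i) \<and> F' i \<subseteq> pverts (T i)" if "i \<in> I" for i using F that by (simp add: F'_def)
  then obtain r where "\<forall>i\<in>I. F' i \<subseteq> tball (T i) (v0 i) r" by (rule bounded_family)
  note r = bspec[OF this]
  have "\<exists>f. f \<in> carrier G \<and> covers f (h l) \<and> (\<forall>i\<in>I. i \<noteq> j \<longrightarrow> f i (v0 i) = v0 i)" for l
  proof -
    \<comment> \<open>Coordinate \<open>j\<close> of the lift starts at any vertex above the moved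
      base point; all other coordinates keep their base vertex.\<close>
    obtain w where w: "w \<in> pverts (T j)" "\<pi> j w = h l j (\<pi> j (v0 j))"
      by (rule component_image[OF J h(2)])
    obtain f where f: "f \<in> carrier G" "covers f (h l)" "\<forall>i\<in>I. f i (v0 i) = (if i = j then w else v0 i)"
    proof (rule lift_exists[OF \<Lambda> h(1)[of l], of v0 "\<lambda>i. if i = j then w else v0 i"])
      show "\<pi> i (if i = j then w else v0 i) = h l i (\<pi> i (v0 i))" if "i \<in> I" for i
        using w h(3)[OF that] by simp
    qed (use w v0 in auto)
    show ?thesis using f by (intro exI[of _ f]) simp
  qed
  then have "\<forall>l. \<exists>f. f \<in> carrier G \<and> covers f (h l) \<and> (\<forall>i\<in>I. i \<noteq> j \<longrightarrow> f i (v0 i) = v0 i)" ..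
  from choice[OF this] obtain \<tau>
    where "\<forall>l. \<tau> l \<in> carrier G \<and> covers (\<tau> l) (h l) \<and> (\<forall>i\<in>I. i \<noteq> j \<longrightarrow> \<tau> l i (v0 i) = v0 i)" ..
  then have \<tau>: "\<And>l. \<tau> l \<in> carrier G" "\<And>l. covers (\<tau> l) (h l)"
    "\<And>l i. i \<in> I \<Longrightarrow> i \<noteq> j \<Longrightarrow> \<tau> l i (v0 i) = v0 i" by simp_all
  let ?\<rho> = "\<lambda>l. \<lambda>i\<in>I - {j}. restrict (\<tau> l i) (F i)"
  have "range ?\<rho> \<subseteq> (\<Pi>\<^sub>E i\<in>I - {j}. \<Pi>\<^sub>E u\<in>F i. tball (T i) (v0 i) r)"
  proof
    fix y assume "y \<in> range ?\<rho>"
    then obtain l where y: "y = ?\<rho> l" by blast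
    have "\<tau> l i u \<in> tball (T i) (v0 i) r" if iu: "i \<in> I - {j}" "u \<in> F i" for i u
    proof -
      have i: "i \<in> I" using iu by simp
      have "u \<in> tball (T i) (v0 i) r" using r[OF i] iu by (auto simp: F'_def)
      then show ?thesis
        using locally_finite_tree.graph_aut_tball[OF trees[OF i] prod_aut_mem[OF \<tau>(1) i] v0[OF i]] \<tau>(3) iu by auto
    qed
    then show "y \<in> (\<Pi>\<^sub>E i\<in>I - {j}. \<Pi>\<^sub>E u\<in>F i. tball (T i) (v0 i) r)" unfolding y by auto
  qed
  moreover have "finite (\<Pi>\<^sub>E i\<in>I - {j}. \<Pi>\<^sub>E u\<in>F i. tball (T i) (v0 i) r)"
    using fin_I F finite_tballs by (intro finite_PiE) auto
  ultimately have "finite (range ?\<rho>)" by (rule finite_subset)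
  then have "\<not> inj ?\<rho>" using finite_imageD[of ?\<rho> UNIV] by auto
  then obtain l l' where l: "l \<noteq> l'" "?\<rho> l = ?\<rho> l'" unfolding inj_def by blast
  \<comment> \<open>The quotient of two lifts that agree on the given sets is trivial there, and it
    is nontrivial in each coordinate because the covered maps differ.\<close>
  let ?\<gamma> = "inv\<^bsub>G\<^esub> (\<tau> l) \<otimes>\<^bsub>G\<^esub> \<tau> l'"
  have \<gamma>: "?\<gamma> i u = (inv\<^bsub>G\<^esub> (\<tau> l)) i (\<tau> l' i u)" if "i \<in> I" "u \<in> pverts (T i)" for i u
    using prod_aut_mult[OF G.inv_closed[OF \<tau>(1)] \<tau>(1) that] .
  have \<tau>_lifts: "\<tau> l \<in> lifts \<Lambda>" for l using \<tau>(1,2) h(1) by (auto simp: lifts_def)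
  show ?thesis
  proof (rule that[of ?\<gamma>])
    show "?\<gamma> \<in> lifts \<Lambda>"
      using subgroup_lifts[OF \<Lambda>] \<tau>_lifts by (intro subgroup.m_closed subgroup.m_inv_closed)
    show "?\<gamma> i u = u" if iu: "i \<in> I" "i \<noteq> j" "u \<in> F i" for i u
    proof -
      have u: "u \<in> pverts (T i)" using F iu by blast
      have "\<tau> l i u = \<tau> l' i u" using fun_cong[OF fun_cong[OF l(2), of i], of u] iu by simp
      then show ?thesis using \<gamma>[OF iu(1) u] prod_aut_inv(1)[OF \<tau>(1) iu(1) u, of l] by simp
    qed
    show "\<exists>u\<in>pverts (T i). ?\<gamma> i u \<noteq> u" if i: "i \<in> I" "i \<noteq> j" for i
    proof (rule ccontr)
      assume "\<not> ?thesis"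
      then have id: "(inv\<^bsub>G\<^esub> (\<tau> l)) i (\<tau> l' i u) = u" if "u \<in> pverts (T i)" for u
        using \<gamma>[OF i(1) that] that by auto
      obtain x where x: "x \<in> component i" "h l i x \<noteq> h l' i x"
        using h(4)[OF i l(1)] by (elim bexE) (rule that)
      obtain u where u: "u \<in> pverts (T i)" "\<pi> i u = x" by (rule component_image[OF i(1) x(1)])
      have "\<tau> l' i u = \<tau> l i u"
        using prod_aut_inv(2)[OF \<tau>(1) i(1) prod_aut_verts[OF \<tau>(1) i(1) u(1)], of l l'] id[OF u(1)] by simp
      moreover have "\<pi> i (\<tau> k i u) = h k i x" for k using \<tau>(2)[of k] i(1) u by (simp add: covers_def)
      ultimately show False using x(2) by metis
    qed
  qed
qed

end

section \<open>The graphs of cosets\<close>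

lemma diff_divide_via:
  fixes x :: "'a :: field"
  shows "(x - a') / d = (x - a) / d + (a - a') / d" "(x - a) / d = (x - a') / d - (a - a') / d"
  by (simp_all add: diff_divide_distrib)

lemma power_diff_quotient:
  fixes x :: "'a :: field"
  assumes "x \<noteq> 0" "l \<le> l'"
  shows "inverse x ^ l * ((x ^ l' - x ^ l) / d) = (x ^ (l' - l) - 1) / d"
proof -
  have "inverse x ^ l * x ^ l' = x ^ (l' - l)" using assms by (simp add: power_diff power_inverse field_simps)
  moreover have "inverse x ^ l * x ^ l = 1" using assms(1) by (simp add: power_inverse)
  ultimately have "inverse x ^ l * (x ^ l' - x ^ l) = x ^ (l' - l) - 1" by (simp only: right_diff_distrib)
  then show ?thesis by (simp only: times_divide_eq_right)
qed

lemma bij_affine: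
  fixes u :: "'a :: field"
  assumes "u \<noteq> 0"
  shows "bij (\<lambda>x. a + u * x)"
  by (rule bij_betw_byWitness[where f' = "\<lambda>y. (y - a) / u"]) (use assms in auto)

context place_system
begin

declare t_nz [simp]

definition coset :: "nat \<Rightarrow> int \<Rightarrow> int poly fract \<Rightarrow> int poly fract set" where
  "coset i c a = {x. (x - a) / t i powi c \<in> reg i}"

text \<open>The level is stored beside the coset, so that it never has to be recovered from the set
  itself.\<close>

definition coset_verts :: "nat \<Rightarrow> (int \<times> int poly fract set) set" where
  "coset_verts i = {(c, coset i c a) | c a. a \<in> K}"

definition shift :: "nat \<Rightarrow> int \<Rightarrow> int \<times> int poly fract set \<Rightarrow> (int \<times> int poly fract set) set" where
  "shift i e x = (\<lambda>a. (fst x + e, coset i (fst x + e) a)) ` snd x"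

text \<open>A step refines the coset at the zeros of \<open>t i\<close> while coarsening it at the
  pole, or conversely. This is the Diestel-Leader graph, the horocyclic product of two trees of
  equal branching; it contains cycles of length 4.\<close>

definition adj :: "nat \<Rightarrow> int \<times> int poly fract set \<Rightarrow> (int \<times> int poly fract set) set" where
  "adj i x = shift i 1 x \<union> shift i (- 1) x"

definition monomial :: "(nat \<Rightarrow> int) \<Rightarrow> int poly fract" where
  "monomial k = (\<Prod>j\<in>I. t j powi k j)"

definition act :: "int poly fract \<Rightarrow> (nat \<Rightarrow> int) \<Rightarrow> nat \<Rightarrow> int \<times> int poly fract set \<Rightarrow> int \<times> int poly fract set"
  where "act a k i x = (fst x + k i, (\<lambda>y. a + monomial k * y) ` snd x)"

definition acts :: "nat \<Rightarrow> (nat \<Rightarrow> int \<times> int poly fract set \<Rightarrow> int \<times> int poly fract set) set" where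
  "acts m = {act a k | a k. a \<in> level m}"

lemma acts_cases:
  assumes "g \<in> acts m"
  obtains a k where "g = act a k" "a \<in> level m"
  using assms by (auto simp: acts_def)

lemma t_powi_nz [simp]: "i \<in> I \<Longrightarrow> t i powi c \<noteq> 0"
  using t_nz by (simp add: power_int_eq_0_iff)

lemma t_powi_add: "i \<in> I \<Longrightarrow> t i powi (c + d) = t i powi c * t i powi d"
  using t_nz by (simp add: power_int_add)

lemma t_powi_K': "i \<in> I \<Longrightarrow> t i powi c \<in> K"
  using t_powi_K[of i "- c"] t_nz[of i] by (simp add: power_int_minus field_simps)

lemma reg_uminus: "x \<in> reg i \<Longrightarrow> - x \<in> reg i"
  using reg_diff[OF reg_0, of x i] by simp

lemma reg_add: "x \<in> reg i \<Longrightarrow> y \<in> reg i \<Longrightarrow> x + y \<in> reg i"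
  using reg_diff[OF _ reg_uminus, of x i y] by simp

lemma reg_power: "x \<in> reg i \<Longrightarrow> x ^ n \<in> reg i"
  by (induction n) (auto intro: reg_1 reg_mult)

lemma t_powi_reg:
  assumes "i \<in> I" "j \<in> I" "i \<noteq> j"
  shows "t j powi c \<in> reg i"
  unfolding power_int_def using t_reg[OF assms] by (auto intro: reg_power)

lemma coset_self: "a \<in> coset i c a"
  by (simp add: coset_def reg_0)

lemma coset_eq_iff: "coset i c a = coset i c a' \<longleftrightarrow> (a - a') / t i powi c \<in> reg i"
proof
  assume "coset i c a = coset i c a'"
  then have "a \<in> coset i c a'" using coset_self[of a i c] by (simp only:)
  then show "(a - a') / t i powi c \<in> reg i" by (simp only: coset_def mem_Collect_eq)
next
  assume a: "(a - a') / t i powi c \<in> reg i"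
  show "coset i c a = coset i c a'"
    unfolding coset_def
  proof (intro Collect_cong iffI)
    show "(x - a') / t i powi c \<in> reg i" if "(x - a) / t i powi c \<in> reg i" for x
      unfolding diff_divide_via(1)[of x a' _ a] using that a by (rule reg_add)
    show "(x - a) / t i powi c \<in> reg i" if "(x - a') / t i powi c \<in> reg i" for x
      unfolding diff_divide_via(2)[of x a _ a'] using that a by (rule reg_diff)
  qed
qed

lemma coset_cong: "a \<in> coset i c a' \<Longrightarrow> coset i c a = coset i c a'"
  by (simp add: coset_eq_iff) (simp add: coset_def)

lemma coset_K:
  assumes "i \<in> I" "a \<in> K" "x \<in> coset i c a"
  shows "x \<in> K"
proof -
  have "t i powi c * ((x - a) / t i powi c) + a \<in> K"
    using assms by (intro K_add K_mult t_powi_K') (simp_all add: coset_def reg_K)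
  then show ?thesis using assms(1) by simp
qed

lemma adj_verts:
  assumes i: "i \<in> I" and x: "x \<in> coset_verts i"
  shows "adj i x \<subseteq> coset_verts i"
proof -
  obtain c a where x: "x = (c, coset i c a)" "a \<in> K" using x by (auto simp: coset_verts_def)
  show ?thesis using coset_K[OF i x(2)] by (auto simp: x(1) adj_def shift_def coset_verts_def)
qed

lemma adj_sym:
  assumes x: "x \<in> coset_verts i" and y: "y \<in> adj i x"
  shows "x \<in> adj i y"
proof -
  obtain c a where x: "x = (c, coset i c a)" using x by (auto simp: coset_verts_def)
  obtain e a' where y: "e = 1 \<or> e = - 1" "a' \<in> coset i c a" "y = (c + e, coset i (c + e) a')"
    using y by (auto simp: x adj_def shift_def)
  have "(c + e + - e, coset i (c + e + - e) a') \<in> shift i (- e) y"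
    using coset_self[of a' i "c + e"] by (auto simp: shift_def y(3))
  then have "x \<in> shift i (- e) y" using coset_cong[OF y(2)] by (simp add: x)
  then show ?thesis using y(1) by (auto simp: adj_def)
qed

text \<open>The affine map from \<open>reg i\<close> onto the coset carries the finer or coarser
  cosets along and reduces the count to level 0.\<close>

lemma card_shift:
  assumes i: "i \<in> I"
  shows "card (shift i e (c, coset i c a)) = card ((\<lambda>a. {x. (x - a) / t i powi e \<in> reg i}) ` reg i)"
proof -
  let ?T = "t i powi c"
  let ?\<phi> = "\<lambda>x. a + ?T * x"
  let ?D = "\<lambda>a. {x. (x - a) / t i powi e \<in> reg i}"
  have \<phi>: "bij ?\<phi>" using i by (intro bij_affine) simp
  have C: "coset i c a = ?\<phi> ` reg i"
  proof (intro equalityI subsetI)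
    fix y assume "y \<in> coset i c a"
    then show "y \<in> ?\<phi> ` reg i"
      using i by (intro image_eqI[of _ _ "(y - a) / ?T"]) (simp_all add: coset_def)
  qed (use i in \<open>auto simp: coset_def\<close>)
  have D: "coset i (c + e) (?\<phi> x) = ?\<phi> ` ?D x" for x
  proof -
    have *: "(?\<phi> y - ?\<phi> x) / t i powi (c + e) = (y - x) / t i powi e" for y
    proof -
      have "(?\<phi> y - ?\<phi> x) / t i powi (c + e) = (?T * (y - x)) / (?T * t i powi e)"
        using i by (simp add: t_powi_add algebra_simps)
      then show ?thesis using i by simp
    qed
    show ?thesis
    proof (intro equalityI subsetI)
      fix z assume z: "z \<in> coset i (c + e) (?\<phi> x)"
      obtain y where y: "z = ?\<phi> y" using bij_is_surj[OF \<phi>] by (rule surjE)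
      have "y \<in> ?D x" using z unfolding y coset_def mem_Collect_eq * .
      then show "z \<in> ?\<phi> ` ?D x" unfolding y by (rule imageI)
    next
      fix z assume "z \<in> ?\<phi> ` ?D x"
      then obtain y where "y \<in> ?D x" "z = ?\<phi> y" by (elim imageE) (rule that)
      then show "z \<in> coset i (c + e) (?\<phi> x)" by (simp only: coset_def mem_Collect_eq *)
    qed
  qed
  have "shift i e (c, coset i c a) = (\<lambda>A. (c + e, ?\<phi> ` A)) ` ?D ` reg i"
    unfolding shift_def fst_conv snd_conv C image_image D ..
  moreover have "inj (\<lambda>A. (c + e, ?\<phi> ` A))"
    using inj_image_eq_iff[OF bij_is_inj[OF \<phi>]] by (simp add: inj_def)
  ultimately show ?thesis by (simp add: card_image inj_on_subset)
qed

lemma card_adj: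
  assumes i: "i \<in> I" and x: "x \<in> coset_verts i"
  shows "finite (adj i x) \<and> card (adj i x) = 2 * nat b ^ degree (p i)"
proof -
  obtain c a where x: "x = (c, coset i c a)" using x by (auto simp: coset_verts_def)
  have card: "card (shift i 1 x) = nat b ^ degree (p i)" "card (shift i (- 1) x) = nat b ^ degree (p i)"
    using card_reg_cosets_down[OF i] card_reg_cosets_up[OF i]
    by (simp_all add: x card_shift[OF i] power_int_minus divide_inverse)
  have "nat b ^ degree (p i) > 0" using b2 by simp
  then have fin: "finite (shift i 1 x)" "finite (shift i (- 1) x)"
    using card by (auto intro!: card_ge_0_finite simp del: zero_less_power_eq)
  have "shift i 1 x \<inter> shift i (- 1) x = {}" by (auto simp: shift_def)
  from card_Un_disjoint[OF fin this] show ?thesis using fin card by (simp add: adj_def)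
qed

section \<open>Monomials and their affine action on cosets\<close>

lemma monomial_split: "i \<in> I \<Longrightarrow> monomial k = t i powi k i * (\<Prod>j\<in>I - {i}. t j powi k j)"
  unfolding monomial_def using fin_I by (rule prod.remove)

lemma monomial_nz [simp]: "monomial k \<noteq> 0"
  unfolding monomial_def using fin_I by (simp add: prod_zero_iff)

lemma cofactor_reg:
  assumes "i \<in> I"
  shows "(\<Prod>j\<in>I - {i}. t j powi k j) \<in> reg i"
proof -
  have "(\<Prod>j\<in>A. t j powi k j) \<in> reg i" if "A \<subseteq> I - {i}" for A
    using finite_subset[OF that finite_Diff[OF fin_I]] that
  proof (induction A)
    case (insert j A)
    have "t j powi k j \<in> reg i" using insert.prems by (intro t_powi_reg assms) auto
    then show ?case using insert by (simp add: reg_mult)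
  qed (simp add: reg_1)
  then show ?thesis by blast
qed

lemma monomial_uminus: "monomial (\<lambda>j. - k j) = inverse (monomial k)"
  unfolding monomial_def by (simp add: power_int_minus prod_inversef[symmetric] comp_def)

lemma monomial_add: "monomial (\<lambda>j. k j + l j) = monomial k * monomial l"
  unfolding monomial_def by (simp add: t_powi_add prod.distrib)

lemma monomial_0: "(\<And>j. j \<in> I \<Longrightarrow> k j = 0) \<Longrightarrow> monomial k = 1"
  unfolding monomial_def by simp

lemma monomial_K: "monomial k \<in> K"
proof -
  have "(\<Prod>j\<in>A. t j powi k j) \<in> K" if "finite A" "A \<subseteq> I" for A
    using that by (induction A) (auto intro: K_mult t_powi_K')
  then show ?thesis using fin_I by (simp add: monomial_def)
qed

lemma level_monomial:
  assumes "x \<in> level m"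
  shows "monomial k * x \<in> level m"
proof -
  have pow: "t j ^ n * x \<in> level m" "inverse (t j) ^ n * x \<in> level m"
    if "j \<in> I" "x \<in> level m" for j n x
    using that by (induction n) (simp_all add: level_t mult.assoc)
  have "(\<Prod>j\<in>A. t j powi k j) * x \<in> level m" if "finite A" "A \<subseteq> I" for A
    using that
  proof (induction A)
    case (insert j A)
    then have "t j powi k j * ((\<Prod>j\<in>A. t j powi k j) * x) \<in> level m"
      unfolding power_int_def by (auto intro!: pow)
    then show ?case using insert by (simp add: mult.assoc)
  qed (simp add: assms)
  then show ?thesis using fin_I by (simp add: monomial_def)
qed

lemma level_uminus: "x \<in> level m \<Longrightarrow> - x \<in> level m"
  using level_diff[OF level_0, of x m] by simp

text \<open>In coordinate \<open>i\<close> the factors \<open>t j\<close> with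
  \<open>j \<noteq> i\<close> are units of \<open>reg i\<close>, so the monomial shifts the level by
  its exponent at \<open>i\<close> only.\<close>

lemma affine_coset:
  assumes i: "i \<in> I"
  shows "(\<lambda>y. a + monomial k * y) ` coset i c x = coset i (c + k i) (a + monomial k * x)"
proof -
  let ?w = "\<Prod>j\<in>I - {i}. t j powi k j"
  have w: "?w \<noteq> 0" "inverse ?w \<in> reg i"
    using monomial_nz[of k] cofactor_reg[OF i, of "\<lambda>j. - k j"] monomial_split[OF i, of k]
    by (simp_all add: power_int_minus prod_inversef[symmetric] comp_def)
  have *: "(a + monomial k * y - (a + monomial k * x)) / t i powi (c + k i) = ?w * ((y - x) / t i powi c)" for y
  proof -
    have "(a + monomial k * y - (a + monomial k * x)) / t i powi (c + k i)
        = (t i powi k i * (?w * (y - x))) / (t i powi k i * t i powi c)"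
      unfolding monomial_split[OF i] t_powi_add[OF i] by (simp add: algebra_simps)
    then show ?thesis using i by simp
  qed
  show ?thesis
  proof (intro equalityI subsetI)
    fix z assume "z \<in> (\<lambda>y. a + monomial k * y) ` coset i c x"
    then obtain y where y: "y \<in> coset i c x" "z = a + monomial k * y" by (elim imageE) (rule that)
    have "(y - x) / t i powi c \<in> reg i" using y(1) by (simp only: coset_def mem_Collect_eq)
    then have "?w * ((y - x) / t i powi c) \<in> reg i" by (rule reg_mult[OF cofactor_reg[OF i]])
    then show "z \<in> coset i (c + k i) (a + monomial k * x)"
      unfolding y(2) coset_def mem_Collect_eq * .
  next
    fix z assume z: "z \<in> coset i (c + k i) (a + monomial k * x)"
    define y where "y = (z - a) / monomial k"
    have y: "z = a + monomial k * y" by (simp add: y_def)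
    have "inverse ?w * (?w * ((y - x) / t i powi c)) \<in> reg i"
      using z unfolding y coset_def mem_Collect_eq * by (rule reg_mult[OF w(2)])
    then have "y \<in> coset i c x" using w(1) by (simp add: coset_def mult.assoc[symmetric])
    then show "z \<in> (\<lambda>y. a + monomial k * y) ` coset i c x" unfolding y by (rule imageI)
  qed
qed

lemma act_coset: "i \<in> I \<Longrightarrow> act a k i (c, coset i c x) = (c + k i, coset i (c + k i) (a + monomial k * x))"
  by (simp add: act_def affine_coset)

lemma act_verts:
  assumes "i \<in> I" "a \<in> K" "x \<in> coset_verts i"
  shows "act a k i x \<in> coset_verts i"
proof -
  obtain c y where x: "x = (c, coset i c y)" "y \<in> K" using assms(3) by (auto simp: coset_verts_def)
  have "a + monomial k * y \<in> K" using assms(2) x(2) monomial_K by blast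
  then show ?thesis unfolding x(1) act_coset[OF assms(1)] coset_verts_def by blast
qed

lemma act_comp: "act a k i (act a' k' i x) = act (a + monomial k * a') (\<lambda>j. k j + k' j) i x"
  unfolding act_def monomial_add by (simp add: image_image algebra_simps)

lemma act_id:
  assumes "\<And>j. j \<in> I \<Longrightarrow> k j = 0" "i \<in> I"
  shows "act 0 k i x = x"
  using assms by (simp add: act_def monomial_0)

lemma act_inverse: "i \<in> I \<Longrightarrow> act (- (monomial (\<lambda>j. - k j) * a)) (\<lambda>j. - k j) i (act a k i x) = x"
  "i \<in> I \<Longrightarrow> act a k i (act (- (monomial (\<lambda>j. - k j) * a)) (\<lambda>j. - k j) i x) = x"
  by (simp_all add: act_comp act_id monomial_uminus mult.assoc[symmetric])

lemma inj_act: "i \<in> I \<Longrightarrow> inj (act a k i)"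
  by (rule inj_on_inverseI) (rule act_inverse(1))

lemma act_adj:
  assumes i: "i \<in> I"
  shows "bij_betw (act a k i) (adj i x) (adj i (act a k i x))"
proof -
  have "act a k i ` shift i e x = shift i e (act a k i x)" for e
    unfolding shift_def image_image act_coset[OF i] by (simp add: act_def image_image algebra_simps)
  then show ?thesis
    using inj_on_subset[OF inj_act[OF i]] by (simp add: bij_betw_def adj_def image_Un)
qed

lemma simultaneous_approximation:
  assumes "\<And>i. i \<in> I \<Longrightarrow> x i \<in> K"
  shows "\<exists>y\<in>level m. \<forall>i\<in>I. y - x i \<in> reg i"
proof (rule approximation[of x m, OF assms])
  fix y assume "y \<in> level m" "\<And>i. i \<in> I \<Longrightarrow> y - x i \<in> reg i"
  then show ?thesis by (intro bexI[of _ y] ballI)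
qed

lemma acts_transitive:
  assumes x: "\<And>i. i \<in> I \<Longrightarrow> x i \<in> coset_verts i" and y: "\<And>i. i \<in> I \<Longrightarrow> y i \<in> coset_verts i"
  obtains g where "g \<in> acts m" "\<forall>i\<in>I. g i (x i) = y i"
proof -
  have vertex: "\<exists>a. a \<in> K \<and> v = (fst v, coset i (fst v) a)" if "v \<in> coset_verts i" for v i
    using that by (auto simp: coset_verts_def)
  have "\<forall>i\<in>I. \<exists>a. a \<in> K \<and> x i = (fst (x i), coset i (fst (x i)) a)" by (intro ballI vertex x)
  from bchoice[OF this] obtain A where A: "\<forall>i\<in>I. A i \<in> K \<and> x i = (fst (x i), coset i (fst (x i)) (A i))" ..
  have "\<forall>i\<in>I. \<exists>a. a \<in> K \<and> y i = (fst (y i), coset i (fst (y i)) a)" by (intro ballI vertex y)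
  from bchoice[OF this] obtain B where B: "\<forall>i\<in>I. B i \<in> K \<and> y i = (fst (y i), coset i (fst (y i)) (B i))" ..
  define d where "d i = fst (y i)" for i
  define k where "k i = d i - fst (x i)" for i
  have "inverse (monomial d) \<in> K" using monomial_K[of "\<lambda>j. - d j"] by (simp add: monomial_uminus)
  \<comment> \<open>Division by one monomial brings all target cosets to level 0 at once, up to
    units in each coordinate. A single simultaneous approximation then serves every
    coordinate.\<close>
  then have target: "(B i - monomial k * A i) * inverse (monomial d) \<in> K" if "i \<in> I" for i
    using bspec[OF A that] bspec[OF B that] by (intro K_mult K_diff monomial_K) simp_all
  have "\<exists>z\<in>level m. \<forall>i\<in>I. z - (B i - monomial k * A i) * inverse (monomial d) \<in> reg i"
    by (rule simultaneous_approximation) (rule target)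
  then obtain z where z: "z \<in> level m" "\<forall>i\<in>I. z - (B i - monomial k * A i) * inverse (monomial d) \<in> reg i"
    by (elim bexE) (rule that)
  have "act (monomial d * z) k i (x i) = y i" if i: "i \<in> I" for i
  proof -
    let ?w = "\<Prod>j\<in>I - {i}. t j powi d j"
    have "monomial d * z + monomial k * A i - B i = monomial d * (z - (B i - monomial k * A i) * inverse (monomial d))"
      by (simp add: field_simps)
    also have "\<dots> = t i powi d i * (?w * (z - (B i - monomial k * A i) * inverse (monomial d)))"
      by (subst (1) monomial_split[OF i]) (simp only: mult.assoc)
    finally have "(monomial d * z + monomial k * A i - B i) / t i powi d i
        = ?w * (z - (B i - monomial k * A i) * inverse (monomial d))" using i by simp
    then have "(monomial d * z + monomial k * A i - B i) / t i powi d i \<in> reg i"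
      using reg_mult[OF cofactor_reg[OF i] bspec[OF z(2) i]] by simp
    then have "coset i (d i) (monomial d * z + monomial k * A i) = coset i (d i) (B i)"
      unfolding coset_eq_iff .
    moreover have "act (monomial d * z) k i (x i) = (d i, coset i (d i) (monomial d * z + monomial k * A i))"
    proof -
      have "x i = (fst (x i), coset i (fst (x i)) (A i))" using bspec[OF A i] by (rule conjunct2)
      then have "act (monomial d * z) k i (x i) = act (monomial d * z) k i (fst (x i), coset i (fst (x i)) (A i))"
        by (rule arg_cong)
      then show ?thesis unfolding act_coset[OF i] by (simp add: k_def)
    qed
    moreover have "y i = (d i, coset i (d i) (B i))" unfolding d_def using bspec[OF B i] by (rule conjunct2)
    ultimately show ?thesis by metis
  qed
  moreover have "act (monomial d * z) k \<in> acts m"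
    using level_monomial[OF z(1)] by (auto simp: acts_def)
  ultimately show ?thesis by (rule_tac that) (auto simp only:)
qed

lemma acts_mult: "g \<in> acts m \<Longrightarrow> h \<in> acts m \<Longrightarrow> \<exists>k\<in>acts m. \<forall>i\<in>I. \<forall>x\<in>coset_verts i. k i x = g i (h i x)"
proof -
  assume "g \<in> acts m" "h \<in> acts m"
  then obtain a k a' k' where *: "a \<in> level m" "g = act a k" "a' \<in> level m" "h = act a' k'"
    by (auto simp: acts_def)
  have "act (a + monomial k * a') (\<lambda>j. k j + k' j) \<in> acts m"
    using level_add[OF *(1) level_monomial[OF *(3)]] by (auto simp: acts_def)
  then show ?thesis by (rule bexI[rotated]) (simp add: *(2,4) act_comp)
qed

lemma acts_inverse: "g \<in> acts m \<Longrightarrow> \<exists>h\<in>acts m. \<forall>i\<in>I. \<forall>x\<in>coset_verts i. h i (g i x) = x \<and> g i (h i x) = x"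
proof -
  assume "g \<in> acts m"
  then obtain a k where *: "a \<in> level m" "g = act a k" by (auto simp: acts_def)
  have "act (- (monomial (\<lambda>j. - k j) * a)) (\<lambda>j. - k j) \<in> acts m"
    using level_uminus[OF level_monomial[OF *(1)]] by (auto simp: acts_def)
  then show ?thesis by (rule bexI[rotated]) (simp add: *(2) act_inverse)
qed

text \<open>Fixing the base cosets forces the exponents on \<open>I\<close> to be 0 and the
  translation part to be regular everywhere, and translations that differ by null elements act
  alike. The restriction to \<open>I\<close> discards exponents outside it, which are
  arbitrary.\<close>

lemma finite_acts_stabiliser:
  "finite ((\<lambda>g. \<lambda>i\<in>I. restrict (g i) (coset_verts i)) ` {g \<in> acts m. \<forall>i\<in>I. g i (0, coset i 0 0) = (0, coset i 0 0)})"
proof -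
  let ?R = "\<lambda>g. \<lambda>i\<in>I. restrict (g i) (coset_verts i)"
  obtain F where F: "finite F" "\<forall>x\<in>level m. (\<forall>i\<in>I. x \<in> reg i) \<longrightarrow> (\<exists>y\<in>F. \<forall>i\<in>I. x - y \<in> null i)"
    using finite_stabiliser by blast
  have "?R ` {g \<in> acts m. \<forall>i\<in>I. g i (0, coset i 0 0) = (0, coset i 0 0)} \<subseteq> (\<lambda>y. ?R (act y (\<lambda>_. 0))) ` F"
  proof
    fix z assume "z \<in> ?R ` {g \<in> acts m. \<forall>i\<in>I. g i (0, coset i 0 0) = (0, coset i 0 0)}"
    then obtain a k where a: "a \<in> level m" "z = ?R (act a k)"
      "\<forall>i\<in>I. act a k i (0, coset i 0 0) = (0, coset i 0 0)" by (auto simp: acts_def)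
    have k: "k i = 0" and aR: "a \<in> reg i" if "i \<in> I" for i
      using a(3) that by (auto simp: act_coset coset_eq_iff)
    then obtain y where y: "y \<in> F" "\<forall>i\<in>I. a - y \<in> null i" using F(2) a(1) by blast
    have "act a k i x = act y (\<lambda>_. 0) i x" if i: "i \<in> I" "x \<in> coset_verts i" for i x
    proof -
      obtain c e where x: "x = (c, coset i c e)" using i(2) by (auto simp: coset_verts_def)
      have "(a - y) / t i powi c \<in> reg i" using y(2) i(1) by (simp add: null_def)
      then have "coset i c (a + e) = coset i c (y + e)" by (simp add: coset_eq_iff)
      then show ?thesis using i(1) k by (simp add: x act_coset monomial_0)
    qed
    then have eq: "restrict (act a k i) (coset_verts i) = restrict (act y (\<lambda>_. 0) i) (coset_verts i)" if "i \<in> I" for i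
      using that by (intro restrict_ext)
    have "z = ?R (act y (\<lambda>_. 0))" unfolding a(2) by (rule restrict_ext) (rule eq)
    then show "z \<in> (\<lambda>y. ?R (act y (\<lambda>_. 0))) ` F" using y(1) by (rule image_eqI)
  qed
  then show ?thesis by (rule finite_subset) (rule finite_imageI[OF F(1)])
qed

text \<open>Keeping the representative and changing only the level is a walk; at level 0 a regular
  representative gives the base coset.\<close>

lemma coset_reachable:
  assumes i: "i \<in> I" and a: "a \<in> reg i"
  shows "((0, coset i 0 0), (c, coset i c a)) \<in> {(x, y). y \<in> adj i x}\<^sup>*"
proof (induction c rule: int_induct[of _ 0])
  case base
  have "coset i 0 a = coset i 0 0" using a by (simp add: coset_eq_iff)
  then show ?case by simp
next
  case (step1 c)
  have "(c + 1, coset i (c + 1) a) \<in> adj i (c, coset i c a)"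
    using coset_self[of a i c] by (auto simp: adj_def shift_def)
  then show ?case using step1 by (auto intro: rtrancl_into_rtrancl)
next
  case (step2 c)
  have "(c - 1, coset i (c - 1) a) \<in> adj i (c, coset i c a)"
    using coset_self[of a i c] by (auto simp: adj_def shift_def)
  then show ?case using step2 by (auto intro: rtrancl_into_rtrancl)
qed

text \<open>Division by \<open>t j ^ l\<close>, a unit of \<open>reg i\<close>, reduces the claim to
  \<open>t_power_nontrivial\<close>.\<close>

lemma t_powers_differ:
  assumes i: "i \<in> I" and j: "j \<in> I" "i \<noteq> j" and l: "l < l'"
  shows "\<exists>c. (t j ^ l' - t j ^ l) / t i powi c \<notin> reg i"
proof -
  have "t j ^ (l' - l) - 1 \<notin> null i" using t_power_nontrivial[OF i j(1)] l by simp
  then obtain c where c: "(t j ^ (l' - l) - 1) / t i powi c \<notin> reg i" by (auto simp: null_def)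
  have "(t j ^ l' - t j ^ l) / t i powi c \<notin> reg i"
  proof
    assume *: "(t j ^ l' - t j ^ l) / t i powi c \<in> reg i"
    have "(t j ^ (l' - l) - 1) / t i powi c \<in> reg i"
      using reg_mult[OF reg_power[OF t_reg(2)[OF i j]] *, of l]
      by (simp only: power_diff_quotient[OF t_nz[OF j(1)] less_imp_le[OF l]])
    with c show False by (rule notE)
  qed
  then show ?thesis ..
qed

end

section \<open>Lattice chains\<close>

lemma out_arcs_with_proj: "out_arcs (with_proj T) u = Pair u ` nbrs T u"
  by (auto simp: out_arcs_def nbrs_def)

lemma card_nbrs_regular_tree:
  assumes "regular_tree k T" "u \<in> pverts T"
  shows "finite (nbrs T u) \<and> card (nbrs T u) = k"
proof -
  have inj: "inj_on (Pair u) (nbrs T u)" by (simp add: inj_on_def)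
  have out: "finite (out_arcs (with_proj T) u)" "card (out_arcs (with_proj T) u) = k"
    using assms by (auto simp: regular_tree_def out_degree_def)
  have "finite (nbrs T u)" using out(1) unfolding out_arcs_with_proj by (rule finite_imageD[OF _ inj])
  moreover have "card (nbrs T u) = k" using out(2) unfolding out_arcs_with_proj card_image[OF inj] .
  ultimately show ?thesis ..
qed

text \<open>The elements sought are close to the identity yet move something in every coordinate
  except \<open>j\<close>, so one family settles the projections to all nonempty sets of coordinates
  avoiding \<open>j\<close>.\<close>

definition nearly_trivial_outside ::
    "'i set \<Rightarrow> ('i \<Rightarrow> 'v pair_pre_digraph) \<Rightarrow> 'i \<Rightarrow> ('i \<Rightarrow> 'v \<Rightarrow> 'v) set \<Rightarrow> bool" where
  "nearly_trivial_outside I T j \<Gamma> \<longleftrightarrow>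
     (\<forall>F. (\<forall>i\<in>I - {j}. finite (F i) \<and> F i \<subseteq> pverts (T i)) \<longrightarrow>
       (\<exists>\<gamma>\<in>\<Gamma>. (\<forall>i\<in>I - {j}. \<forall>u\<in>F i. \<gamma> i u = u) \<and> (\<forall>i\<in>I - {j}. \<exists>u\<in>pverts (T i). \<gamma> i u \<noteq> u)))"

lemma nearly_trivial_outsideD:
  assumes "nearly_trivial_outside I T j \<Gamma>" "\<forall>i\<in>I - {j}. finite (F i) \<and> F i \<subseteq> pverts (T i)"
  shows "\<exists>\<gamma>\<in>\<Gamma>. (\<forall>i\<in>I - {j}. \<forall>u\<in>F i. \<gamma> i u = u) \<and> (\<forall>i\<in>I - {j}. \<exists>u\<in>pverts (T i). \<gamma> i u \<noteq> u)"
  using spec[OF assms(1)[unfolded nearly_trivial_outside_def], of F] assms(2) by (rule mp)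

lemma nondiscrete_projection:
  assumes J: "finite J" "J \<noteq> {}" "J \<subseteq> I - {j}" and \<Gamma>: "subgroup \<Gamma> (prod_aut_group I T)"
    and near: "nearly_trivial_outside I T j \<Gamma>"
  shows "\<not> discrete_in (prod_aut_topology J T) ((\<lambda>g. restrict g J) ` \<Gamma>)"
proof (rule not_discrete_prod_aut[OF J(1)])
  let ?S = "(\<lambda>g. restrict g J) ` \<Gamma>"
  show "?S \<subseteq> carrier (prod_aut_group J T)"
  proof
    fix h assume "h \<in> ?S"
    then obtain g where g: "g \<in> \<Gamma>" "h = restrict g J" by (elim imageE) (rule that)
    have "g \<in> carrier (prod_aut_group I T)" using subgroup.subset[OF \<Gamma>] g(1) by (rule subsetD)
    then have "g i \<in> graph_auts (T i)" if "i \<in> J" for i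
      using prod_aut_mem[of g I T i] that J(3) by auto
    then show "h \<in> carrier (prod_aut_group J T)" by (simp add: g(2) carrier_prod_aut_group)
  qed
  show "restrict \<one>\<^bsub>prod_aut_group I T\<^esub> J \<in> ?S" using subgroup.one_closed[OF \<Gamma>] by (rule imageI)
  fix F assume F: "\<forall>i\<in>J. finite (F i) \<and> F i \<subseteq> pverts (T i)"
  define F' where "F' i = (if i \<in> J then F i else {})" for i
  have "\<forall>i\<in>I - {j}. finite (F' i) \<and> F' i \<subseteq> pverts (T i)" using F by (simp add: F'_def)
  from nearly_trivial_outsideD[OF near this] obtain \<gamma> where \<gamma>: "\<gamma> \<in> \<Gamma>" "\<forall>i\<in>I - {j}. \<forall>u\<in>F' i. \<gamma> i u = u"
    "\<forall>i\<in>I - {j}. \<exists>u\<in>pverts (T i). \<gamma> i u \<noteq> u" by (elim bexE conjE) (rule that)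
  obtain i where i: "i \<in> J" using J(2) by blast
  then have iI: "i \<in> I - {j}" using J(3) by blast
  from bspec[OF \<gamma>(3) iI] obtain u where u: "u \<in> pverts (T i)" "\<gamma> i u \<noteq> u" by (elim bexE) (rule that)
  have one: "\<one>\<^bsub>prod_aut_group I T\<^esub> i u = u" if "i \<in> J" "u \<in> pverts (T i)" for i u
    using that J(3) by (intro prod_aut_one) auto
  show "\<exists>h\<in>?S. h \<noteq> restrict \<one>\<^bsub>prod_aut_group I T\<^esub> J \<and>
      (\<forall>i\<in>J. \<forall>u\<in>F i. h i u = restrict \<one>\<^bsub>prod_aut_group I T\<^esub> J i u)"
  proof (intro bexI[of _ "restrict \<gamma> J"] conjI ballI)
    show "restrict \<gamma> J \<noteq> restrict \<one>\<^bsub>prod_aut_group I T\<^esub> J"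
    proof
      assume "restrict \<gamma> J = restrict \<one>\<^bsub>prod_aut_group I T\<^esub> J"
      from fun_cong[OF fun_cong[OF this, of i], of u] show False using u one[OF i u(1)] i by simp
    qed
    show "restrict \<gamma> J \<in> ?S" using \<gamma>(1) by (rule imageI)
    fix i u assume iu: "i \<in> J" "u \<in> F i"
    have "i \<in> I - {j}" "u \<in> F' i" using iu J(3) by (auto simp: F'_def)
    then have "\<gamma> i u = u" using \<gamma>(2) by simp
    moreover have "u \<in> pverts (T i)" using F iu by auto
    ultimately show "restrict \<gamma> J i u = restrict \<one>\<^bsub>prod_aut_group I T\<^esub> J i u"
      using one[of i u] iu(1) by simp
  qed
qed

lemma nondiscrete_coordinate:
  assumes i: "i \<in> I" "i \<noteq> j" and \<Gamma>: "subgroup \<Gamma> (prod_aut_group I T)"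
    and near: "nearly_trivial_outside I T j \<Gamma>"
  shows "\<not> discrete_in (aut_topology (T i)) ((\<lambda>g. g i) ` \<Gamma>)"
proof (rule not_discrete_aut)
  let ?S = "(\<lambda>g. g i) ` \<Gamma>"
  have iI: "i \<in> I - {j}" using i by simp
  show "?S \<subseteq> graph_auts (T i)"
  proof
    fix h assume "h \<in> ?S"
    then obtain g where g: "g \<in> \<Gamma>" "h = g i" by (elim imageE) (rule that)
    have "g \<in> carrier (prod_aut_group I T)" using subgroup.subset[OF \<Gamma>] g(1) by (rule subsetD)
    then show "h \<in> graph_auts (T i)" unfolding g(2) using i(1) by (rule prod_aut_mem)
  qed
  show "\<one>\<^bsub>prod_aut_group I T\<^esub> i \<in> ?S" using subgroup.one_closed[OF \<Gamma>] by (rule imageI)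
  fix F assume F: "finite F" "F \<subseteq> pverts (T i)"
  define F' where "F' k = (if k = i then F else {})" for k
  have "\<forall>k\<in>I - {j}. finite (F' k) \<and> F' k \<subseteq> pverts (T k)" using F by (simp add: F'_def)
  from nearly_trivial_outsideD[OF near this] obtain \<gamma> where \<gamma>: "\<gamma> \<in> \<Gamma>" "\<forall>i\<in>I - {j}. \<forall>u\<in>F' i. \<gamma> i u = u"
    "\<forall>i\<in>I - {j}. \<exists>u\<in>pverts (T i). \<gamma> i u \<noteq> u" by (elim bexE conjE) (rule that)
  from bspec[OF \<gamma>(3) iI] obtain u where u: "u \<in> pverts (T i)" "\<gamma> i u \<noteq> u" by (elim bexE) (rule that)
  show "\<exists>h\<in>?S. h \<noteq> \<one>\<^bsub>prod_aut_group I T\<^esub> i \<and> (\<forall>u\<in>F. h u = \<one>\<^bsub>prod_aut_group I T\<^esub> i u)"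
  proof (intro bexI[of _ "\<gamma> i"] conjI ballI)
    show "\<gamma> i \<noteq> \<one>\<^bsub>prod_aut_group I T\<^esub> i"
    proof
      assume "\<gamma> i = \<one>\<^bsub>prod_aut_group I T\<^esub> i"
      from fun_cong[OF this, of u] show False using u prod_aut_one[of i I u T] i(1) by simp
    qed
    show "\<gamma> i \<in> ?S" using \<gamma>(1) by (rule imageI)
    fix u assume u: "u \<in> F"
    then have "\<gamma> i u = u" using bspec[OF \<gamma>(2) iI] by (simp add: F'_def)
    moreover have "u \<in> pverts (T i)" using F(2) u by (rule subsetD)
    ultimately show "\<gamma> i u = \<one>\<^bsub>prod_aut_group I T\<^esub> i u" using prod_aut_one[of i I u T] i(1) by simp
  qed
qed

context place_system
begin

lemma acts_mono: "acts m \<subseteq> acts (Suc m)"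
  using level_Suc[of m] by (auto simp: acts_def)

theorem lattice_chain:
  fixes T :: "nat \<Rightarrow> 'v pair_pre_digraph"
  assumes T: "\<And>i. i \<in> I \<Longrightarrow> regular_tree (2 * nat b ^ degree (p i)) (T i)"
  obtains \<Gamma> where "ascending_lattice_chain I T \<Gamma>"
    "\<forall>m. \<forall>j\<in>I. nearly_trivial_outside I T j (\<Gamma> m)"
proof -
  have tree: "tree_graph (T i)" if "i \<in> I" for i
    using T[OF that] by (simp add: tree_graph_def regular_tree_def)
  have nbrs: "finite (nbrs (T i) u) \<and> card (nbrs (T i) u) = 2 * nat b ^ degree (p i)"
    if "i \<in> I" "u \<in> pverts (T i)" for i u
    using T[OF that(1)] that(2) by (rule card_nbrs_regular_tree)
  have "\<forall>i\<in>I. \<exists>v. v \<in> pverts (T i)"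
    using tree_graph.verts_nonempty[OF tree] by (simp add: ex_in_conv)
  from bchoice[OF this] obtain v0 where v0: "\<forall>i\<in>I. v0 i \<in> pverts (T i)" ..
  have "\<forall>i\<in>I. \<exists>\<pi>. tree_graph.covering (T i) (adj i) \<pi> \<and> \<pi> (v0 i) = (0, coset i 0 0) \<and> \<pi> ` pverts (T i) \<subseteq> coset_verts i"
  proof
    fix i assume i: "i \<in> I"
    have x0: "(0, coset i 0 0) \<in> coset_verts i" by (auto simp: coset_verts_def)
    have E: "finite (adj i x) \<and> card (adj i x) = 2 * nat b ^ degree (p i) \<and> adj i x \<subseteq> coset_verts i"
      if "x \<in> coset_verts i" for x
      using card_adj[OF i that] adj_verts[OF i that] by simp
    show "\<exists>\<pi>. tree_graph.covering (T i) (adj i) \<pi> \<and> \<pi> (v0 i) = (0, coset i 0 0) \<and> \<pi> ` pverts (T i) \<subseteq> coset_verts i"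
    proof (rule tree_graph.covering_exists[OF tree[OF i] bspec[OF v0 i] x0 nbrs[OF i] E adj_sym])
      fix \<pi> assume "tree_graph.covering (T i) (adj i) \<pi>" "\<pi> (v0 i) = (0, coset i 0 0)" "\<pi> ` pverts (T i) \<subseteq> coset_verts i"
      then show ?thesis by (intro exI[of _ \<pi>] conjI)
    qed assumption+
  qed
  from bchoice[OF this] obtain \<pi> where \<pi>: "\<forall>i\<in>I. tree_graph.covering (T i) (adj i) (\<pi> i) \<and>
      \<pi> i (v0 i) = (0, coset i 0 0) \<and> \<pi> i ` pverts (T i) \<subseteq> coset_verts i" ..
  interpret C: covering_action I T v0 coset_verts adj \<pi>
  proof (intro covering_action.intro tree_product.intro covering_action_axioms.intro fin_I)
    show "locally_finite_tree (T i)" if "i \<in> I" for i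
      using tree[OF that] nbrs[OF that] by (intro locally_finite_tree.intro locally_finite_tree_axioms.intro) simp_all
    show "v0 i \<in> pverts (T i)" if "i \<in> I" for i using v0 that by (rule bspec)
    show "tree_graph.covering (T i) (adj i) (\<pi> i)" if "i \<in> I" for i using bspec[OF \<pi> that] by (rule conjunct1)
    show "\<pi> i u \<in> coset_verts i" if "i \<in> I" "u \<in> pverts (T i)" for i u
      using bspec[OF \<pi> that(1)] that(2) by (simp add: image_subset_iff)
  qed
  have base: "\<pi> i (v0 i) = (0, coset i 0 0)" if "i \<in> I" for i using bspec[OF \<pi> that] by simp
  have comp: "(c, coset i c a) \<in> C.component i" if "i \<in> I" "a \<in> reg i" for i c a
    unfolding C.component_def mem_Collect_eq base[OF that(1)] by (rule coset_reachable[OF that])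
  have act: "C.transitive_action (acts m)" for m
    unfolding C.transitive_action_def
  proof (intro conjI ballI allI impI)
    fix g i x assume "g \<in> acts m" and i: "i \<in> I" and x: "x \<in> coset_verts i"
    from this(1) obtain a k where g: "g = act a k" "a \<in> level m" by (rule acts_cases)
    show "g i x \<in> coset_verts i"
      unfolding g(1) using i subsetD[OF level_K g(2)] x by (rule act_verts)
    show "bij_betw (g i) (adj i x) (adj i (g i x))" unfolding g(1) by (rule act_adj[OF i])
  next
    fix g h assume "g \<in> acts m" "h \<in> acts m"
    then show "\<exists>k\<in>acts m. \<forall>i\<in>I. \<forall>x\<in>coset_verts i. k i x = g i (h i x)" by (rule acts_mult)
  next
    fix g assume "g \<in> acts m"
    then show "\<exists>h\<in>acts m. \<forall>i\<in>I. \<forall>x\<in>coset_verts i. h i (g i x) = x \<and> g i (h i x) = x"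
      by (rule acts_inverse)
  next
    fix x y assume xy: "\<forall>i\<in>I. x i \<in> coset_verts i \<and> y i \<in> coset_verts i"
    have "x i \<in> coset_verts i" "y i \<in> coset_verts i" if "i \<in> I" for i using bspec[OF xy that] by simp_all
    then obtain g where "g \<in> acts m" "\<forall>i\<in>I. g i (x i) = y i" by (rule acts_transitive)
    then show "\<exists>g\<in>acts m. \<forall>i\<in>I. g i (x i) = y i" by (intro bexI[of _ g])
  qed
  have fin: "finite (C.stab \<inter> C.lifts (acts m))" for m
  proof (rule C.finite_stab_lifts)
    have "{g \<in> acts m. \<forall>i\<in>I. g i (\<pi> i (v0 i)) = \<pi> i (v0 i)} = {g \<in> acts m. \<forall>i\<in>I. g i (0, coset i 0 0) = (0, coset i 0 0)}"
      by (intro Collect_cong conj_cong ball_cong refl) (simp add: base)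
    then show "finite ((\<lambda>g. \<lambda>i\<in>I. restrict (g i) (coset_verts i)) ` {g \<in> acts m. \<forall>i\<in>I. g i (\<pi> i (v0 i)) = \<pi> i (v0 i)})"
      using finite_acts_stabiliser by simp
  qed
  have strict: "C.lifts (acts m) \<subset> C.lifts (acts (Suc m))" for m
  proof -
    obtain a where a: "a \<in> level (Suc m)" "\<forall>i\<in>I. a \<in> reg i" "\<forall>x\<in>level m. a - x \<notin> null 1"
      using strict_step[of m] by (elim bexE conjE) (rule that)
    show ?thesis
    proof (rule C.lifts_psubset[OF acts_mono act, of "act a (\<lambda>_. 0)"])
      show "act a (\<lambda>_. 0) \<in> acts (Suc m)" using a(1) by (auto simp: acts_def)
      show "act a (\<lambda>_. 0) i (\<pi> i (v0 i)) = \<pi> i (v0 i)" if "i \<in> I" for i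
        using bspec[OF a(2) that] by (simp add: base[OF that] act_coset[OF that] coset_eq_iff)
      fix g assume "g \<in> acts m"
      then obtain x k where g: "g = act x k" "x \<in> level m" by (rule acts_cases)
      obtain c where c: "(a - x) / t 1 powi c \<notin> reg 1" using bspec[OF a(3) g(2)] by (auto simp: null_def)
      \<comment> \<open>The coset of 0 separates the two maps: a nonzero exponent of
        \<open>g\<close> at 1 changes the level, and otherwise the images are the distinct cosets of
        \<open>a\<close> and \<open>x\<close>.\<close>
      have "act a (\<lambda>_. 0) 1 (c, coset 1 c 0) \<noteq> g 1 (c, coset 1 c 0)"
        using c by (auto simp: g(1) act_coset[OF one_I] coset_eq_iff simp del: One_nat_def)
      then show "\<exists>i\<in>I. \<exists>x\<in>C.component i. act a (\<lambda>_. 0) i x \<noteq> g i x"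
        using one_I comp[OF one_I reg_0, of c] by (intro bexI)
    qed
  qed
  have near: "nearly_trivial_outside I T j (C.lifts (acts m))" if j: "j \<in> I" for m j
    unfolding nearly_trivial_outside_def
  proof (intro allI impI)
    fix F assume F: "\<forall>i\<in>I - {j}. finite (F i) \<and> F i \<subseteq> pverts (T i)"
    define e where "e l i = (if i = j then int l else 0)" for l i
    have e: "monomial (e l) = t j ^ l" for l
      unfolding monomial_split[OF j] e_def by (simp add: prod.neutral)
    have at: "act 0 (e l) i (c, coset i c x) = (c + e l i, coset i (c + e l i) (t j ^ l * x))" if "i \<in> I" for l i c x
      by (simp add: act_coset[OF that] e)
    show "\<exists>\<gamma>\<in>C.lifts (acts m). (\<forall>i\<in>I - {j}. \<forall>u\<in>F i. \<gamma> i u = u) \<and> (\<forall>i\<in>I - {j}. \<exists>u\<in>pverts (T i). \<gamma> i u \<noteq> u)"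
    proof (rule C.near_identity[OF act j, of "\<lambda>l. act 0 (e l)" m F])
      show "act 0 (e l) \<in> acts m" for l using level_0 by (auto simp: acts_def)
      show "act 0 (e l) j (\<pi> j (v0 j)) \<in> C.component j" for l
        using comp[OF j reg_0] by (simp add: base[OF j] at[OF j])
      show "act 0 (e l) i (\<pi> i (v0 i)) = \<pi> i (v0 i)" if "i \<in> I" "i \<noteq> j" for l i
        using that(2) by (simp add: base[OF that(1)] at[OF that(1)] e_def)
      show "\<exists>x\<in>C.component i. act 0 (e l) i x \<noteq> act 0 (e l') i x" if i: "i \<in> I" "i \<noteq> j" and l: "l \<noteq> l'" for l l' i
      proof -
        have "\<exists>c. (t j ^ l - t j ^ l') / t i powi c \<notin> reg i"
        proof (cases "l < l'")
          case True
          obtain c where c: "(t j ^ l' - t j ^ l) / t i powi c \<notin> reg i"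
            using t_powers_differ[OF i(1) j i(2) True] by (elim exE) (rule that)
          have "- ((t j ^ l - t j ^ l') / t i powi c) = (t j ^ l' - t j ^ l) / t i powi c"
            by (simp only: minus_divide_left minus_diff_eq)
          then have "(t j ^ l - t j ^ l') / t i powi c \<notin> reg i" using c reg_uminus by metis
          then show ?thesis by (rule exI)
        next
          case False
          then have "l' < l" using l by simp
          then show ?thesis by (rule t_powers_differ[OF i(1) j i(2)])
        qed
        then obtain c where c: "(t j ^ l - t j ^ l') / t i powi c \<notin> reg i" by (elim exE) (rule that)
        \<comment> \<open>The cosets of 0 are fixed by these pure multiplications in coordinate
          \<open>i\<close>; those of 1 move to the cosets of the powers of
          \<open>t j\<close>.\<close>
        have "act 0 (e l) i (c, coset i c 1) \<noteq> act 0 (e l') i (c, coset i c 1)"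
          using c i by (simp add: at e_def coset_eq_iff)
        then show ?thesis using comp[OF i(1) reg_1, of c] by (rule bexI)
      qed
      show "finite (F i) \<and> F i \<subseteq> pverts (T i)" if "i \<in> I" "i \<noteq> j" for i
        using F that by simp
      fix \<gamma> assume \<gamma>: "\<gamma> \<in> C.lifts (acts m)" "\<And>i u. i \<in> I \<Longrightarrow> i \<noteq> j \<Longrightarrow> u \<in> F i \<Longrightarrow> \<gamma> i u = u"
        "\<And>i. i \<in> I \<Longrightarrow> i \<noteq> j \<Longrightarrow> \<exists>u\<in>pverts (T i). \<gamma> i u \<noteq> u"
      show ?thesis using \<gamma>(1)
        by (rule bexI[rotated]) (simp add: \<gamma>(2,3))
    qed
  qed
  show ?thesis
  proof (rule that[of "\<lambda>m. C.lifts (acts m)"])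
    show "ascending_lattice_chain I T (\<lambda>m. C.lifts (acts m))"
      unfolding ascending_lattice_chain_def
      using C.cocompact_lattice_criterion[OF C.subgroup_lifts[OF act] C.vertex_transitive_lifts[OF act] fin]
        C.vertex_transitive_lifts[OF act] strict by simp
  qed (simp add: near)
qed

end

section \<open>Two families of places\<close>

lemma monic_add:
  assumes "monic f" "degree g < degree f"
  shows "monic (f + g)" "degree (f + g) = degree f"
proof -
  show deg: "degree (f + g) = degree f" using assms(2) by (rule degree_add_eq_left)
  show "monic (f + g)" using assms by (simp add: deg coeff_eq_0)
qed

lemma monic_add_int:
  assumes "monic f" "degree f > 0"
  shows "monic (f + of_int c)" "degree (f + of_int c) = degree f"
  using monic_add[OF assms(1), of "of_int c"] assms(2) by (simp_all add: of_int_poly)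

lemma monic_X:
  "monic (monom 1 1)" "degree (monom 1 1 :: int poly) = 1"
  "monic (monom 1 1 - 1)" "degree (monom 1 1 - 1 :: int poly) = 1"
  "monic (monom 1 1 + 1)" "degree (monom 1 1 + 1 :: int poly) = 1"
proof -
  let ?x = "monom 1 1 :: int poly"
  show x: "monic ?x" "degree ?x = 1" by (simp_all add: degree_monom_eq)
  have pos: "degree ?x > 0" unfolding x(2) by simp
  have 1: "?x - 1 = ?x + of_int (- 1)" and 2: "?x + 1 = ?x + of_int 1" by simp_all
  show "monic (?x - 1)" unfolding 1 by (rule monic_add_int(1)[OF x(1) pos])
  show "degree (?x - 1) = 1" unfolding 1 monic_add_int(2)[OF x(1) pos] by (rule x(2))
  show "monic (?x + 1)" unfolding 2 by (rule monic_add_int(1)[OF x(1) pos])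
  show "degree (?x + 1) = 1" unfolding 2 monic_add_int(2)[OF x(1) pos] by (rule x(2))
qed

lemma degree_monic_mult: "monic f \<Longrightarrow> monic g \<Longrightarrow> degree (f * g) = degree f + degree g"
  by (rule degree_mult_eq) auto

lemma degree_monic_power: "monic f \<Longrightarrow> degree (f ^ n) = n * degree f"
  by (rule degree_power_eq) auto

lemma comaximal_modI: "u * f + v * g = 1 + of_int b * z \<Longrightarrow> comaximal_mod b f g"
  unfolding comaximal_mod_def by (intro exI[of _ u] exI[of _ v] exI[of _ z]) (simp add: of_int_poly)

lemma comaximal_mod_dvd:
  assumes "f dvd g - 1"
  shows "comaximal_mod b f g"
proof -
  obtain h where h: "g - 1 = f * h" using assms by (rule dvdE)
  have "(- h) * f + 1 * g = 1 + of_int b * 0" using h by (simp add: algebra_simps)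
  then show ?thesis by (rule comaximal_modI)
qed

lemma ascending_chain_subgroup:
  assumes "ascending_lattice_chain I T \<Gamma>"
  shows "subgroup (\<Gamma> m) (prod_aut_group I T)"
  using assms by (simp add: ascending_lattice_chain_def cocompact_lattice_in_def lattice_in_def)

text \<open>Sylvester's recursion: each term is 1 modulo every earlier one.\<close>

fun sylvester :: "nat \<Rightarrow> int poly" where
  "sylvester 0 = monom 1 1"
| "sylvester (Suc k) = sylvester k * (sylvester k - 1) + 1"

lemma monic_sylvester: "monic (sylvester k) \<and> degree (sylvester k) = 2 ^ k"
proof (induction k)
  case 0
  show ?case by (simp add: degree_monom_eq)
next
  case (Suc k)
  let ?f = "sylvester k"
  note f = conjunct1[OF Suc] conjunct2[OF Suc]
  have pos: "degree ?f > 0" using f(2) by simp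
  have g: "monic (?f - 1)" "degree (?f - 1) = degree ?f"
    using monic_add_int[OF f(1) pos, of "- 1"] by simp_all
  have fg: "monic (?f * (?f - 1))" by (rule monic_mult[OF f(1) g(1)])
  have deg: "degree (?f * (?f - 1)) = 2 * 2 ^ k"
    unfolding degree_monic_mult[OF f(1) g(1)] g(2) f(2) by simp
  have pos': "degree (?f * (?f - 1)) > 0" unfolding deg by simp
  have rec: "sylvester (Suc k) = ?f * (?f - 1) + of_int 1" by simp
  show ?case
  proof
    show "monic (sylvester (Suc k))" unfolding rec by (rule monic_add_int(1)[OF fg pos'])
    show "degree (sylvester (Suc k)) = 2 ^ Suc k"
      unfolding rec monic_add_int(2)[OF fg pos'] deg by simp
  qed
qed

lemma sylvester_dvd: "j < k \<Longrightarrow> sylvester j dvd sylvester k - 1"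
proof (induction k)
  case (Suc k)
  have "sylvester j dvd sylvester k * (sylvester k - 1)"
  proof (cases "j = k")
    case False
    then have "sylvester j dvd sylvester k - 1" using Suc by simp
    then show ?thesis by (rule dvd_mult)
  qed simp
  then show ?case by simp
qed simp

lemma comaximal_sylvester: "j \<noteq> k \<Longrightarrow> comaximal_mod b (sylvester j ^ m) (sylvester k ^ n)"
proof (rule comaximal_mod_power2)
  assume "j \<noteq> k"
  then consider "j < k" | "k < j" by linarith
  then show "comaximal_mod b (sylvester j) (sylvester k)"
  proof cases
    case 1
    then show ?thesis by (intro comaximal_mod_dvd sylvester_dvd)
  next
    case 2
    then have "comaximal_mod b (sylvester k) (sylvester j)" by (intro comaximal_mod_dvd sylvester_dvd)
    then show ?thesis using comaximal_mod_commute by metis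
  qed
qed

declare sylvester.simps(2) [simp del]

text \<open>Even indices serve for zeros and odd ones for poles, with index 1 kept for
  \<open>s\<close>. Since the degree doubles at each index, squaring the polynomial at
  \<open>2 * i\<close> matches the degree at \<open>2 * i + 1\<close>. The trivial exponents give
  all polynomials one shape.\<close>

definition sylvester_p :: "nat \<Rightarrow> int poly" where
  "sylvester_p i = (if i = 1 then sylvester 0 ^ 1 else sylvester (2 * i) ^ 2)"

definition sylvester_r :: "nat \<Rightarrow> int poly" where
  "sylvester_r i = (if i = 1 then 1 else sylvester (2 * i + 1) ^ 1)"

lemma sylvester_p_eq: "sylvester_p i = sylvester (if i = 1 then 0 else 2 * i) ^ (if i = 1 then 1 else 2)"
  by (simp add: sylvester_p_def)

lemma sylvester_p_even:
  obtains k m where "sylvester_p i = sylvester (2 * k) ^ m"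
proof (cases "i = 1")
  case True
  then have "sylvester_p i = sylvester (2 * 0) ^ 1" by (simp add: sylvester_p_def)
  then show ?thesis by (rule that)
next
  case False
  then have "sylvester_p i = sylvester (2 * i) ^ 2" by (simp add: sylvester_p_def)
  then show ?thesis by (rule that)
qed

lemma degree_sylvester_power: "degree (sylvester k ^ n) = n * 2 ^ k"
  unfolding degree_monic_power[OF conjunct1[OF monic_sylvester]] conjunct2[OF monic_sylvester] ..

lemma monic_sylvester_power: "monic (sylvester k ^ n)"
  by (rule monic_power[OF conjunct1[OF monic_sylvester]])

lemma place_system_sylvester:
  assumes "b \<ge> 2" "n \<ge> 1"
  shows "place_system b {1..n} sylvester_p sylvester_r (sylvester 1 ^ 1)"
proof unfold_locales
  show "2 \<le> b" "finite {1..n}" "1 \<in> {1..n}" using assms by simp_all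
  show "monic (sylvester_p i)" for i
    unfolding sylvester_p_eq by (rule monic_sylvester_power)
  show "degree (sylvester_p i) > 0" for i
    unfolding sylvester_p_eq degree_sylvester_power by simp
  show "monic (sylvester_r i)" for i
  proof (cases "i = 1")
    case False
    then have "sylvester_r i = sylvester (2 * i + 1) ^ 1" by (simp add: sylvester_r_def)
    then show ?thesis by (simp only: monic_sylvester_power)
  qed (simp add: sylvester_r_def)
  show "monic (sylvester 1 ^ 1)" by (rule monic_sylvester_power)
  show "degree (sylvester 1 ^ 1) > 0" unfolding degree_sylvester_power by simp
  show "sylvester_p 1 = monom 1 1 ^ degree (sylvester_p 1)"
    by (simp add: sylvester_p_def degree_monom_eq)
  show "sylvester_r 1 = 1" by (simp add: sylvester_r_def)
  show "degree (sylvester_r i) = degree (sylvester_p i)" if "i \<noteq> 1" for i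
  proof -
    have "sylvester_r i = sylvester (2 * i + 1) ^ 1" "sylvester_p i = sylvester (2 * i) ^ 2"
      using that by (simp_all add: sylvester_r_def sylvester_p_def)
    then show ?thesis by (simp only: degree_sylvester_power) simp
  qed
  show "comaximal_mod b (sylvester_p i) (sylvester_p j)" if "i \<in> {1..n}" "j \<in> {1..n}" "i \<noteq> j" for i j
    unfolding sylvester_p_eq by (rule comaximal_sylvester) (use that in auto)
  show "comaximal_mod b (sylvester_r i) (sylvester_r j)" if "i \<in> {1..n}" "j \<in> {1..n}" "i \<noteq> j" for i j
  proof (cases "i = 1 \<or> j = 1")
    case True
    then show ?thesis using comaximal_mod_commute[of b 1] by (auto simp: sylvester_r_def)
  next
    case False
    then have "sylvester_r i = sylvester (2 * i + 1) ^ 1" "sylvester_r j = sylvester (2 * j + 1) ^ 1"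
      by (simp_all add: sylvester_r_def)
    moreover have "2 * i + 1 \<noteq> 2 * j + 1" using that(3) by simp
    ultimately show ?thesis using comaximal_sylvester by metis
  qed
  show "comaximal_mod b (sylvester_p i) (sylvester_r j)" for i j :: nat
  proof (cases "j = 1")
    case False
    then have r: "sylvester_r j = sylvester (2 * j + 1) ^ 1" by (simp add: sylvester_r_def)
    obtain k m where "sylvester_p i = sylvester (2 * k) ^ m" by (rule sylvester_p_even)
    moreover have "2 * k \<noteq> 2 * j + 1" by presburger
    ultimately show ?thesis unfolding r using comaximal_sylvester by metis
  qed (simp add: sylvester_r_def)
  show "comaximal_mod b (sylvester_p i) (sylvester 1 ^ 1)" for i
  proof -
    obtain k m where "sylvester_p i = sylvester (2 * k) ^ m" by (rule sylvester_p_even)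
    moreover have "2 * k \<noteq> 1" by presburger
    ultimately show ?thesis using comaximal_sylvester by metis
  qed
  show "comaximal_mod b (sylvester_r i) (sylvester 1 ^ 1)" if i: "i \<in> {1..n}" for i
  proof (cases "i = 1")
    case True
    then show ?thesis using comaximal_mod_commute[of b 1 "sylvester 1 ^ 1"] by (simp add: sylvester_r_def)
  next
    case False
    then have "sylvester_r i = sylvester (2 * i + 1) ^ 1" by (simp add: sylvester_r_def)
    moreover have "2 * i + 1 \<noteq> 1" using i by simp
    ultimately show ?thesis using comaximal_sylvester by metis
  qed
qed

text \<open>The zeros are 0 and 1, each with multiplicity \<open>e\<close>, and the poles are
  infinity and \<open>\<rho>\<close>. Adding 1 to the product makes \<open>s\<close> congruent to 1
  at each finite place, so only \<open>\<rho>\<close> has to be found.\<close>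

lemma place_system_pair:
  fixes x :: "int poly"
  defines "x \<equiv> monom 1 1"
  assumes b: "b \<ge> 2" and e: "e \<ge> 1" and \<rho>: "monic \<rho>" "degree \<rho> = e"
    and co: "comaximal_mod b x \<rho>" "comaximal_mod b (x - 1) \<rho>"
  shows "place_system b {1..2} (\<lambda>i. (if i = 1 then x else x - 1) ^ e) (\<lambda>i. if i = 1 then 1 else \<rho>)
    (x * (x - 1) * \<rho> + 1)"
proof -
  let ?p = "\<lambda>i::nat. (if i = 1 then x else x - 1) ^ e"
  let ?r = "\<lambda>i::nat. if i = 1 then 1 else \<rho>"
  let ?s = "x * (x - 1) * \<rho> + 1"
  note x = monic_X(1,2)[folded x_def] and y = monic_X(3,4)[folded x_def]
  have m: "monic (x * (x - 1) * \<rho>)" using x(1) y(1) \<rho>(1) by (intro monic_mult)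
  have d: "degree (x * (x - 1) * \<rho>) = 2 + e"
    unfolding degree_monic_mult[OF monic_mult[OF x(1) y(1)] \<rho>(1)] degree_monic_mult[OF x(1) y(1)]
      x(2) y(2) \<rho>(2) by simp
  have pos: "degree (x * (x - 1) * \<rho>) > 0" unfolding d by simp
  have s: "monic ?s" using monic_add_int(1)[OF m pos, of 1] by (simp only: of_int_1)
  have ds: "degree ?s = 2 + e" using monic_add_int(2)[OF m pos, of 1] unfolding d of_int_1 .
  have co_s: "comaximal_mod b f ?s" if "f dvd x * (x - 1) * \<rho>" for f
    using that by (intro comaximal_mod_dvd) simp
  have xs: "comaximal_mod b x ?s" "comaximal_mod b (x - 1) ?s" "comaximal_mod b \<rho> ?s"
    by (rule co_s, simp add: mult.assoc)+
  have "(1) * x + (- 1) * (x - 1) = 1 + of_int b * 0" by simp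
  then have xy: "comaximal_mod b x (x - 1)" by (rule comaximal_modI)
  have pow: "comaximal_mod b (f ^ e) g" if "comaximal_mod b f g" for f g
    using comaximal_mod_power2[OF that, of e 1] by simp
  have one: "comaximal_mod b 1 f" for f using comaximal_mod_commute[of b 1 f] by simp
  show ?thesis
  proof (intro place_system.intro)
    show "2 \<le> b" "finite {1..2::nat}" "1 \<in> {1..2::nat}" using b by simp_all
    have deg: "degree (?p i) = e" for i
      using degree_monic_power[OF x(1), of e] degree_monic_power[OF y(1), of e] x(2) y(2)
      by (cases "i = 1") (simp_all only: if_True if_False mult_1_right simp_thms)
    show "monic (?p i)" for i
      using monic_power[OF x(1)] monic_power[OF y(1)] by (cases "i = 1") (simp_all only: if_True if_False simp_thms)
    show "degree (?p i) > 0" for i unfolding deg using e by simp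
    show "monic (?r i)" for i using \<rho>(1) by simp
    show "monic ?s" by (rule s)
    show "degree ?s > 0" unfolding ds by simp
    show "?p 1 = monom 1 1 ^ degree (?p 1)" unfolding deg by (simp add: x_def)
    show "?r 1 = 1" by simp
    show "degree (?r i) = degree (?p i)" if "i \<noteq> 1" for i
      unfolding deg using \<rho>(2) that by simp
    show "comaximal_mod b (?p i) (?p j)" if "i \<in> {1..2}" "j \<in> {1..2}" "i \<noteq> j" for i j
    proof -
      have xy': "comaximal_mod b (x ^ e) ((x - 1) ^ e)" by (rule comaximal_mod_power2[OF xy])
      have yx': "comaximal_mod b ((x - 1) ^ e) (x ^ e)"
        by (rule comaximal_mod_commute[THEN iffD1, OF xy'])
      have "i = 1 \<and> j = 2 \<or> i = 2 \<and> j = 1" using that by auto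
      then show ?thesis
      proof (elim disjE conjE)
        assume "i = 1" "j = 2"
        then show ?thesis using xy' by simp
      next
        assume "i = 2" "j = 1"
        then show ?thesis using yx' by simp
      qed
    qed
    show "comaximal_mod b (?r i) (?r j)" if "i \<in> {1..2}" "j \<in> {1..2}" "i \<noteq> j" for i j
    proof -
      have "i = 1 \<or> j = 1" using that by auto
      then show ?thesis
      proof
        assume "i = 1"
        then show ?thesis using one by simp
      next
        assume "j = 1"
        then show ?thesis by simp
      qed
    qed
    show "comaximal_mod b (?p i) (?r j)" for i j using pow[OF co(1)] pow[OF co(2)] by simp
    show "comaximal_mod b (?p i) ?s" for i using pow[OF xs(1)] pow[OF xs(2)] by simp
    show "comaximal_mod b (?r i) ?s" for i using xs(3) one by simp
  qed
qed

lemma pair_chain: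
  fixes T :: "nat \<Rightarrow> 'v pair_pre_digraph"
  assumes b: "b \<ge> 2" and e: "e \<ge> 1" and \<rho>: "monic \<rho>" "degree \<rho> = e"
    and co: "comaximal_mod b (monom 1 1) \<rho>" "comaximal_mod b (monom 1 1 - 1) \<rho>"
    and T: "\<forall>i\<in>{1..2}. regular_tree (2 * nat b ^ e) (T i)"
  shows "\<exists>\<Gamma>. ascending_lattice_chain {1..2} T \<Gamma> \<and>
    (\<forall>m. \<forall>i\<in>{1..2}. \<not> discrete_in (aut_topology (T i)) ((\<lambda>g. g i) ` \<Gamma> m))"
proof -
  let ?p = "\<lambda>i::nat. (if i = 1 then monom 1 1 else monom 1 1 - 1 :: int poly) ^ e"
  have deg: "degree (?p i) = e" for i
    using degree_monic_power[OF monic_X(1), of e] degree_monic_power[OF monic_X(3), of e] monic_X(2,4)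
    by (cases "i = 1") (simp_all only: if_True if_False mult_1_right simp_thms)
  have T': "regular_tree (2 * nat b ^ degree (?p i)) (T i)" if "i \<in> {1..2}" for i
    unfolding deg using T that by (rule bspec)
  obtain \<Gamma> where \<Gamma>: "ascending_lattice_chain {1..2} T \<Gamma>"
    "\<forall>m. \<forall>j\<in>{1..2}. nearly_trivial_outside {1..2} T j (\<Gamma> m)"
    using place_system.lattice_chain[OF place_system_pair[OF b e \<rho> co] T'] .
  have "\<not> discrete_in (aut_topology (T i)) ((\<lambda>g. g i) ` \<Gamma> m)" if i: "i \<in> {1..2}" for m i
  proof (rule nondiscrete_coordinate[OF i _ ascending_chain_subgroup[OF \<Gamma>(1)], of "3 - i"])
    \<comment> \<open>With the indices 1 and 2, the other index is \<open>3 - i\<close>.\<close>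
    show "i \<noteq> 3 - i" using i unfolding atLeastAtMost_iff by presburger
    have "3 - i \<in> {1..2}" using i by auto
    then show "nearly_trivial_outside {1..2} T (3 - i) (\<Gamma> m)" by (rule bspec[OF spec[OF \<Gamma>(2)]])
  qed
  then show ?thesis using \<Gamma>(1) by (intro exI[of _ \<Gamma>]) simp
qed

section \<open>Choice of modulus and polynomials for the two assertions\<close>

lemma primepow_even:
  fixes q :: nat
  assumes "primepow q" "even q"
  obtains e where "e \<ge> 1" "q = 2 ^ e"
proof -
  obtain p k where p: "prime p" "k > 0" "q = p ^ k" using assms(1) by (auto simp: primepow_def)
  have "2 dvd p" using assms(2) p(3) by simp
  then have "p = 2" using p(1) primes_dvd_imp_eq two_is_prime_nat by blast
  then show ?thesis using that[of k] p(2,3) by simp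
qed

theorem corollary5p6:
  fixes q :: nat
  assumes "primepow q"
  shows
    "(\<forall>n\<ge>1. \<exists>qs :: nat \<Rightarrow> nat.
        (\<forall>i\<in>{1..n}. \<exists>e\<ge>1. qs i = q ^ e) \<and> qs 1 = q \<and>
        (\<forall>T :: nat \<Rightarrow> 'v pair_pre_digraph.
           (\<forall>i\<in>{1..n}. regular_tree (2 * qs i) (T i)) \<longrightarrow>
           (\<exists>\<Gamma>. ascending_lattice_chain {1..n} T \<Gamma> \<and>
                (\<forall>m J. J \<noteq> {} \<and> J \<subset> {1..n} \<longrightarrow>
                   \<not> discrete_in (prod_aut_topology J T) ((\<lambda>g. restrict g J) ` \<Gamma> m)))))
     \<and>
     (q \<ge> 3 \<longrightarrow>
        (\<forall>T :: nat \<Rightarrow> 'v pair_pre_digraph.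
           (\<forall>i\<in>{1..2}. regular_tree (2 * q) (T i)) \<longrightarrow>
           (\<exists>\<Gamma>. ascending_lattice_chain {1..2} T \<Gamma> \<and>
                (\<forall>m. \<forall>i\<in>{1..2}.
                   \<not> discrete_in (aut_topology (T i)) ((\<lambda>g. g i) ` \<Gamma> m)))))"
proof (intro conjI allI impI)
  fix n :: nat assume n: "n \<ge> 1"
  have q: "int q \<ge> 2" using primepow_gt_Suc_0[OF assms] by simp
  interpret place_system "int q" "{1..n}" sylvester_p sylvester_r "sylvester 1 ^ 1"
    using q n by (rule place_system_sylvester)
  let ?qs = "\<lambda>i. q ^ degree (sylvester_p i)"
  show "\<exists>qs :: nat \<Rightarrow> nat.
        (\<forall>i\<in>{1..n}. \<exists>e\<ge>1. qs i = q ^ e) \<and> qs 1 = q \<and>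
        (\<forall>T :: nat \<Rightarrow> 'v pair_pre_digraph.
           (\<forall>i\<in>{1..n}. regular_tree (2 * qs i) (T i)) \<longrightarrow>
           (\<exists>\<Gamma>. ascending_lattice_chain {1..n} T \<Gamma> \<and>
                (\<forall>m J. J \<noteq> {} \<and> J \<subset> {1..n} \<longrightarrow>
                   \<not> discrete_in (prod_aut_topology J T) ((\<lambda>g. restrict g J) ` \<Gamma> m))))"
  proof (intro exI[of _ ?qs] conjI ballI allI impI)
    fix i assume "i \<in> {1..n}"
    then have "degree (sylvester_p i) \<ge> 1" using deg_p[of i] by simp
    then show "\<exists>e\<ge>1. ?qs i = q ^ e" by (intro exI[of _ "degree (sylvester_p i)"] conjI refl)
  next
    show "?qs 1 = q" by (simp add: sylvester_p_def degree_monom_eq)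
  next
    fix T :: "nat \<Rightarrow> 'v pair_pre_digraph"
    assume T: "\<forall>i\<in>{1..n}. regular_tree (2 * ?qs i) (T i)"
    have T': "regular_tree (2 * nat (int q) ^ degree (sylvester_p i)) (T i)" if "i \<in> {1..n}" for i
      using bspec[OF T that] by simp
    obtain \<Gamma> where \<Gamma>: "ascending_lattice_chain {1..n} T \<Gamma>"
      "\<forall>m. \<forall>j\<in>{1..n}. nearly_trivial_outside {1..n} T j (\<Gamma> m)"
      using lattice_chain[OF T'] .
    have "\<not> discrete_in (prod_aut_topology J T) ((\<lambda>g. restrict g J) ` \<Gamma> m)"
      if J: "J \<noteq> {}" "J \<subset> {1..n}" for m J
    proof -
      \<comment> \<open>The powers of \<open>t j\<close> for an index outside \<open>J\<close>
        supply the elements near the identity.\<close>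
      obtain j where j: "j \<in> {1..n}" "j \<notin> J" using J(2) by blast
      have fin: "finite J" using J(2) by (meson finite_atLeastAtMost finite_subset psubset_imp_subset)
      have sub: "J \<subseteq> {1..n} - {j}" using J(2) j(2) by blast
      show ?thesis
        by (rule nondiscrete_projection[OF fin J(1) sub ascending_chain_subgroup[OF \<Gamma>(1)]])
          (use \<Gamma>(2) j(1) in simp)
    qed
    then show "\<exists>\<Gamma>. ascending_lattice_chain {1..n} T \<Gamma> \<and>
        (\<forall>m J. J \<noteq> {} \<and> J \<subset> {1..n} \<longrightarrow>
           \<not> discrete_in (prod_aut_topology J T) ((\<lambda>g. restrict g J) ` \<Gamma> m))"
      using \<Gamma>(1) by (intro exI[of _ \<Gamma>]) simp
  qed
next
  fix T :: "nat \<Rightarrow> 'v pair_pre_digraph"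
  assume q: "q \<ge> 3" and T: "\<forall>i\<in>{1..2}. regular_tree (2 * q) (T i)"
  let ?x = "monom 1 1 :: int poly"
  note x = monic_X(1,2)
  have xe: "monic (?x ^ e)" "degree (?x ^ e) = e" for e
    by (rule monic_power[OF x(1)]) (simp only: degree_monic_power[OF x(1)] x(2) mult_1_right)
  show "\<exists>\<Gamma>. ascending_lattice_chain {1..2} T \<Gamma> \<and>
      (\<forall>m. \<forall>i\<in>{1..2}. \<not> discrete_in (aut_topology (T i)) ((\<lambda>g. g i) ` \<Gamma> m))"
  \<comment> \<open>For odd \<open>q\<close> the fourth place can be \<open>- 1\<close> modulo
    \<open>q\<close>, because it differs from 1 by the unit 2. For even \<open>q\<close> the points
    1 and \<open>- 1\<close> merge modulo 2, so the modulus drops to 2 and the degree rises to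
    \<open>e\<close>.\<close>
  proof (cases "even q")
    case True
    then obtain e where e: "e \<ge> 1" "q = 2 ^ e" using primepow_even[OF assms] by blast
    have e2: "e \<ge> 2" using e q by (cases "e = 1") auto
    \<comment> \<open>Its values at 0 and 1 are 1 and 3, units modulo 2. The bound
      \<open>e \<ge> 2\<close> makes the added term of lower degree; this is where
      \<open>q = 2\<close> is excluded.\<close>
    let ?\<rho> = "?x ^ e + (?x + 1)"
    have d: "degree (?x + 1) < degree (?x ^ e)"
      unfolding xe(2) monic_X(6) using e2 by simp
    have \<rho>: "monic ?\<rho>" "degree ?\<rho> = e"
      by (rule monic_add(1)[OF xe(1) d]) (rule trans[OF monic_add(2)[OF xe(1) d] xe(2)])
    have "?x ^ e = ?x * ?x ^ (e - 1)" using e(1) by (simp flip: power_Suc)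
    then have "(- (?x ^ (e - 1) + 1)) * ?x + 1 * ?\<rho> = 1 + of_int 2 * 0" by (simp add: algebra_simps)
    then have co1: "comaximal_mod 2 ?x ?\<rho>" by (rule comaximal_modI)
    let ?S = "\<Sum>i<e. ?x ^ i"
    \<comment> \<open>Modulo \<open>x - 1\<close> the power is 1 and \<open>x + 1\<close> is 2, so
      the sum is 3, that is 1 modulo 2.\<close>
    have "?x ^ e = (?x - 1) * ?S + 1" using power_diff_1_eq[of ?x e] by (simp add: algebra_simps)
    then have "(- (?S + 1)) * (?x - 1) + 1 * ?\<rho> = 1 + of_int 2 * 1" by (simp add: algebra_simps)
    then have co2: "comaximal_mod 2 (?x - 1) ?\<rho>" by (rule comaximal_modI)
    show ?thesis
      using T by (intro pair_chain[OF _ e(1) \<rho> co1 co2]) (simp_all add: e(2))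
  next
    case False
    let ?\<rho> = "?x + 1"
    note \<rho> = monic_X(5,6)
    have "(- 1) * ?x + 1 * ?\<rho> = 1 + of_int (int q) * 0" by simp
    then have co1: "comaximal_mod (int q) ?x ?\<rho>" by (rule comaximal_modI)
    have "even (int q + 1)" using False by simp
    \<comment> \<open>\<open>h\<close> is the inverse of 2 modulo \<open>q\<close>; multiplied by
      the difference 2 of \<open>x + 1\<close> and \<open>x - 1\<close> it gives
      \<open>1 + q\<close>.\<close>
    then obtain h where h: "int q + 1 = 2 * h" by (rule evenE)
    have "2 * (of_int h :: int poly) = of_int (int q + 1)" unfolding h by simp
    then have "(- of_int h) * (?x - 1) + of_int h * ?\<rho> = 1 + of_int (int q) * 1" by (simp add: algebra_simps)
    then have co2: "comaximal_mod (int q) (?x - 1) ?\<rho>" by (rule comaximal_modI)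
    show ?thesis
      using T q by (intro pair_chain[OF _ _ \<rho> co1 co2]) simp_all
  qed
qed

end
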